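(* Let $0<\theta\le1$, $\alpha>-\frac12$ and $r>\alpha+\frac12$. Then there exist positive constants $c_1$, $C_2$ depending only on $\alpha$, $\theta$, $r$ such that for all $n\in\mathbb{N}$ $$c_1\,n^{-(r+\frac1\theta-\frac12)}\le\sigma_n(\mathcal{A}^r_{\alpha,\theta},\mathcal{B}_\alpha)_\infty\le C_2\,n^{-(r+\frac1\theta-\frac12)}.$$
   Context: $\mu_\alpha$ is the probability measure on $[-1,1]$ with $d\mu_\alpha(x)=c_\alpha(1-x^2)^\alpha dx$, $c_\alpha=(\int_{-1}^1(1-x^2)^\alpha dx)^{-1}$, with inner product $\langle f,g\rangle=\int_{-1}^1f\bar g\,d\mu_\alpha$. $\mathcal{B}_\alpha=\{L_n^\alpha\}_{n=0}^\infty$ is the system of orthonormal polynomials with respect to $\mu_\alpha$, $L_n^\alpha$ of degree $n$ (orthonormalized Gegenbauer polynomials). $\mathcal{A}^r_{\alpha,\theta}:=\{f\in\mathcal{C}[-1,1]:\sum_{n\in\mathbb{N}_0}|(1+n)^r\langle f,L_n^\alpha\rangle|^\theta\le1\}$. $\sigma_n(\mathbf{F},\mathcal{B}_\alpha)_\infty:=\sup_{f\in\mathbf{F}}\inf\{\max_{x\in[-1,1]}|f(x)-g(x)|: g=\sum_{j\in J}c_jL_j^\alpha,\ J\subset\mathbb{N}_0,\ |J|=n\}$. *)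

theory Defs
  imports "HOL-Analysis.Analysis" "HOL-Computational_Algebra.Polynomial"
begin

definition gegen_const :: "real \<Rightarrow> real" where
  "gegen_const \<alpha> = 1 / integral {-1..1} (\<lambda>x. (1 - x\<^sup>2) powr \<alpha>)"

definition gegen_weight :: "real \<Rightarrow> real \<Rightarrow> real" where
  "gegen_weight \<alpha> x = gegen_const \<alpha> * (1 - x\<^sup>2) powr \<alpha>"

definition gegen_inner :: "real \<Rightarrow> (real \<Rightarrow> complex) \<Rightarrow> (real \<Rightarrow> complex) \<Rightarrow> complex" where
  "gegen_inner \<alpha> f g =
     integral {-1..1} (\<lambda>x. complex_of_real (gegen_weight \<alpha> x) * f x * cnj (g x))"

definition is_orthonormal_poly_sys :: "real \<Rightarrow> (nat \<Rightarrow> real poly) \<Rightarrow> bool" where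
  "is_orthonormal_poly_sys \<alpha> P \<longleftrightarrow>
     (\<forall>n. degree (P n) = n \<and> lead_coeff (P n) > 0) \<and>
     (\<forall>m n. integral {-1..1} (\<lambda>x. gegen_weight \<alpha> x * poly (P m) x * poly (P n) x)
             = (if m = n then 1 else 0))"

text \<open>The orthonormalized Gegenbauer polynomials (unique system as above).\<close>
definition gegen_poly :: "real \<Rightarrow> nat \<Rightarrow> real poly" where
  "gegen_poly \<alpha> = (SOME P. is_orthonormal_poly_sys \<alpha> P)"

definition gegenL :: "real \<Rightarrow> nat \<Rightarrow> real \<Rightarrow> complex" where
  "gegenL \<alpha> n x = complex_of_real (poly (gegen_poly \<alpha> n) x)"

definition classA :: "real \<Rightarrow> real \<Rightarrow> real \<Rightarrow> (real \<Rightarrow> complex) set" where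
  "classA r \<alpha> \<theta> = {f. continuous_on {-1..1} f \<and>
      summable (\<lambda>n. norm ((1 + real n) powr r * gegen_inner \<alpha> f (gegenL \<alpha> n)) powr \<theta>) \<and>
      (\<Sum>n. norm ((1 + real n) powr r * gegen_inner \<alpha> f (gegenL \<alpha> n)) powr \<theta>) \<le> 1}"

definition sup_dist :: "(real \<Rightarrow> complex) \<Rightarrow> (real \<Rightarrow> complex) \<Rightarrow> real" where
  "sup_dist f g = Sup ((\<lambda>x. norm (f x - g x)) ` {-1..1})"

definition sigma_n :: "nat \<Rightarrow> real \<Rightarrow> (real \<Rightarrow> complex) set \<Rightarrow> real" where
  "sigma_n n \<alpha> F = Sup ((\<lambda>f. Inf {sup_dist f (\<lambda>x. \<Sum>j\<in>J. c j * gegenL \<alpha> j x) |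
        J c. finite J \<and> card J = n}) ` F)"

end

theory Submission
  imports Defs
begin

text \<open>
  The lower bound is an \<open>L\<^sub>2\<close> bound: the flat sum of the first \<open>2 n\<close> basis elements, normalized to lie in
  the class, keeps at least \<open>n\<close> of its coefficients after subtracting any combination of \<open>n\<close> elements.

  For the upper bound write \<open>lam = \<alpha> + 1/2\<close>. The Gegenbauer differential equation gives
  \<open>\<bar>L\<^sub>k (cos t)\<bar> \<le> C min (k + 1) (1 / \<bar>sin t\<bar>) powr lam\<close>, so the polynomials are large only near the endpoints,
  where a polynomial of degree \<open>2 N\<close> has few degrees of freedom. Partial colourings therefore allow one to
  round away a fixed proportion of \<open>s\<close> coefficients in a dyadic block of degrees around \<open>N\<close>, with \<open>l\<^sub>1\<close> norm
  at most 1, at the cost of a uniform error of order \<open>s powr (-1/2) (N / s) powr lam\<close>: the constraints at the grid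
  points nearest to the endpoints are much stricter than the natural fluctuation, but there are only
  about \<open>s\<close> of those. As \<open>lam > 0\<close> the errors of the iterated roundings form a geometric series, and no
  logarithm is lost. Since \<open>r > lam\<close>, the blocks above \<open>n\<close> can be given geometrically decreasing numbers of terms.
\<close>

section \<open>Discretization of the uniform norm\<close>

text \<open>Rounding s coefficients of size about 1/s moves the value at a grid point by about
  s^(-1/2) times the size of the polynomials there. With random signs alone, a union bound over the
  grid would cost a logarithm. Instead every grid point gets the same tolerance, the natural
  fluctuation at about the s-th point from an endpoint. At the g-th point with g < s the ratio of
  tolerance to fluctuation is (g/s)^lam, and its cost is only of order 1 + log (s/g), which sums to
  O(s). Beyond the s-th point the cost falls faster than any power of g/s, so those points together
  also cost O(s).

  The exponents fit as follows. A block of degrees around N has l_\<theta> norm at most about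
  N^(-r); without its x largest coefficients its l_1 norm is at most N^(-r) x^(1 - 1/\<theta>).
  Rounding the rest to x terms gives the error N^(lam - r) x^(-(lam + 1/\<theta> - 1/2)), which at x
  = N is the claimed rate.\<close>

definition fejer :: "nat \<Rightarrow> real \<Rightarrow> complex" where
  "fejer n s = (\<Sum>a<n. \<Sum>b<n. cis ((real a - real b) * s))"

text \<open>\<open>fejer n\<close> is n times the usual Fejer kernel. The double sum shows the
  coefficient at frequency j, the number of pairs with difference j; the square shows
  nonnegativity.\<close>

lemma fejer_eq: "fejer n s = complex_of_real ((cmod (\<Sum>a<n. cis (real a * s)))\<^sup>2)"
proof -
  have "fejer n s = (\<Sum>a<n. cis (real a * s)) * (\<Sum>b<n. cnj (cis (real b * s)))"
    unfolding fejer_def sum_product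
    by (intro sum.cong refl) (simp add: cis_cnj cis_mult left_diff_distrib)
  also have "\<dots> = complex_of_real ((cmod (\<Sum>a<n. cis (real a * s)))\<^sup>2)"
    by (simp only: complex_norm_square cnj_sum)
  finally show ?thesis .
qed

lemma sum_cis_grid:
  fixes l :: int
  assumes "M > 0" and "\<bar>l\<bar> < int M"
  shows "(\<Sum>i<M. cis (of_int l * (2 * pi * real i / real M))) = (if l = 0 then of_nat M else 0)"
proof (cases "l = 0")
  case False
  define w where "w = cis (of_int l * (2 * pi / real M))"
  have "w \<noteq> 1"
  proof
    assume "w = 1"
    then have "Re w = 1" by simp
    then have "cos (of_int l * (2 * pi / real M)) = 1" by (simp add: w_def)
    then obtain k :: int where "of_int l * (2 * pi / real M) = of_int k * 2 * pi"
      by (auto simp: cos_one_2pi_int)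
    then have "of_int l = real_of_int (k * int M)" using assms(1) by (simp add: field_simps)
    then have lk: "l = k * int M" by linarith
    then have "k \<noteq> 0" using False by auto
    then have "\<bar>k\<bar> * int M \<ge> 1 * int M" by (intro mult_right_mono) auto
    then show False using assms(2) lk by (simp add: abs_mult)
  qed
  have "(\<Sum>i<M. cis (of_int l * (2 * pi * real i / real M))) = (\<Sum>i<M. w ^ i)"
  proof (rule sum.cong)
    fix i
    show "cis (of_int l * (2 * pi * real i / real M)) = w ^ i"
      unfolding w_def Complex.DeMoivre by (rule arg_cong[of _ _ cis]) simp
  qed simp
  also have "\<dots> = (w ^ M - 1) / (w - 1)" using \<open>w \<noteq> 1\<close> by (simp add: geometric_sum)
  also have "w ^ M = 1"
  proof -
    have "w ^ M = cis (2 * pi * of_int l)"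
      unfolding w_def Complex.DeMoivre using assms(1) by (intro arg_cong[of _ _ cis]) simp
    then show ?thesis by (simp add: cis_multiple_2pi)
  qed
  finally show ?thesis using False by simp
qed simp

lemma card_diff_pairs:
  fixes j :: int
  assumes "\<bar>j\<bar> \<le> int n"
  shows "card {(a, b). a < n \<and> b < n \<and> int a - int b = j} = nat (int n - \<bar>j\<bar>)"
proof (cases "j \<ge> 0")
  case True
  have "{(a, b). a < n \<and> b < n \<and> int a - int b = j} = (\<lambda>b. (b + nat j, b)) ` {..<n - nat j}"
    using True by (auto simp: image_iff)
  then show ?thesis using True by (simp add: card_image inj_on_def)
next
  case False
  have "{(a, b). a < n \<and> b < n \<and> int a - int b = j} = (\<lambda>a. (a, a + nat (- j))) ` {..<n - nat (- j)}"
    using False by (auto simp: image_iff)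
  then show ?thesis using False by (simp add: card_image inj_on_def)
qed

text \<open>Discrete convolution with the kernel multiplies frequency j by its kernel coefficient.
  The grid has to be fine enough to separate j from every frequency a - b of the kernel, and these
  differ from j by less than n + |j|.\<close>

lemma fejer_grid_sum:
  fixes j :: int
  assumes "\<bar>j\<bar> \<le> int n" and "\<bar>j\<bar> + int n \<le> int M" "M > 0"
  shows "(\<Sum>i<M. cis (of_int j * (2 * pi * real i / real M)) * fejer n (t - 2 * pi * real i / real M))
     = of_nat M * of_int (int n - \<bar>j\<bar>) * cis (of_int j * t)"
proof -
  have term_eq: "cis (of_int j * x) * cis ((real a - real b) * (t - x))
      = cis ((real a - real b) * t) * cis (of_int (j - (int a - int b)) * x)" for a b x
    by (simp add: cis_mult algebra_simps)
  have "(\<Sum>i<M. cis (of_int j * (2 * pi * real i / real M)) * fejer n (t - 2 * pi * real i / real M))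
      = (\<Sum>i<M. \<Sum>a<n. \<Sum>b<n. cis ((real a - real b) * t) * cis (of_int (j - (int a - int b)) * (2 * pi * real i / real M)))"
    unfolding fejer_def sum_distrib_left term_eq ..
  also have "\<dots> = (\<Sum>a<n. \<Sum>b<n. cis ((real a - real b) * t) *
      (\<Sum>i<M. cis (of_int (j - (int a - int b)) * (2 * pi * real i / real M))))"
    unfolding sum_distrib_left
    by (rule trans[OF sum.swap], rule sum.cong, rule refl, rule sum.swap)
  also have "\<dots> = (\<Sum>a<n. \<Sum>b<n. if int a - int b = j then of_nat M * cis (of_int j * t) else 0)"
  proof (intro sum.cong refl)
    fix a b assume "a \<in> {..<n}" "b \<in> {..<n}"
    then have "\<bar>j - (int a - int b)\<bar> < int M" using assms by (simp add: abs_if split: if_splits)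
    then have "(\<Sum>i<M. cis (of_int (j - (int a - int b)) * (2 * pi * real i / real M)))
        = (if j - (int a - int b) = 0 then of_nat M else 0)"
      using assms by (intro sum_cis_grid) auto
    moreover have "real a - real b = of_int j" if "int a - int b = j" using that by auto
    ultimately show "cis ((real a - real b) * t) *
      (\<Sum>i<M. cis (of_int (j - (int a - int b)) * (2 * pi * real i / real M)))
      = (if int a - int b = j then of_nat M * cis (of_int j * t) else 0)" by auto
  qed
  also have "\<dots> = (\<Sum>(a, b)\<in>{..<n} \<times> {..<n}. if int a - int b = j then of_nat M * cis (of_int j * t) else 0)"
    by (simp add: sum.cartesian_product)
  also have "\<dots> = (\<Sum>p\<in>{(a, b). a < n \<and> b < n \<and> int a - int b = j}. of_nat M * cis (of_int j * t))"
    by (rule sum.mono_neutral_cong_right) (auto split: if_splits)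
  also have "\<dots> = of_nat (nat (int n - \<bar>j\<bar>)) * (of_nat M * cis (of_int j * t))"
    using card_diff_pairs[OF assms(1)] by simp
  finally show ?thesis using assms(1) by simp
qed

text \<open>De la Vallee-Poussin means: the kernel coefficients 2d - |j| and d - |j| differ by d
  whenever |j| \<le> d, so the difference of two discrete convolutions is M d T. The kernels are
  nonnegative with grid sums 2dM and dM, whence the factor (2d + d)/d = 3. The larger kernel needs M
  \<ge> 2d + d.\<close>

lemma trig_poly_bound_from_grid:
  fixes c :: "int \<Rightarrow> complex" and d M :: nat
  defines "T \<equiv> \<lambda>t. \<Sum>j\<in>{- int d..int d}. c j * cis (of_int j * t)"
  assumes d: "d > 0" and M: "M \<ge> 3 * d" and B: "\<And>i. i < M \<Longrightarrow> cmod (T (2 * pi * real i / real M)) \<le> B"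
  shows "cmod (T t) \<le> 3 * B"
proof -
  define x where "x i = 2 * pi * real i / real M" for i
  have M0: "M > 0" using d M by simp
  have conv: "(\<Sum>i<M. T (x i) * fejer n (t - x i)) =
      of_nat M * (\<Sum>j\<in>{- int d..int d}. of_int (int n - \<bar>j\<bar>) * (c j * cis (of_int j * t)))"
    if "d \<le> n" "n + d \<le> M" for n
  proof -
    have "(\<Sum>i<M. T (x i) * fejer n (t - x i)) =
      (\<Sum>j\<in>{- int d..int d}. c j * (\<Sum>i<M. cis (of_int j * x i) * fejer n (t - x i)))"
      unfolding T_def sum_distrib_right sum_distrib_left by (subst sum.swap) (simp add: mult_ac)
    also have "\<dots> = (\<Sum>j\<in>{- int d..int d}. c j * (of_nat M * of_int (int n - \<bar>j\<bar>) * cis (of_int j * t)))"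
      unfolding x_def using that M0 by (intro sum.cong refl arg_cong2[of _ _ _ _ "(*)"] fejer_grid_sum) auto
    finally show ?thesis by (simp add: sum_distrib_left mult_ac)
  qed
  have "(\<Sum>i<M. T (x i) * fejer (2 * d) (t - x i)) - (\<Sum>i<M. T (x i) * fejer d (t - x i))
      = of_nat M * (\<Sum>j\<in>{- int d..int d}. of_nat d * (c j * cis (of_int j * t)))"
    using M by (simp add: conv right_diff_distrib[symmetric] sum_subtractf[symmetric] left_diff_distrib[symmetric])
  then have eq: "of_nat M * of_nat d * T t
      = (\<Sum>i<M. T (x i) * fejer (2 * d) (t - x i)) - (\<Sum>i<M. T (x i) * fejer d (t - x i))"
    by (simp add: T_def sum_distrib_left mult_ac)
  have bound: "cmod (\<Sum>i<M. T (x i) * fejer n (t - x i)) \<le> B * (of_nat M * of_nat n)" if "n \<le> M" for n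
  proof -
    have total: "(\<Sum>i<M. cmod (fejer n (t - x i))) = of_nat M * of_nat n"
    proof -
      have "complex_of_real (\<Sum>i<M. cmod (fejer n (t - x i))) = (\<Sum>i<M. fejer n (t - x i))"
        by (simp add: fejer_eq norm_power)
      also have "\<dots> = of_nat M * of_nat n"
        using fejer_grid_sum[of 0 n M t] that M0 by (simp add: x_def)
      finally have "complex_of_real (\<Sum>i<M. cmod (fejer n (t - x i))) = complex_of_real (of_nat M * of_nat n)"
        by simp
      then show ?thesis by (simp only: of_real_eq_iff)
    qed
    have "cmod (\<Sum>i<M. T (x i) * fejer n (t - x i)) \<le> (\<Sum>i<M. B * cmod (fejer n (t - x i)))"
      using B by (intro sum_norm_le) (auto simp: norm_mult x_def intro!: mult_right_mono)
    then show ?thesis unfolding sum_distrib_left[symmetric] total .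
  qed
  have "cmod (of_nat M * of_nat d * T t) \<le> B * (of_nat M * of_nat (2 * d)) + B * (of_nat M * of_nat d)"
    unfolding eq by (rule order_trans[OF norm_triangle_ineq4], rule add_mono; rule bound) (use M in auto)
  then have "real M * real d * cmod (T t) \<le> real M * real d * (3 * B)"
    by (simp add: norm_mult algebra_simps)
  then show ?thesis using M0 d by (simp add: mult_le_cancel_left)
qed

section \<open>From algebraic to trigonometric polynomials\<close>

lemma sum_delta_cis:
  "(\<Sum>j\<in>{- int d..int d}. (if j = 0 then z else 0) * cis (of_int j * t)) = z"
proof -
  have "(\<Sum>j\<in>{- int d..int d}. (if j = 0 then z else 0) * cis (of_int j * t))
      = (\<Sum>j\<in>{- int d..int d}. if j = 0 then z else 0)"
    by (intro sum.cong) auto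
  then show ?thesis by simp
qed

text \<open>Horner's rule: multiplication by the cosine averages the two unit shifts of the
  coefficient sequence.\<close>

lemma poly_cos_trig_poly:
  fixes p :: "real poly"
  assumes "degree p \<le> d"
  shows "\<exists>c. \<forall>t. complex_of_real (poly p (cos t)) = (\<Sum>j\<in>{- int d..int d}. c j * cis (of_int j * t))"
  using assms
proof (induction p arbitrary: d)
  case 0
  then show ?case by (intro exI[of _ "\<lambda>_. 0"]) simp
next
  case (pCons a p)
  show ?case
  proof (cases "p = 0")
    case True
    then show ?thesis
      by (intro exI[of _ "\<lambda>j. if j = 0 then complex_of_real a else 0"]) (simp add: sum_delta_cis)
  next
    case False
    then obtain e where e: "d = Suc e" "degree p \<le> e" using pCons.prems by (cases d) auto
    then obtain c where c: "complex_of_real (poly p (cos t)) = (\<Sum>j\<in>{- int e..int e}. c j * cis (of_int j * t))" for t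
      using pCons.IH by blast
    define c0 where "c0 j = (if \<bar>j\<bar> \<le> int e then c j else 0)" for j :: int
    have c0: "complex_of_real (poly p (cos t)) = (\<Sum>j\<in>J. c0 j * cis (of_int j * t))"
      if "{- int e..int e} \<subseteq> J" "finite J" for t J
      unfolding c by (rule sum.mono_neutral_cong_left) (use that in \<open>auto simp: c0_def\<close>)
    let ?J = "{- int d..int d}"
    let ?c = "\<lambda>j. (if j = 0 then complex_of_real a else 0) + c0 (j - 1) / 2 + c0 (j + 1) / 2"
    have cosc: "complex_of_real (cos t) = (cis t + cis (- t)) / 2" for t
      by (simp add: complex_eq_iff)
    have "complex_of_real (poly (pCons a p) (cos t)) = (\<Sum>j\<in>?J. ?c j * cis (of_int j * t))" for t
    proof -
      have 1: "(\<Sum>j\<in>?J. c0 (j - 1) * cis (of_int j * t)) = cis t * complex_of_real (poly p (cos t))"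
      proof -
        have "(\<Sum>j\<in>?J. c0 (j - 1) * cis (of_int j * t)) = (\<Sum>i\<in>{- int d - 1..int d - 1}. c0 i * cis (of_int (i + 1) * t))"
          by (rule sum.reindex_bij_witness[of _ "\<lambda>i. i + 1" "\<lambda>j. j - 1"]) auto
        also have "\<dots> = (\<Sum>i\<in>{- int d - 1..int d - 1}. cis t * (c0 i * cis (of_int i * t)))"
          by (intro sum.cong refl) (simp add: cis_mult[symmetric] distrib_right)
        finally show ?thesis
          using c0[of "{- int d - 1..int d - 1}" t] by (simp add: e sum_distrib_left)
      qed
      have 2: "(\<Sum>j\<in>?J. c0 (j + 1) * cis (of_int j * t)) = cis (- t) * complex_of_real (poly p (cos t))"
      proof -
        have "(\<Sum>j\<in>?J. c0 (j + 1) * cis (of_int j * t)) = (\<Sum>i\<in>{- int d + 1..int d + 1}. c0 i * cis (of_int (i - 1) * t))"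
          by (rule sum.reindex_bij_witness[of _ "\<lambda>i. i - 1" "\<lambda>j. j + 1"]) auto
        also have "\<dots> = (\<Sum>i\<in>{- int d + 1..int d + 1}. cis (- t) * (c0 i * cis (of_int i * t)))"
        proof (intro sum.cong refl)
          fix i :: int
          have "cis (of_int (i - 1) * t) = cis (- t) * cis (of_int i * t)"
            unfolding cis_mult by (simp add: algebra_simps)
          then show "c0 i * cis (of_int (i - 1) * t) = cis (- t) * (c0 i * cis (of_int i * t))" by simp
        qed
        finally show ?thesis
          using c0[of "{- int d + 1..int d + 1}" t] by (simp add: e sum_distrib_left)
      qed
      have "(\<Sum>j\<in>?J. ?c j * cis (of_int j * t)) = complex_of_real a
          + (\<Sum>j\<in>?J. c0 (j - 1) * cis (of_int j * t)) / 2 + (\<Sum>j\<in>?J. c0 (j + 1) * cis (of_int j * t)) / 2"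
        by (simp add: distrib_right sum.distrib sum_delta_cis sum_divide_distrib)
      then show ?thesis unfolding 1 2 by (simp add: cosc field_simps)
    qed
    then show ?thesis by (intro exI[of _ ?c] allI)
  qed
qed

lemma poly_bound_from_grid:
  fixes p :: "real poly"
  assumes "degree p \<le> d" "d > 0" "M \<ge> 3 * d"
    and B: "\<And>i. i < M \<Longrightarrow> \<bar>poly p (cos (2 * pi * real i / real M))\<bar> \<le> B"
    and x: "x \<in> {-1..1}"
  shows "\<bar>poly p x\<bar> \<le> 3 * B"
proof -
  obtain c where c: "complex_of_real (poly p (cos t)) = (\<Sum>j\<in>{- int d..int d}. c j * cis (of_int j * t))" for t
    using poly_cos_trig_poly[OF assms(1)] by blast
  have "cmod (\<Sum>j\<in>{- int d..int d}. c j * cis (of_int j * arccos x)) \<le> 3 * B"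
  proof (rule trig_poly_bound_from_grid[OF assms(2,3)])
    fix i assume "i < M"
    then show "cmod (\<Sum>j\<in>{- int d..int d}. c j * cis (of_int j * (2 * pi * real i / real M))) \<le> B"
      unfolding c[symmetric] using B by simp
  qed
  then show ?thesis unfolding c[symmetric] using x by (simp add: cos_arccos)
qed

section \<open>Partial colourings\<close>

lemma cosh_le_exp_half_square: "cosh (x::real) \<le> exp (x\<^sup>2 / 2)"
proof -
  have pos: "cosh x \<le> exp (x\<^sup>2 / 2)" if "x \<ge> 0" for x :: real
  proof -
    have sinh_le: "sinh t \<le> t * cosh t" if "t \<ge> 0" for t :: real
    proof -
      have "0 * cosh 0 - sinh (0::real) \<le> t * cosh t - sinh t"
      proof (rule DERIV_nonneg_imp_nondecreasing[OF that])
        fix s :: real assume "0 \<le> s" "s \<le> t"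
        have "((\<lambda>s. s * cosh s - sinh s) has_real_derivative (s * sinh s)) (at s)"
          by (auto intro!: derivative_eq_intros)
        moreover have "s * sinh s \<ge> 0" using \<open>0 \<le> s\<close> by simp
        ultimately show "\<exists>y. ((\<lambda>s. s * cosh s - sinh s) has_real_derivative y) (at s) \<and> 0 \<le> y"
          by blast
      qed
      then show ?thesis by simp
    qed
    have "cosh x * exp (- (x\<^sup>2 / 2)) \<le> cosh 0 * exp (- (0\<^sup>2 / 2))"
    proof (rule DERIV_nonpos_imp_nonincreasing[OF that])
      fix s :: real assume "0 \<le> s" "s \<le> x"
      have "((\<lambda>s. cosh s * exp (- (s\<^sup>2 / 2))) has_real_derivative
          ((sinh s - s * cosh s) * exp (- (s\<^sup>2 / 2)))) (at s)"
        by (auto intro!: derivative_eq_intros simp: algebra_simps)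
      moreover have "(sinh s - s * cosh s) * exp (- (s\<^sup>2 / 2)) \<le> 0"
        using sinh_le[OF \<open>0 \<le> s\<close>] by (intro mult_nonpos_nonneg) auto
      ultimately show "\<exists>y. ((\<lambda>s. cosh s * exp (- (s\<^sup>2 / 2))) has_real_derivative y) (at s) \<and> y \<le> 0"
        by blast
    qed
    then show ?thesis by (simp add: exp_minus field_simps)
  qed
  show ?thesis using pos[of x] pos[of "-x"] by (cases "x \<ge> 0") auto
qed

text \<open>A set T encodes a choice of signs, + on T and - on S - T. Sums over \<open>Pow S\<close>
  are thus 2 ^ card S times an expectation over random signs.\<close>

definition signed_sum :: "'a set \<Rightarrow> ('a \<Rightarrow> real) \<Rightarrow> 'a set \<Rightarrow> real" where
  "signed_sum S v T = (\<Sum>k\<in>T. v k) - (\<Sum>k\<in>S - T. v k)"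

lemma sum_Pow_exp_signed_sum:
  assumes "finite S" and "(\<Sum>k\<in>S. (v k)\<^sup>2) \<le> 1"
  shows "(\<Sum>T\<in>Pow S. exp (signed_sum S v T)) \<le> 2 * 2 ^ card S"
proof -
  have "(\<Sum>T\<in>Pow S. exp (signed_sum S v T)) = (\<Sum>T\<in>Pow S. (\<Prod>k\<in>T. exp (v k)) * (\<Prod>k\<in>S - T. exp (- v k)))"
    using assms(1)
    by (intro sum.cong) (auto simp: signed_sum_def exp_diff exp_sum exp_minus divide_inverse
        prod_inversef[symmetric] o_def dest: finite_subset)
  also have "\<dots> = (\<Prod>k\<in>S. exp (v k) + exp (- v k))"
    by (rule prod_add[OF assms(1), symmetric])
  also have "\<dots> \<le> (\<Prod>k\<in>S. 2 * exp ((v k)\<^sup>2 / 2))"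
  proof (rule prod_mono, safe)
    fix k show "exp (v k) + exp (- v k) \<le> 2 * exp ((v k)\<^sup>2 / 2)"
      using cosh_le_exp_half_square[of "v k"] by (simp add: cosh_field_def)
  qed (simp add: add_nonneg_nonneg)
  also have "\<dots> = 2 ^ card S * exp ((\<Sum>k\<in>S. (v k)\<^sup>2) / 2)"
    using assms(1) by (simp add: prod.distrib exp_sum sum_divide_distrib)
  also have "exp ((\<Sum>k\<in>S. (v k)\<^sup>2) / 2) \<le> exp (1/2)" using assms(2) by simp
  also have "exp (1/2::real) \<le> 2" using exp_bound_half[of "1/2::real"] by simp
  finally show ?thesis by (simp add: mult.commute)
qed

lemma sum_Pow_exp_abs_signed_sum:
  assumes "finite S" and "(\<Sum>k\<in>S. (v k)\<^sup>2) \<le> 1"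
  shows "(\<Sum>T\<in>Pow S. exp \<bar>signed_sum S v T\<bar>) \<le> 4 * 2 ^ card S"
proof -
  have neg: "signed_sum S (\<lambda>k. - v k) T = - signed_sum S v T" for T
    by (simp add: signed_sum_def sum_negf)
  have "(\<Sum>T\<in>Pow S. exp \<bar>signed_sum S v T\<bar>)
      \<le> (\<Sum>T\<in>Pow S. exp (signed_sum S v T) + exp (signed_sum S (\<lambda>k. - v k) T))"
    by (intro sum_mono) (auto simp: neg abs_if)
  also have "\<dots> \<le> 2 * 2 ^ card S + 2 * 2 ^ card S"
    unfolding sum.distrib using assms
    by (intro add_mono sum_Pow_exp_signed_sum) auto
  finally show ?thesis by simp
qed

section \<open>Logarithmic cost of a rounded row sum\<close>

lemma abs_round_le:
  fixes x b :: real
  assumes "b > 0"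
  shows "\<bar>real_of_int (round (x / (2*b)))\<bar> \<le> \<bar>x\<bar> / b"
    and "\<bar>x\<bar> < b \<Longrightarrow> round (x / (2*b)) = 0"
proof -
  have r: "\<bar>real_of_int (round (x / (2*b))) - x/(2*b)\<bar> \<le> 1/2"
    by (rule of_int_round_abs_le)
  show z: "round (x / (2*b)) = 0" if "\<bar>x\<bar> < b"
  proof -
    have "\<bar>x/(2*b)\<bar> < 1/2" using that assms by (simp add: field_simps)
    then have "\<bar>real_of_int (round (x / (2*b)))\<bar> < 1" using r by linarith
    then show ?thesis by linarith
  qed
  show "\<bar>real_of_int (round (x / (2*b)))\<bar> \<le> \<bar>x\<bar> / b"
  proof (cases "\<bar>x\<bar> < b")
    case True then show ?thesis using z assms by simp
  next
    case False
    then have "1/2 \<le> \<bar>x\<bar>/(2*b)" using assms by (simp add: field_simps)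
    moreover have "\<bar>x/(2*b)\<bar> = \<bar>x\<bar>/(2*b)" using assms by simp
    moreover have "\<bar>x\<bar>/b = \<bar>x\<bar>/(2*b) + \<bar>x\<bar>/(2*b)" by simp
    ultimately show ?thesis using r by linarith
  qed
qed

text \<open>The rounded value vanishes unless the signed sum reaches b in modulus, so only a tail
  contributes. The decay in b / V is what makes loose constraints nearly free.\<close>

lemma sum_Pow_abs_round:
  assumes "finite S" and "(\<Sum>k\<in>S. (v k)\<^sup>2) \<le> V\<^sup>2" and "V > 0" and "b > 0"
  shows "(\<Sum>T\<in>Pow S. \<bar>real_of_int (round (signed_sum S v T / (2*b)))\<bar>)
           \<le> 8 * V / b * exp (- (b / V) / 2) * 2 ^ card S"
proof -
  define w where "w k = v k / V" for k
  have w: "(\<Sum>k\<in>S. (w k)\<^sup>2) \<le> 1"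
    using assms by (simp add: w_def power_divide sum_divide_distrib[symmetric])
  have ss: "signed_sum S v T = V * signed_sum S w T" for T
    using assms by (simp add: signed_sum_def w_def sum_divide_distrib[symmetric] field_simps)
  have one: "\<bar>real_of_int (round (signed_sum S v T / (2*b)))\<bar>
      \<le> 2 * V / b * exp (- (b / V) / 2) * exp \<bar>signed_sum S w T\<bar>" for T
  proof (cases "\<bar>signed_sum S v T\<bar> < b")
    case True
    then show ?thesis using abs_round_le(2)[OF assms(4) True] assms by simp
  next
    case False
    define y where "y = \<bar>signed_sum S w T\<bar>"
    have vy: "\<bar>signed_sum S v T\<bar> = V * y" using assms by (simp add: ss y_def abs_mult)
    have yb: "b / V \<le> y" using False assms unfolding vy by (simp add: field_simps)
    \<comment> \<open>Of the moment exp y one half bounds y itself, and the other half yields the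
      tail factor because y \<ge> b / V.\<close>
    have "y \<le> 2 * exp (y/2)" using exp_ge_add_one_self[of "y/2"] by linarith
    also have "\<dots> = 2 * exp (- y/2) * exp y" by (simp add: mult_exp_exp)
    also have "\<dots> \<le> 2 * exp (- (b / V) / 2) * exp y" using yb by simp
    finally have "y * (V / b) \<le> 2 * exp (- (b / V) / 2) * exp y * (V / b)"
      using assms by (intro mult_right_mono) auto
    moreover have "\<bar>real_of_int (round (signed_sum S v T / (2*b)))\<bar> \<le> y * (V / b)"
      using abs_round_le(1)[OF assms(4), of "signed_sum S v T"] unfolding vy by (simp add: mult.commute)
    ultimately show ?thesis unfolding y_def[symmetric] by (simp add: algebra_simps)
  qed
  have "(\<Sum>T\<in>Pow S. \<bar>real_of_int (round (signed_sum S v T / (2*b)))\<bar>)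
     \<le> (\<Sum>T\<in>Pow S. 2 * V / b * exp (- (b / V) / 2) * exp \<bar>signed_sum S w T\<bar>)"
    by (intro sum_mono one)
  also have "\<dots> = 2 * V / b * exp (- (b / V) / 2) * (\<Sum>T\<in>Pow S. exp \<bar>signed_sum S w T\<bar>)"
    by (simp add: sum_distrib_left)
  also have "\<dots> \<le> 2 * V / b * exp (- (b / V) / 2) * (4 * 2 ^ card S)"
    using assms by (intro mult_left_mono sum_Pow_exp_abs_signed_sum w) auto
  finally show ?thesis by simp
qed

text \<open>The right side is the sum over all integers, the normalizing constant of the two-sided
  geometric law. The induction keeps the two missing tails.\<close>

lemma sum_power_abs_int_le:
  fixes q :: real
  assumes "0 < q" "q < 1"
  shows "(\<Sum>z\<in>{- int R..int R}. q ^ nat \<bar>z\<bar>) \<le> (1 + q) / (1 - q)"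
proof -
  have "(\<Sum>z\<in>{- int R..int R}. q ^ nat \<bar>z\<bar>) \<le> (1 + q - 2 * q ^ Suc R) / (1 - q)"
  proof (induction R)
    case 0 then show ?case using assms by simp
  next
    case (Suc R)
    have "{- int (Suc R)..int (Suc R)} = insert (- int (Suc R)) (insert (int (Suc R)) {- int R..int R})"
      by auto
    moreover have "nat (1 + int R) = Suc R" by simp
    ultimately have "(\<Sum>z\<in>{- int (Suc R)..int (Suc R)}. q ^ nat \<bar>z\<bar>)
        = 2 * q ^ Suc R + (\<Sum>z\<in>{- int R..int R}. q ^ nat \<bar>z\<bar>)"
      by (subst \<open>{- int (Suc R)..int (Suc R)} = _\<close>, subst sum.insert, simp, simp, subst sum.insert)
         (auto simp: nat_add_distrib)
    also have "\<dots> \<le> 2 * q ^ Suc R + (1 + q - 2 * q ^ Suc R) / (1 - q)" using Suc by simp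
    also have "\<dots> = (1 + q - 2 * q ^ Suc (Suc R)) / (1 - q)" using assms by (simp add: field_simps)
    finally show ?case .
  qed
  also have "\<dots> \<le> (1 + q) / (1 - q)" using assms by (intro divide_right_mono) auto
  finally show ?thesis .
qed

text \<open>With q = exp (-L/4) the argument of the logarithm is (1 + q)/(1 - q), the normalizing
  constant of the weights q ^ |z|. For L = b / V one of the three copies pays for the normalization
  and two pay for the mean of |z| L/4.\<close>

definition round_cost :: "real \<Rightarrow> real" where
  "round_cost L = 3 * ln (1 + 2 / (exp (L/4) - 1))"

text \<open>The summand 2 exp (-L/2) is the mean bound of \<open>sum_Pow_abs_round\<close> times
  L/4. It is at most 2q, and q \<le> 2q/(1 + q) \<le> ln ((1 + q)/(1 - q)).\<close>

lemma round_cost_bound: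
  fixes L :: real
  assumes "L > 0"
  defines "q \<equiv> exp (- L / 4)"
  shows "ln ((1 + q) / (1 - q)) + 2 * exp (- L / 2) \<le> round_cost L" and "0 < round_cost L"
proof -
  have q: "0 < q" "q < 1" using assms by (auto simp: q_def)
  have inv: "exp (L/4) = 1/q" by (simp add: q_def exp_minus field_simps)
  have e: "1 + 2 / (exp (L/4) - 1) = (1 + q) / (1 - q)"
    unfolding inv using q by (simp add: field_simps)
  have "(1 - q) / (1 + q) > 0" using q by simp
  then have "ln ((1 - q) / (1 + q)) \<le> (1 - q) / (1 + q) - 1" by (rule ln_le_minus_one)
  moreover have "ln ((1 - q) / (1 + q)) = - ln ((1 + q) / (1 - q))"
    using q by (simp add: ln_div)
  ultimately have "1 - (1 - q) / (1 + q) \<le> ln ((1 + q) / (1 - q))" by linarith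
  moreover have "q \<le> 1 - (1 - q) / (1 + q)"
  proof -
    have "q * (1 + q) \<le> q * 2" using q by (intro mult_left_mono) auto
    moreover have "1 - (1 - q) / (1 + q) = 2 * q / (1 + q)" using q by (simp add: field_simps)
    ultimately show ?thesis using q by (simp add: field_simps)
  qed
  moreover have "exp (- L / 2) \<le> q" using assms(1) by (simp add: q_def)
  ultimately show "ln ((1 + q) / (1 - q)) + 2 * exp (- L / 2) \<le> round_cost L"
    and "0 < round_cost L"
    unfolding round_cost_def e using q by linarith+
qed

text \<open>For strict constraints, where L is small: the cost grows logarithmically, hence slower
  than any power of 1/L. The passage from the logarithm to a power rests on the subadditivity of x
  powr e for e \<le> 1.\<close>

lemma round_cost_le_powr:
  fixes L e :: real
  assumes "L > 0" "0 < e" "e \<le> 1"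
  shows "round_cost L \<le> 3 / e * (8 / L) powr e"
proof -
  define x where "x = 2 / (exp (L/4) - 1)"
  have x: "0 < x" using assms by (simp add: x_def)
  have "exp (L/4) - 1 \<ge> L/4" using exp_ge_add_one_self[of "L/4"] by linarith
  then have "x \<le> 2 / (L/4)" unfolding x_def using assms by (intro divide_left_mono) auto
  then have xL: "x \<le> 8 / L" by simp
  have "ln (1 + x) \<le> x powr e / e"
  proof -
    have "ln (1 + x powr e) \<le> x powr e" using x by (intro ln_add_one_self_le_self) auto
    moreover have "e * ln (1 + x) \<le> ln (1 + x powr e)"
    proof -
      have "(1 + x) powr e \<le> 1 powr e + x powr e"
      proof -
        have "1 / (1 + x) \<le> (1 / (1 + x)) powr e" "x / (1 + x) \<le> (x / (1 + x)) powr e"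
          using x assms powr_mono'[of e 1 "1 / (1 + x)"] powr_mono'[of e 1 "x / (1 + x)"] by auto
        moreover have "1 / (1 + x) + x / (1 + x) = 1" using x by (simp add: field_simps)
        ultimately have "1 \<le> (1 / (1 + x)) powr e + (x / (1 + x)) powr e" by linarith
        then show ?thesis using x by (simp add: powr_divide field_simps)
      qed
      moreover have "0 < (1 + x) powr e" using x by simp
      ultimately have "ln ((1 + x) powr e) \<le> ln (1 + x powr e)" by (subst ln_le_cancel_iff) (auto intro: add_pos_nonneg)
      then show ?thesis using x by (simp add: ln_powr)
    qed
    ultimately show ?thesis using assms by (simp add: field_simps)
  qed
  also have "x powr e \<le> (8 / L) powr e" using x xL assms by (intro powr_mono2) auto
  finally show ?thesis using assms unfolding round_cost_def x_def[symmetric]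
    by (simp add: field_simps)
qed

text \<open>For loose constraints, where L is large: one term of the exponential series gives decay
  of any prescribed order.\<close>

lemma round_cost_le_power:
  fixes L :: real
  assumes "L > 0" "k \<ge> 1"
  shows "round_cost L \<le> 6 * fact k * (4 / L) ^ k"
proof -
  have "(L/4) ^ k / fact k \<le> exp (L/4) - 1"
  proof -
    have "(\<Sum>n\<in>{0, k}. inverse (fact n) * (L/4) ^ n) \<le> (\<Sum>n. inverse (fact n) * (L/4) ^ n)"
      using assms by (intro sum_le_suminf summable_exp) auto
    also have "\<dots> = exp (L/4)" by (simp only: exp_def real_scaleR_def)
    finally show ?thesis using assms by (simp add: field_simps)
  qed
  then have "2 / (exp (L/4) - 1) \<le> 2 / ((L/4) ^ k / fact k)"
    using assms by (intro divide_left_mono) auto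
  also have "\<dots> = 2 * fact k * (4 / L) ^ k" by (simp add: power_divide)
  finally have "2 / (exp (L/4) - 1) \<le> 2 * fact k * (4 / L) ^ k" .
  moreover have "ln (1 + 2 / (exp (L/4) - 1)) \<le> 2 / (exp (L/4) - 1)"
    using assms by (intro ln_add_one_self_le_self) auto
  ultimately show ?thesis unfolding round_cost_def by linarith
qed

text \<open>Each set U gets the weight (1/16) ^ card U. All weights add up to (17/16) ^ card S, and
  a set with at most an eighth of the elements weighs at least (1 / sqrt 2) ^ card S, since the
  eighth power of 1 / sqrt 2 is 1/16.\<close>

lemma card_small_subsets_le:
  assumes "finite S"
  shows "real (card {U. U \<subseteq> S \<and> 8 * card U \<le> card S}) \<le> (17/16 * sqrt 2) ^ card S"
proof -
  let ?D = "{U. U \<subseteq> S \<and> 8 * card U \<le> card S}"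
  have finD: "finite ?D" using assms by (simp add: finite_subset[of _ "Pow S"] Collect_mono subset_eq)
  have pw: "(\<Sum>U\<in>Pow S. (1/16::real) ^ card U) = (17/16) ^ card S"
  proof -
    have "(\<Sum>U\<in>Pow S. (1/16::real) ^ card U) = (\<Prod>k\<in>S. 1/16 + 1)"
      unfolding prod_add[OF assms, of "\<lambda>_. 1/16" "\<lambda>_. 1"] by simp
    then show ?thesis by simp
  qed
  have "(1 / sqrt 2) ^ card S \<le> (1/16::real) ^ card U" if "U \<in> ?D" for U
  proof -
    have s8: "(1 / sqrt 2)^8 = (1/16::real)"
    proof -
      have "(1 / sqrt 2)^8 = (((1 / sqrt 2)^2)^4 :: real)" by (simp add: power_mult[symmetric])
      then show ?thesis by (simp add: power_divide)
    qed
    have "(1 / sqrt 2) ^ card S \<le> (1 / sqrt 2) ^ (8 * card U)"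
      using that by (intro power_decreasing) auto
    also have "\<dots> = (1/16::real) ^ card U" by (simp add: power_mult s8)
    finally show ?thesis .
  qed
  then have "real (card ?D) * (1 / sqrt 2) ^ card S \<le> (\<Sum>U\<in>?D. (1/16::real) ^ card U)"
    using sum_bounded_below[of ?D "(1 / sqrt 2) ^ card S" "\<lambda>U. (1/16::real) ^ card U"] by auto
  also have "\<dots> \<le> (\<Sum>U\<in>Pow S. (1/16::real) ^ card U)"
    using assms by (intro sum_mono2) auto
  finally have "real (card ?D) * (1 / sqrt 2) ^ card S \<le> (17/16) ^ card S" unfolding pw .
  then show ?thesis by (simp add: power_divide power_mult_distrib field_simps)
qed

text \<open>If every fibre had fewer than d * card A points, there would be more than 1/d values;
  but each value weighs at least d and the total weight is at most 1.\<close>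

lemma pigeonhole_large_fibre:
  fixes h :: "'a \<Rightarrow> 'b" and w :: "'b \<Rightarrow> real"
  assumes "finite A" and "A \<noteq> {}" and "(\<Sum>z\<in>h ` A. w z) \<le> 1" and "\<And>x. x \<in> A \<Longrightarrow> w (h x) \<ge> d"
  shows "\<exists>x\<in>A. real (card {y\<in>A. h y = h x}) \<ge> d * real (card A)"
proof (rule ccontr)
  assume "\<not> ?thesis"
  then have lt: "real (card {y\<in>A. h y = h x}) < d * real (card A)" if "x \<in> A" for x using that by force
  have dpos: "d > 0"
  proof -
    obtain x where "x \<in> A" using assms(2) by blast
    then have "0 < d * real (card A)" using lt[of x] by linarith
    then show ?thesis using assms(1,2) by (simp add: zero_less_mult_iff)
  qed
  have "real (card A) = (\<Sum>z\<in>h ` A. real (card {y\<in>A. h y = z}))"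
    using sum.image_gen[OF assms(1), of "\<lambda>_. 1::real" h] by simp
  also have "\<dots> < (\<Sum>z\<in>h ` A. d * real (card A))"
    using assms(1,2) lt by (intro sum_strict_mono) auto
  also have "\<dots> \<le> (\<Sum>z\<in>h ` A. w z * real (card A))"
    using assms(4) by (intro sum_mono mult_right_mono) auto
  also have "\<dots> = (\<Sum>z\<in>h ` A. w z) * real (card A)" by (simp add: sum_distrib_right)
  also have "\<dots> \<le> 1 * real (card A)" using assms(3) by (intro mult_right_mono) auto
  finally show False by simp
qed

text \<open>In place of the usual entropy estimate, each rounded row sum \<open>z\<close> gets the weight proportional to \<open>q ^ \<bar>z\<bar>\<close>.
  The weights of all patterns add up to at most 1, and \<open>round_cost\<close> bounds the mean logarithmic cost of a row.\<close>

lemma partial_colouring: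
  fixes v :: "'i \<Rightarrow> 'a \<Rightarrow> real" and V b :: "'i \<Rightarrow> real"
  assumes finS: "finite S" and finI: "finite I" and S8: "card S \<ge> 8"
    and V: "\<And>i. i \<in> I \<Longrightarrow> V i > 0" "\<And>i. i \<in> I \<Longrightarrow> (\<Sum>k\<in>S. (v i k)\<^sup>2) \<le> (V i)\<^sup>2"
    and b: "\<And>i. i \<in> I \<Longrightarrow> b i > 0"
    and cost: "(\<Sum>i\<in>I. round_cost (b i / V i)) \<le> card S / 16"
  shows "\<exists>T1 T2. T1 \<subseteq> S \<and> T2 \<subseteq> S \<and> T1 \<inter> T2 = {} \<and> card S < 8 * (card T1 + card T2) \<and>
           (\<forall>i\<in>I. \<bar>(\<Sum>k\<in>T1. v i k) - (\<Sum>k\<in>T2. v i k)\<bar> \<le> b i)"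
proof -
  define s where "s = card S"
  define q where "q i = exp (- (b i / V i) / 4)" for i
  \<comment> \<open>The spacing is 2 b: subsets with equal rounded values have signed sums within 2
    b of each other, and their plain sums are within b.\<close>
  define z where "z i T = round (signed_sum S (v i) T / (2 * b i))" for i T
  define pen where "pen i = ln ((1 + q i) / (1 - q i))" for i
  \<comment> \<open>The negative logarithm of the weight of the pattern of T, as \<open>wC\<close>
    confirms.\<close>
  define C where "C T = (\<Sum>i\<in>I. pen i + \<bar>real_of_int (z i T)\<bar> * (b i / V i / 4))" for T
  define G where "G = {T \<in> Pow S. C T \<le> s / 8}"
  have q: "0 < q i" "q i < 1" if "i \<in> I" for i using V(1)[OF that] b[OF that] by (auto simp: q_def)
  have pen0: "pen i \<ge> 0" if "i \<in> I" for i
    unfolding pen_def using q[OF that] by (intro ln_ge_zero) (auto simp: field_simps)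
  have C0: "C T \<ge> 0" for T
    unfolding C_def using pen0 V(1) b by (intro sum_nonneg add_nonneg_nonneg) (auto simp: less_imp_le)
  have finP: "finite (Pow S)" using finS by simp
  have cardP: "real (card (Pow S)) = 2 ^ s" using finS by (simp add: card_Pow s_def)
  have "(\<Sum>T\<in>Pow S. C T) = (\<Sum>i\<in>I. 2 ^ s * pen i + (\<Sum>T\<in>Pow S. \<bar>real_of_int (z i T)\<bar>) * (b i / V i / 4))"
    unfolding C_def
    by (subst sum.swap) (simp add: sum.distrib cardP sum_distrib_right sum_divide_distrib)
  also have "\<dots> \<le> (\<Sum>i\<in>I. 2 ^ s * round_cost (b i / V i))"
  proof (rule sum_mono)
    fix i assume i: "i \<in> I"
    note pos = V(1)[OF i] b[OF i]
    have "(\<Sum>T\<in>Pow S. \<bar>real_of_int (z i T)\<bar>) * (b i / V i / 4)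
        \<le> (8 * V i / b i * exp (- (b i / V i) / 2) * 2 ^ s) * (b i / V i / 4)"
      unfolding z_def s_def using V(2)[OF i] pos finS
      by (intro mult_right_mono sum_Pow_abs_round) auto
    also have "\<dots> = 2 ^ s * (2 * exp (- (b i / V i) / 2))" using pos by (simp add: field_simps)
    finally have "2 ^ s * pen i + (\<Sum>T\<in>Pow S. \<bar>real_of_int (z i T)\<bar>) * (b i / V i / 4)
        \<le> 2 ^ s * (pen i + 2 * exp (- (b i / V i) / 2))" by (simp add: distrib_left)
    also have "\<dots> \<le> 2 ^ s * round_cost (b i / V i)"
      unfolding pen_def q_def using pos by (intro mult_left_mono round_cost_bound) auto
    finally show "2 ^ s * pen i + (\<Sum>T\<in>Pow S. \<bar>real_of_int (z i T)\<bar>) * (b i / V i / 4)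
        \<le> 2 ^ s * round_cost (b i / V i)" .
  qed
  also have "\<dots> \<le> 2 ^ s * (s / 16)"
    unfolding sum_distrib_left[symmetric] s_def using cost by (intro mult_left_mono) auto
  finally have total: "(\<Sum>T\<in>Pow S. C T) \<le> 2 ^ s * (s / 16)" .
  have spos: "real s > 0" using S8 by (simp add: s_def)
  \<comment> \<open>Markov's inequality: the mean cost is at most s/16, so at least half of the
    subsets cost at most s/8.\<close>
  have cardG: "real (card G) \<ge> 2 ^ s / 2"
  proof -
    have "real (card (Pow S - G)) * (s / 8) \<le> (\<Sum>T\<in>Pow S - G. C T)"
      by (rule sum_bounded_below) (auto simp: G_def)
    also have "\<dots> \<le> (\<Sum>T\<in>Pow S. C T)" using finP C0 by (intro sum_mono2) auto
    also note total
    finally have "real (card (Pow S - G)) \<le> 2 ^ s / 2" using spos by (simp add: field_simps)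
    moreover have "card (Pow S - G) = card (Pow S) - card G" "card G \<le> card (Pow S)"
      using finP by (auto simp: G_def intro!: card_Diff_subset card_mono finite_subset[OF _ finP])
    ultimately show ?thesis using cardP by (simp add: of_nat_diff)
  qed
  have finG: "finite G" using finP by (auto simp: G_def intro: finite_subset[OF _ finP])
  have Gne: "G \<noteq> {}"
  proof
    assume "G = {}"
    then have "(2::real) ^ s \<le> 0" using cardG by simp
    moreover have "(2::real) ^ s > 0" by simp
    ultimately show False by linarith
  qed
  define h where "h T = restrict (\<lambda>i. z i T) I" for T
  define w where "w g = (\<Prod>i\<in>I. (1 - q i) / (1 + q i) * q i ^ nat \<bar>g i :: int\<bar>)" for g
  have wC: "w (h T) = exp (- C T)" for T
  proof -
    have "(1 - q i) / (1 + q i) * q i ^ nat \<bar>z i T\<bar> = exp (- (pen i + \<bar>real_of_int (z i T)\<bar> * (b i / V i / 4)))"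
      if "i \<in> I" for i
    proof -
      have "exp (- pen i) = (1 - q i) / (1 + q i)"
        unfolding pen_def exp_minus using q[OF that] by simp
      moreover have "q i ^ nat \<bar>z i T\<bar> = exp (- (\<bar>real_of_int (z i T)\<bar> * (b i / V i / 4)))"
        unfolding q_def exp_of_nat_mult[symmetric] by simp
      ultimately show ?thesis by (simp add: exp_diff exp_minus field_simps)
    qed
    then show ?thesis
      by (simp add: w_def h_def C_def exp_sum[OF finI] sum_negf[symmetric] cong: prod.cong)
  qed
  have "(\<Sum>g\<in>h ` G. w g) \<le> 1"
  proof -
    \<comment> \<open>A common bound for all occurring values puts the patterns into a finite box,
      where the total weight factors over the rows into geometric sums.\<close>
    define R where "R = (\<Sum>i\<in>I. \<Sum>T\<in>G. nat \<bar>z i T\<bar>)"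
    have "nat \<bar>z i T\<bar> \<le> R" if "i \<in> I" "T \<in> G" for i T
    proof -
      have "nat \<bar>z i T\<bar> \<le> (\<Sum>T\<in>G. nat \<bar>z i T\<bar>)"
        using that finG by (intro member_le_sum) auto
      also have "\<dots> \<le> R" unfolding R_def using that finI by (intro member_le_sum) auto
      finally show ?thesis .
    qed
    then have "h ` G \<subseteq> (\<Pi>\<^sub>E i\<in>I. {- int R..int R})" by (force simp: h_def)
    then have "(\<Sum>g\<in>h ` G. w g) \<le> (\<Sum>g\<in>(\<Pi>\<^sub>E i\<in>I. {- int R..int R}). w g)"
      using finI q by (intro sum_mono2) (auto simp: w_def less_imp_le intro!: finite_PiE prod_nonneg)
    also have "\<dots> = (\<Prod>i\<in>I. \<Sum>y\<in>{- int R..int R}. (1 - q i) / (1 + q i) * q i ^ nat \<bar>y\<bar>)"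
      unfolding w_def by (subst prod_sum_PiE) (use finI in auto)
    also have "\<dots> \<le> (\<Prod>i\<in>I. 1)"
    proof (intro prod_mono conjI)
      fix i assume i: "i \<in> I"
      show "0 \<le> (\<Sum>y\<in>{- int R..int R}. (1 - q i) / (1 + q i) * q i ^ nat \<bar>y\<bar>)"
        using q[OF i] by (intro sum_nonneg) auto
      have "(\<Sum>y\<in>{- int R..int R}. (1 - q i) / (1 + q i) * q i ^ nat \<bar>y\<bar>)
          \<le> (1 - q i) / (1 + q i) * ((1 + q i) / (1 - q i))"
        unfolding sum_distrib_left[symmetric] using q[OF i]
        by (intro mult_left_mono sum_power_abs_int_le) auto
      then show "(\<Sum>y\<in>{- int R..int R}. (1 - q i) / (1 + q i) * q i ^ nat \<bar>y\<bar>) \<le> 1"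
        using q[OF i] by simp
    qed
    finally show ?thesis by simp
  qed
  then obtain T0 where T0: "T0 \<in> G" "real (card {T\<in>G. h T = h T0}) \<ge> exp (- (s / 8)) * real (card G)"
    using pigeonhole_large_fibre[OF finG Gne, of w h "exp (- (s / 8))"] by (auto simp: wC G_def)
  define F where "F = {T\<in>G. h T = h T0}"
  have "real (card F) \<ge> exp (- (s / 8)) * (2 ^ s / 2)"
    using T0(2) cardG unfolding F_def by (meson exp_ge_zero mult_left_mono order_trans)
  \<comment> \<open>The product of 17/16, sqrt 2 and exp (1/8) stays below 2 by at least the factor
    1.15, and 1.15 ^ 8 > 2 makes up for the discarded half of the subsets. This is where 8 elements
    are required.\<close>
  moreover have "exp (- (s / 8)) * (2 ^ s / 2) > (17/16 * sqrt 2) ^ s"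
  proof -
    have e: "exp (1/8::real) \<le> 73/64" using exp_bound[of "1/8::real"] by (simp add: power2_eq_square)
    have sq: "sqrt 2 \<le> 1.415" by (rule real_le_lsqrt) (auto simp: power2_eq_square)
    have "17/16 * sqrt 2 * 1.15 * exp (1/8) \<le> 17/16 * 1.415 * 1.15 * (73/64)"
      using e sq by (intro mult_mono) auto
    then have base: "17/16 * sqrt 2 * 1.15 * exp (1/8) \<le> 2" by simp
    have "(17/16 * sqrt 2) ^ s * 2 < (17/16 * sqrt 2) ^ s * 1.15 ^ s"
    proof -
      have "(2::real) < 1.15 ^ 8" by (simp add: power_divide)
      also have "\<dots> \<le> 1.15 ^ s" using S8 by (intro power_increasing) (auto simp: s_def)
      finally show ?thesis by simp
    qed
    moreover have "(17/16 * sqrt 2 * 1.15 * exp (1/8)) ^ s \<le> 2 ^ s"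
      using base by (intro power_mono) auto
    moreover have "exp (1/8) ^ s = exp (s / 8)" by (simp add: exp_of_nat_mult[symmetric])
    ultimately have "(17/16 * sqrt 2) ^ s * 2 * exp (s / 8) < 2 ^ s"
      by (simp only: power_mult_distrib) (smt (verit) exp_gt_zero mult_strict_right_mono)
    then show ?thesis by (simp add: exp_minus field_simps)
  qed
  moreover have "card {U. U \<subseteq> S \<and> 8 * card U \<le> card S} \<le> (17/16 * sqrt 2) ^ s"
    unfolding s_def by (rule card_small_subsets_le[OF finS])
  ultimately have cardF: "card {U. U \<subseteq> S \<and> 8 * card U \<le> card S} < card F" by linarith
  \<comment> \<open>The symmetric difference with T0 determines T, so if all of them were small, F
    could not outnumber the small sets.\<close>
  have "\<exists>T\<in>F. \<not> 8 * card ((T - T0) \<union> (T0 - T)) \<le> card S"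
  proof (rule ccontr)
    assume "\<not> ?thesis"
    then have "(\<lambda>T. (T - T0) \<union> (T0 - T)) ` F \<subseteq> {U. U \<subseteq> S \<and> 8 * card U \<le> card S}"
      using T0(1) by (auto simp: F_def G_def)
    moreover have "finite {U. U \<subseteq> S \<and> 8 * card U \<le> card S}"
      using finP by (rule finite_subset[rotated]) auto
    moreover have "inj_on (\<lambda>T. (T - T0) \<union> (T0 - T)) F" by (rule inj_onI) blast
    ultimately have "card F \<le> card {U. U \<subseteq> S \<and> 8 * card U \<le> card S}"
      by (intro card_inj_on_le)
    then show False using cardF by simp
  qed
  then obtain T where T: "T \<in> F" "card S < 8 * card ((T - T0) \<union> (T0 - T))" by auto
  have sub: "T \<subseteq> S" "T0 \<subseteq> S" using T T0 by (auto simp: F_def G_def)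
  then have fin: "finite T" "finite T0" using finS finite_subset by auto
  have "card ((T - T0) \<union> (T0 - T)) = card (T - T0) + card (T0 - T)"
    using fin by (intro card_Un_disjoint) auto
  moreover have "\<bar>(\<Sum>k\<in>T - T0. v i k) - (\<Sum>k\<in>T0 - T. v i k)\<bar> \<le> b i" if i: "i \<in> I" for i
  proof -
    have same: "z i T = z i T0" using T(1) i by (auto simp: F_def h_def restrict_def fun_eq_iff split: if_splits)
    have ss: "signed_sum S (v i) U = 2 * (\<Sum>k\<in>U. v i k) - (\<Sum>k\<in>S. v i k)" if "U \<subseteq> S" for U
      using that finS by (simp add: signed_sum_def sum_diff)
    have "\<bar>real_of_int (z i T) - signed_sum S (v i) T / (2 * b i)\<bar> \<le> 1/2"
         "\<bar>real_of_int (z i T) - signed_sum S (v i) T0 / (2 * b i)\<bar> \<le> 1/2"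
      using of_int_round_abs_le same unfolding z_def by metis+
    then have "\<bar>(signed_sum S (v i) T - signed_sum S (v i) T0) / (2 * b i)\<bar> \<le> 1"
      unfolding diff_divide_distrib by linarith
    then have "\<bar>signed_sum S (v i) T - signed_sum S (v i) T0\<bar> \<le> 2 * b i"
      using b[OF i] by (simp add: field_simps)
    moreover have "(\<Sum>k\<in>T - T0. v i k) - (\<Sum>k\<in>T0 - T. v i k) = (\<Sum>k\<in>T. v i k) - (\<Sum>k\<in>T0. v i k)"
      using fin sum.Int_Diff[of T "v i" T0] sum.Int_Diff[of T0 "v i" T] by (simp add: Int_commute)
    ultimately show ?thesis using ss[OF sub(1)] ss[OF sub(2)] by linarith
  qed
  ultimately show ?thesis
    using T(2) sub by (intro exI[of _ "T - T0"] exI[of _ "T0 - T"]) auto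
qed

section \<open>Means with respect to the Gegenbauer weight\<close>

lemma continuous_on_poly_fun [simp]: "continuous_on A (poly (p :: real poly))"
  by (intro continuous_on_poly continuous_on_id)

lemma continuous_on_interval_bounded:
  assumes "continuous_on {-1..1} (f :: real \<Rightarrow> real)"
  shows "\<exists>B>0. \<forall>x\<in>{-1..1}. \<bar>f x\<bar> \<le> B"
proof -
  have "compact (f ` {-1..1})" by (intro compact_continuous_image assms) auto
  then obtain B where "\<forall>y\<in>f ` {-1..1}. norm y \<le> B" using compact_imp_bounded bounded_iff by metis
  then show ?thesis by (intro exI[of _ "\<bar>B\<bar> + 1"]) force
qed

text \<open>The integral against (1 - x^2) powr \<alpha> after substituting x = cos t, with lam =
  \<alpha> + 1/2. In the angle the weight is continuous for every lam > 0, whereas in x it is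
  unbounded when \<alpha> < 0.\<close>

definition gint :: "real \<Rightarrow> (real \<Rightarrow> real) \<Rightarrow> real" where
  "gint lam f = integral {0..pi} (\<lambda>t. sin t powr (2 * lam) * f (cos t))"

definition gmean :: "real \<Rightarrow> (real \<Rightarrow> real) \<Rightarrow> real" where
  "gmean lam f = gint lam f / gint lam (\<lambda>_. 1)"

lemma continuous_on_sin_powr:
  fixes e :: real
  assumes "e > 0"
  shows "continuous_on {0..pi} (\<lambda>t. sin t powr e)"
  using assms by (intro continuous_on_powr') (auto intro!: continuous_intros simp: sin_ge_zero)

lemma continuous_on_compose_cos:
  assumes "continuous_on {-1..1} (f :: real \<Rightarrow> real)"
  shows "continuous_on A (\<lambda>t. f (cos t))"
  by (rule continuous_on_compose2[OF assms]) (auto intro!: continuous_intros)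

lemma continuous_on_gint:
  assumes "lam > 0" "continuous_on {-1..1} f"
  shows "continuous_on {0..pi} (\<lambda>t. sin t powr (2 * lam) * f (cos t))"
  using assms by (intro continuous_on_mult continuous_on_sin_powr continuous_on_compose_cos) auto

lemma has_integral_gegen_weight:
  fixes \<alpha> :: real
  assumes "\<alpha> > -1/2" and f: "continuous_on {-1..1} f"
  shows "((\<lambda>x. (1 - x\<^sup>2) powr \<alpha> * f x) has_integral gint (\<alpha> + 1/2) f) {-1..1}"
proof -
  let ?lam = "\<alpha> + 1/2"
  have img: "cos ` {0<..<pi} = {-1<..<1::real}"
  proof (intro subset_antisym subsetI)
    fix x assume "x \<in> cos ` {0<..<pi}"
    then obtain t where t: "x = cos t" "0 < t" "t < pi" by auto
    then show "x \<in> {-1<..<1}"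
      using cos_monotone_0_pi[of 0 t] cos_monotone_0_pi[of t pi] by auto
  next
    fix x :: real assume "x \<in> {-1<..<1}"
    then have "x = cos (arccos x)" "0 < arccos x" "arccos x < pi" using arccos_lt_bounded[of x] by auto
    then show "x \<in> cos ` {0<..<pi}" by auto
  qed
  have lam: "?lam > 0" using assms by simp
  have int0: "(\<lambda>t. sin t powr (2 * ?lam) * f (cos t)) absolutely_integrable_on {0..pi}"
    by (rule absolutely_integrable_continuous_real, rule continuous_on_gint[OF lam f])
  have int: "(\<lambda>t. sin t powr (2 * ?lam) * f (cos t)) absolutely_integrable_on {0<..<pi}"
    by (rule set_integrable_subset[OF int0]) (simp, auto)
  have eq: "\<bar>- sin t\<bar> * ((1 - (cos t)\<^sup>2) powr \<alpha> * f (cos t)) = sin t powr (2 * ?lam) * f (cos t)"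
    if "t \<in> {0<..<pi}" for t
  proof -
    have s: "sin t > 0" using that sin_gt_zero[of t] by simp
    have "1 - (cos t)\<^sup>2 = sin t powr 2" using s by (simp add: sin_squared_eq)
    then have "(1 - (cos t)\<^sup>2) powr \<alpha> = sin t powr (2 * \<alpha>)" by (simp only: powr_powr)
    moreover have "sin t powr (2 * ?lam) = sin t powr (2 * \<alpha>) * sin t"
      using s by (simp add: distrib_left powr_add)
    moreover have "\<bar>- sin t\<bar> = sin t" using s by simp
    ultimately show ?thesis by (simp only: mult_ac)
  qed
  have open_int: "integral {0<..<pi} (\<lambda>t. sin t powr (2 * ?lam) * f (cos t)) = gint ?lam f"
    unfolding gint_def by (rule integral_open_interval_real[symmetric])
  have int': "(\<lambda>x. \<bar>- sin x\<bar> * ((1 - (cos x)\<^sup>2) powr \<alpha> * f (cos x))) absolutely_integrable_on {0<..<pi}"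
    by (rule set_integrable_cong[THEN iffD2, OF refl refl eq int])
  have int'': "integral {0<..<pi} (\<lambda>x. \<bar>- sin x\<bar> * ((1 - (cos x)\<^sup>2) powr \<alpha> * f (cos x))) = gint ?lam f"
    unfolding open_int[symmetric] by (rule integral_cong[OF eq])
  have "(\<lambda>x. (1 - x\<^sup>2) powr \<alpha> * f x) absolutely_integrable_on (cos ` {0<..<pi}) \<and>
     integral (cos ` {0<..<pi}) (\<lambda>x. (1 - x\<^sup>2) powr \<alpha> * f x) = gint ?lam f"
  proof (subst has_absolute_integral_change_of_variables_1'[symmetric, where g' = "\<lambda>t. - sin t"])
    show "inj_on cos {0<..<pi}" by (rule inj_onI, rule cos_inj_pi) auto
    show "(\<lambda>x. \<bar>- sin x\<bar> * ((1 - (cos x)\<^sup>2) powr \<alpha> * f (cos x))) absolutely_integrable_on {0<..<pi} \<and>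
      integral {0<..<pi} (\<lambda>x. \<bar>- sin x\<bar> * ((1 - (cos x)\<^sup>2) powr \<alpha> * f (cos x))) = gint ?lam f"
      using int' int'' by blast
  qed (auto intro!: derivative_eq_intros)
  then have "((\<lambda>x. (1 - x\<^sup>2) powr \<alpha> * f x) has_integral gint ?lam f) {-1<..<1}"
    unfolding img has_integral_integrable_integral using set_lebesgue_integral_eq_integral(1) by blast
  then show ?thesis by (simp add: has_integral_Icc_iff_Ioo)
qed

lemma gint_1_pos:
  assumes "lam > 0" shows "gint lam (\<lambda>_. 1) > 0"
proof -
  have c: "continuous_on {0..pi} (\<lambda>t. sin t powr (2 * lam) * 1)" by (rule continuous_on_gint[OF assms]) auto
  have "gint lam (\<lambda>_. 1) \<ge> 0" unfolding gint_def
    by (rule integral_nonneg) (use c in \<open>auto intro: integrable_continuous_real\<close>)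
  moreover have "gint lam (\<lambda>_. 1) \<noteq> 0"
  proof
    assume "gint lam (\<lambda>_. 1) = 0"
    then have "\<forall>t\<in>{0..pi}. sin t powr (2 * lam) * 1 = 0"
      unfolding gint_def using integral_eq_0_iff[OF c] by simp
    then have "sin (pi/2) powr (2 * lam) * 1 = 0" by (rule bspec) auto
    then show False by simp
  qed
  ultimately show ?thesis by simp
qed

lemma integral_gegen_weight:
  assumes "\<alpha> > -1/2" and "continuous_on {-1..1} f"
  shows "((\<lambda>x. gegen_weight \<alpha> x * f x) has_integral gmean (\<alpha> + 1/2) f) {-1..1}"
proof -
  have "gegen_const \<alpha> = 1 / gint (\<alpha> + 1/2) (\<lambda>_. 1)"
    using has_integral_gegen_weight[OF assms(1), of "\<lambda>_. 1"] by (simp add: gegen_const_def integral_unique)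
  then show ?thesis
    using has_integral_mult_right[OF has_integral_gegen_weight[OF assms], of "gegen_const \<alpha>"]
    by (simp add: gegen_weight_def gmean_def mult.assoc)
qed

context
  fixes lam :: real
  assumes lam: "lam > 0"
begin

lemma gint_integrable:
  "continuous_on {-1..1} f \<Longrightarrow> (\<lambda>t. sin t powr (2 * lam) * f (cos t)) integrable_on {0..pi}"
  by (intro integrable_continuous_real continuous_on_gint lam)

lemma gmean_add:
  assumes "continuous_on {-1..1} f" "continuous_on {-1..1} g"
  shows "gmean lam (\<lambda>x. f x + g x) = gmean lam f + gmean lam g"
  using integral_add[OF gint_integrable[OF assms(1)] gint_integrable[OF assms(2)]]
  by (simp add: gmean_def gint_def add_divide_distrib distrib_left)

lemma gmean_diff:
  assumes "continuous_on {-1..1} f" "continuous_on {-1..1} g"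
  shows "gmean lam (\<lambda>x. f x - g x) = gmean lam f - gmean lam g"
  using integral_diff[OF gint_integrable[OF assms(1)] gint_integrable[OF assms(2)]]
  by (simp add: gmean_def gint_def diff_divide_distrib right_diff_distrib)

lemma gmean_cmult: "gmean lam (\<lambda>x. c * f x) = c * gmean lam f"
proof -
  have "(\<lambda>t. sin t powr (2 * lam) * (c * f (cos t))) = (\<lambda>t. c * (sin t powr (2 * lam) * f (cos t)))"
    by (simp add: mult_ac)
  then show ?thesis by (simp add: gmean_def gint_def)
qed

lemma gmean_const: "gmean lam (\<lambda>_. c) = c"
  using gmean_cmult[of c "\<lambda>_. 1"] gint_1_pos[OF lam] by (simp add: gmean_def)

lemma gmean_sum:
  assumes "finite I" "\<And>i. i \<in> I \<Longrightarrow> continuous_on {-1..1} (f i)"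
  shows "gmean lam (\<lambda>x. \<Sum>i\<in>I. f i x) = (\<Sum>i\<in>I. gmean lam (f i))"
  using assms by (induction rule: finite_induct) (auto simp: gmean_const gmean_add continuous_on_sum)

lemma gmean_mono:
  assumes "continuous_on {-1..1} f" "continuous_on {-1..1} g" "\<And>x. x \<in> {-1..1} \<Longrightarrow> f x \<le> g x"
  shows "gmean lam f \<le> gmean lam g"
  unfolding gmean_def gint_def using gint_1_pos[OF lam]
  by (intro divide_right_mono integral_le gint_integrable assms mult_left_mono) (auto simp: gint_def)

lemma gmean_abs_le:
  assumes "continuous_on {-1..1} f" "\<And>x. x \<in> {-1..1} \<Longrightarrow> \<bar>f x\<bar> \<le> B"
  shows "\<bar>gmean lam f\<bar> \<le> B"
proof -
  have "gmean lam f \<le> gmean lam (\<lambda>_. B)" "gmean lam (\<lambda>_. - B) \<le> gmean lam f"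
    using assms by (auto intro!: gmean_mono) (smt (verit) assms(2) atLeastAtMost_iff)+
  then show ?thesis by (simp add: gmean_const)
qed

text \<open>The weight vanishes only at the endpoints, and there the value follows by
  continuity.\<close>

lemma gmean_square_eq_0:
  assumes f: "continuous_on {-1..1} f" and "gmean lam (\<lambda>x. (f x)\<^sup>2) = 0" and "x \<in> {-1..1}"
  shows "f x = 0"
proof -
  have c: "continuous_on {-1..1} (\<lambda>x. (f x)\<^sup>2)" by (intro continuous_intros f)
  have "integral {0..pi} (\<lambda>t. sin t powr (2 * lam) * (f (cos t))\<^sup>2) = 0"
    using assms(2) gint_1_pos[OF lam] by (simp add: gmean_def gint_def)
  then have z: "sin t powr (2 * lam) * (f (cos t))\<^sup>2 = 0" if "t \<in> {0..pi}" for t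
    using integral_eq_0_iff[OF continuous_on_gint[OF lam c]] that by simp
  have "f y = 0" if "y \<in> {-1<..<1}" for y
  proof -
    have "sin (arccos y) > 0" using that arccos_lt_bounded[of y] by (intro sin_gt_zero) auto
    moreover have "cos (arccos y) = y" "arccos y \<in> {0..pi}"
      using that arccos_lbound[of y] arccos_ubound[of y] by auto
    ultimately show ?thesis using z[of "arccos y"] by auto
  qed
  then show ?thesis
    using continuous_constant_on_closure[of "{-1<..<1}" f 0 x] assms(3) f by auto
qed

end

lemma gmean_poly_square_eq_0:
  assumes "lam > 0" and "gmean lam (\<lambda>x. (poly p x)\<^sup>2) = 0"
  shows "p = 0"
proof (rule ccontr)
  assume "p \<noteq> 0"
  moreover have "{-1..1} \<subseteq> {x. poly p x = 0}"
    using gmean_square_eq_0[OF assms(1), of "poly p"] assms(2) by auto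
  ultimately have "finite {-1..1::real}" using poly_roots_finite[of p] finite_subset by blast
  then show False using infinite_Icc[of "-1::real" 1] by simp
qed

section \<open>Orthonormal polynomials and their differential equation\<close>

lemma poly_span_degree_basis:
  fixes P :: "nat \<Rightarrow> real poly"
  assumes "\<And>k. k < n \<Longrightarrow> degree (P k) = k \<and> P k \<noteq> 0" and "q = 0 \<or> degree q < n"
  shows "\<exists>c. q = (\<Sum>k<n. smult (c k) (P k))"
  using assms
proof (induction n arbitrary: q)
  case (Suc n)
  define a where "a = coeff q n / lead_coeff (P n)"
  define r where "r = q - smult a (P n)"
  have P: "degree (P n) = n" "lead_coeff (P n) \<noteq> 0" using Suc.prems(1)[of n] by (auto simp del: leading_coeff_0_iff) (metis leading_coeff_0_iff)
  have "coeff r i = 0" if "i \<ge> n" for i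
  proof (cases "i = n")
    case True
    then show ?thesis using P by (simp add: r_def a_def)
  next
    case False
    then have "i > n" using that by simp
    then have "coeff q i = 0" "coeff (P n) i = 0"
      using Suc.prems(2) P by (auto intro: coeff_eq_0)
    then show ?thesis by (simp add: r_def)
  qed
  then have "r = 0 \<or> degree r < n" by (metis leading_coeff_0_iff not_le)
  then obtain c where "r = (\<Sum>k<n. smult (c k) (P k))" using Suc.IH[of r] Suc.prems(1) by auto
  then have "q = (\<Sum>k<Suc n. smult ((c(n := a)) k) (P k))" by (simp add: r_def algebra_simps)
  then show ?case by blast
qed simp

text \<open>The zero polynomial has \<open>degree\<close> 0 and is therefore listed separately:
  remainders after cancelling leading terms may vanish, also when \<open>degree p\<close> is
  0.\<close>

definition orth_lower :: "real \<Rightarrow> real poly \<Rightarrow> bool" where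
  "orth_lower lam p \<longleftrightarrow> (\<forall>q. q = 0 \<or> degree q < degree p \<longrightarrow> gmean lam (\<lambda>x. poly p x * poly q x) = 0)"

lemma orth_lowerD:
  assumes "orth_lower lam p" "q = 0 \<or> degree q < degree p"
  shows "gmean lam (\<lambda>x. poly p x * poly q x) = 0" "gmean lam (\<lambda>x. poly q x * poly p x) = 0"
  using assms unfolding orth_lower_def by (auto simp only: mult.commute)

lemma orth_lower_orthonormal:
  assumes "\<And>k. k \<le> max m n \<Longrightarrow> degree (P k) = k \<and> orth_lower lam (P k) \<and> gmean lam (\<lambda>x. poly (P k) x * poly (P k) x) = 1"
  shows "gmean lam (\<lambda>x. poly (P m) x * poly (P n) x) = (if m = n then 1 else 0)"
proof (cases m n rule: linorder_cases)
  case less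
  then show ?thesis using orth_lowerD(2)[of lam "P n" "P m"] assms[of m] assms[of n] by simp
next
  case greater
  then show ?thesis using orth_lowerD(1)[of lam "P m" "P n"] assms[of m] assms[of n] by simp
qed (use assms[of n] in simp)

lemma orth_lower_of_basis:
  assumes lam: "lam > 0" and P: "\<And>k. k < degree p \<Longrightarrow> degree (P k) = k \<and> P k \<noteq> 0"
    and z: "\<And>k. k < degree p \<Longrightarrow> gmean lam (\<lambda>x. poly p x * poly (P k) x) = 0"
  shows "orth_lower lam p"
  unfolding orth_lower_def
proof (intro allI impI)
  fix q :: "real poly" assume "q = 0 \<or> degree q < degree p"
  then obtain c where "q = (\<Sum>k<degree p. smult (c k) (P k))"
    using poly_span_degree_basis[of "degree p" P q] P by auto
  then have "(\<lambda>x. poly p x * poly q x) = (\<lambda>x. \<Sum>k<degree p. c k * (poly p x * poly (P k) x))"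
    by (simp add: poly_sum sum_distrib_left mult_ac)
  then show "gmean lam (\<lambda>x. poly p x * poly q x) = 0"
    using z by (simp add: gmean_sum[OF lam] gmean_cmult[OF lam] continuous_intros)
qed

text \<open>Gram-Schmidt applied to x^n: subtracting the projection onto the lower degrees leaves
  leading coefficient 1, so the remainder is not zero and can be normalized.\<close>

lemma orthonormal_poly_exists:
  assumes lam: "lam > 0"
  shows "\<exists>p. degree p = n \<and> lead_coeff p > 0 \<and> gmean lam (\<lambda>x. poly p x * poly p x) = 1 \<and> orth_lower lam p"
proof (induction n rule: less_induct)
  case (less n)
  then obtain P where P: "degree (P k) = k" "lead_coeff (P k) > 0"
      "gmean lam (\<lambda>x. poly (P k) x * poly (P k) x) = 1" "orth_lower lam (P k)" if "k < n" for k
    by metis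
  have orth: "gmean lam (\<lambda>x. poly (P k) x * poly (P j) x) = (if k = j then 1 else 0)" if "k < n" "j < n" for k j
    using that P by (intro orth_lower_orthonormal) auto
  define c where "c k = gmean lam (\<lambda>x. poly (monom 1 n) x * poly (P k) x)" for k
  define s where "s = (\<Sum>k<n. smult (c k) (P k))"
  define r where "r = monom 1 n - s"
  have coeff_s: "coeff s i = 0" if "i \<ge> n" for i
    using that P(1) by (auto simp: s_def coeff_sum intro!: sum.neutral coeff_eq_0)
  have deg: "degree r = n"
  proof (rule antisym)
    show "degree r \<le> n" using coeff_s by (intro degree_le) (auto simp: r_def)
    show "n \<le> degree r" using coeff_s[of n] by (intro le_degree) (simp add: r_def)
  qed
  then have lc: "lead_coeff r = 1" using coeff_s[of n] by (simp add: r_def)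
  have "gmean lam (\<lambda>x. poly r x * poly (P j) x) = 0" if j: "j < n" for j
  proof -
    have "(\<lambda>x. poly r x * poly (P j) x) = (\<lambda>x. poly (monom 1 n) x * poly (P j) x - (\<Sum>k<n. c k * (poly (P k) x * poly (P j) x)))"
      by (simp add: r_def s_def poly_sum left_diff_distrib sum_distrib_right mult.assoc)
    then have "gmean lam (\<lambda>x. poly r x * poly (P j) x) = c j - (\<Sum>k<n. c k * (if k = j then 1 else 0))"
      using j orth by (simp add: gmean_diff[OF lam] gmean_sum[OF lam] gmean_cmult[OF lam] continuous_intros c_def)
    then show ?thesis using j by (simp add: if_distrib[of "\<lambda>x. _ * x"] cong: if_cong)
  qed
  moreover have "P k \<noteq> 0" if "k < n" for k using P(2)[OF that] by auto
  ultimately have ol: "orth_lower lam r"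
    using P(1) deg by (intro orth_lower_of_basis[OF lam, of r P]) auto
  define N where "N = gmean lam (\<lambda>x. (poly r x)\<^sup>2)"
  have "N \<noteq> 0" using gmean_poly_square_eq_0[OF lam, of r] lc by (auto simp: N_def)
  moreover have "N \<ge> 0"
  proof -
    have "continuous_on {-1..1} (\<lambda>x. (poly r x)\<^sup>2)" by (intro continuous_intros)
    then show ?thesis
      using gmean_mono[OF lam, of "\<lambda>_. 0" "\<lambda>x. (poly r x)\<^sup>2"] gmean_const[OF lam, of 0] by (simp add: N_def)
  qed
  ultimately have N: "N > 0" by simp
  define p where "p = smult (1 / sqrt N) r"
  have dp: "degree p = n" using N deg by (simp add: p_def)
  have "gmean lam (\<lambda>x. poly p x * poly q x) = 0" if "q = 0 \<or> degree q < n" for q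
  proof -
    have eq: "(\<lambda>x. poly p x * poly q x) = (\<lambda>x. 1 / sqrt N * (poly r x * poly q x))"
      by (simp add: p_def)
    show ?thesis unfolding eq gmean_cmult[OF lam] using orth_lowerD(1)[OF ol, of q] that deg by simp
  qed
  moreover have "gmean lam (\<lambda>x. poly p x * poly p x) = 1"
  proof -
    have eq: "(\<lambda>x. poly p x * poly p x) = (\<lambda>x. 1 / N * (poly r x)\<^sup>2)"
      using N by (simp add: p_def power2_eq_square)
    show ?thesis unfolding eq gmean_cmult[OF lam] N_def[symmetric] using N by simp
  qed
  ultimately show ?case
    using dp N lc deg by (intro exI[of _ p]) (simp add: orth_lower_def, simp add: p_def)
qed

text \<open>Existence of one system makes the choice in \<open>gegen_poly\<close> satisfy its
  specification; all later facts derive from these conditions.\<close>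

lemma gegen_poly_orthonormal:
  assumes "\<alpha> > -1/2"
  shows "degree (gegen_poly \<alpha> n) = n" and "gegen_poly \<alpha> n \<noteq> 0"
    and "gmean (\<alpha> + 1/2) (\<lambda>x. poly (gegen_poly \<alpha> m) x * poly (gegen_poly \<alpha> n) x) = (if m = n then 1 else 0)"
    and "orth_lower (\<alpha> + 1/2) (gegen_poly \<alpha> n)"
proof -
  let ?lam = "\<alpha> + 1/2"
  have lam: "?lam > 0" using assms by simp
  have eq: "integral {-1..1} (\<lambda>x. gegen_weight \<alpha> x * poly (P m) x * poly (P n) x)
      = gmean ?lam (\<lambda>x. poly (P m) x * poly (P n) x)" for P m n
    using integral_gegen_weight[OF assms, of "\<lambda>x. poly (P m) x * poly (P n) x"]
    by (simp add: mult.assoc integral_unique continuous_intros)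
  obtain P where P: "degree (P n) = n" "lead_coeff (P n) > 0"
      "gmean ?lam (\<lambda>x. poly (P n) x * poly (P n) x) = 1" "orth_lower ?lam (P n)" for n
    using orthonormal_poly_exists[OF lam] by metis
  have "gmean ?lam (\<lambda>x. poly (P m) x * poly (P n) x) = (if m = n then 1 else 0)" for m n
    using P by (intro orth_lower_orthonormal) auto
  then have "is_orthonormal_poly_sys \<alpha> P"
    unfolding is_orthonormal_poly_sys_def eq using P by auto
  then have sys: "is_orthonormal_poly_sys \<alpha> (gegen_poly \<alpha>)"
    unfolding gegen_poly_def using someI[of "is_orthonormal_poly_sys \<alpha>" P] by simp
  then show d: "degree (gegen_poly \<alpha> n) = n" "gegen_poly \<alpha> n \<noteq> 0" for n
    unfolding is_orthonormal_poly_sys_def by (auto, metis leading_coeff_0_iff less_irrefl)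
  show o: "gmean ?lam (\<lambda>x. poly (gegen_poly \<alpha> m) x * poly (gegen_poly \<alpha> n) x) = (if m = n then 1 else 0)" for m n
    using sys unfolding is_orthonormal_poly_sys_def eq by blast
  show "orth_lower ?lam (gegen_poly \<alpha> n)"
    by (rule orth_lower_of_basis[OF lam, of _ "gegen_poly \<alpha>"]) (auto simp: d o)
qed

text \<open>The Gegenbauer operator. Acting on functions of cos t it is (sin t)^(-2 lam) d/dt ((sin
  t)^(2 lam) d/dt), which explains its symmetry below.\<close>

definition gegen_op :: "real \<Rightarrow> real poly \<Rightarrow> real poly" where
  "gegen_op lam p = [:1, 0, -1:] * pderiv (pderiv p) - smult (2 * lam + 1) ([:0, 1:] * pderiv p)"

lemma poly_gegen_op:
  "poly (gegen_op lam p) x = (1 - x\<^sup>2) * poly (pderiv (pderiv p)) x - (2 * lam + 1) * x * poly (pderiv p) x"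
  by (simp add: gegen_op_def power2_eq_square algebra_simps)

lemma coeff_gegen_op:
  "coeff (gegen_op lam p) i = real (i + 2) * real (i + 1) * coeff p (i + 2) - real i * (real i + 2 * lam) * coeff p i"
proof -
  consider "i = 0" | "i = 1" | j where "i = Suc (Suc j)" by (metis One_nat_def not0_implies_Suc)
  then show ?thesis
    by cases (simp_all add: gegen_op_def coeff_pderiv algebra_simps)
qed

text \<open>In the angle, the weighted difference of the integrands is the derivative of the
  weighted Wronskian \<open>?F\<close>, which vanishes at 0 and pi.\<close>

lemma gegen_op_symmetric:
  assumes lam: "lam > 0"
  shows "gmean lam (\<lambda>x. poly (gegen_op lam p) x * poly q x) = gmean lam (\<lambda>x. poly p x * poly (gegen_op lam q) x)"
proof -
  let ?F = "\<lambda>t. - (sin t powr (2 * lam + 1) * (poly (pderiv p) (cos t) * poly q (cos t) - poly p (cos t) * poly (pderiv q) (cos t)))"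
  let ?f = "\<lambda>x. poly (gegen_op lam p) x * poly q x - poly p x * poly (gegen_op lam q) x"
  have "((\<lambda>t. sin t powr (2 * lam) * ?f (cos t)) has_integral (?F pi - ?F 0)) {0..pi}"
  proof (rule fundamental_theorem_of_calculus_interior)
    show "continuous_on {0..pi} ?F"
      using lam by (intro continuous_intros continuous_on_sin_powr) auto
    fix t assume t: "t \<in> {0<..<pi}"
    then have s: "sin t > 0" by (auto intro: sin_gt_zero)
    have e: "sin t powr (2 * lam + 1) = sin t powr (2 * lam) * sin t" using s by (simp add: powr_add)
    have c: "((\<lambda>t. poly u (cos t)) has_real_derivative poly (pderiv u) (cos t) * - sin t) (at t)" for u
      by (rule DERIV_chain2[OF poly_DERIV DERIV_cos])
    have w: "((\<lambda>t. sin t powr (2 * lam + 1)) has_real_derivative (2 * lam + 1) * sin t powr (2 * lam) * cos t) (at t)"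
      using DERIV_fun_powr[OF DERIV_sin s, of "2 * lam + 1"] by simp
    have "(?F has_real_derivative sin t powr (2 * lam) * ?f (cos t)) (at t)"
    proof (rule DERIV_cong[OF DERIV_minus[OF DERIV_mult[OF w DERIV_diff[OF DERIV_mult[OF c c] DERIV_mult[OF c c]]]]])
      show "- ((2 * lam + 1) * sin t powr (2 * lam) * cos t *
           (poly (pderiv p) (cos t) * poly q (cos t) - poly p (cos t) * poly (pderiv q) (cos t)) +
          (poly (pderiv (pderiv p)) (cos t) * - sin t * poly q (cos t) +
           poly (pderiv q) (cos t) * - sin t * poly (pderiv p) (cos t) -
           (poly (pderiv p) (cos t) * - sin t * poly (pderiv q) (cos t) +
            poly (pderiv (pderiv q)) (cos t) * - sin t * poly p (cos t))) *
          sin t powr (2 * lam + 1)) = sin t powr (2 * lam) * ?f (cos t)"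
        unfolding poly_gegen_op e sin_squared_eq[symmetric] by (simp add: power2_eq_square algebra_simps)
    qed
    then show "(?F has_vector_derivative sin t powr (2 * lam) * ?f (cos t)) (at t)"
      by (simp add: has_real_derivative_iff_has_vector_derivative)
  qed simp
  then have "gint lam ?f = 0" unfolding gint_def using lam by (simp add: integral_unique)
  then have "gmean lam ?f = 0" by (simp add: gmean_def)
  then show ?thesis by (simp add: gmean_diff[OF lam] continuous_intros)
qed

text \<open>The eigenvalue is read off from the leading coefficient, so r has lower degree than p.
  Its norm vanishes: the operator moves by symmetry from p to r, does not raise the degree of r, and
  p is orthogonal to all lower degrees.\<close>

lemma orth_lower_imp_gegen_op:
  assumes lam: "lam > 0" and orth: "orth_lower lam p"
  shows "gegen_op lam p = smult (- (real (degree p) * (real (degree p) + 2 * lam))) p"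
proof -
  define n where "n = degree p"
  define e where "e = real n * (real n + 2 * lam)"
  define r where "r = gegen_op lam p + smult e p"
  have cr: "coeff r i = 0" if "i \<ge> n" for i
  proof (cases "i = n")
    case True
    then show ?thesis by (simp add: r_def coeff_gegen_op e_def coeff_eq_0 n_def)
  next
    case False
    then show ?thesis using that by (simp add: r_def coeff_gegen_op coeff_eq_0 n_def)
  qed
  have small: "r = 0 \<or> degree r < n" by (metis cr leading_coeff_0_iff not_le)
  have small': "gegen_op lam r = 0 \<or> degree (gegen_op lam r) < n"
  proof -
    have "coeff (gegen_op lam r) i = 0" if "i \<ge> n" for i using that cr by (simp add: coeff_gegen_op)
    then show ?thesis by (metis leading_coeff_0_iff not_le)
  qed
  have "(\<lambda>x. (poly r x)\<^sup>2) = (\<lambda>x. poly (gegen_op lam p) x * poly r x + e * (poly p x * poly r x))"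
    by (simp add: r_def power2_eq_square algebra_simps)
  then have "gmean lam (\<lambda>x. (poly r x)\<^sup>2)
      = gmean lam (\<lambda>x. poly (gegen_op lam p) x * poly r x) + e * gmean lam (\<lambda>x. poly p x * poly r x)"
    by (simp add: gmean_add[OF lam] gmean_cmult[OF lam] continuous_intros)
  also have "\<dots> = 0"
    unfolding gegen_op_symmetric[OF lam]
    using orth_lowerD(1)[OF orth] small small' by (simp add: n_def)
  finally have "r = 0" by (rule gmean_poly_square_eq_0[OF lam])
  then show ?thesis by (simp add: r_def e_def n_def eq_neg_iff_add_eq_0)
qed

section \<open>Pointwise bounds\<close>

text \<open>As cot has derivative -1 / sin^2, the function \<open>G t * exp (k * cot t)\<close>
  decreases and \<open>G t * exp (- k * cot t)\<close> increases.\<close>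

lemma gronwall_cot:
  fixes G G' :: "real \<Rightarrow> real"
  assumes der: "\<And>t. 0 < t \<Longrightarrow> t < pi \<Longrightarrow> (G has_real_derivative G' t) (at t)"
    and bnd: "\<And>t. 0 < t \<Longrightarrow> t < pi \<Longrightarrow> \<bar>G' t\<bar> \<le> k * G t / (sin t)\<^sup>2"
    and k: "k \<ge> 0" and Gs: "G s \<ge> 0"
    and st: "0 < s" "s < pi" "0 < t" "t < pi"
  shows "G t \<le> G s * exp (k * \<bar>cot s - cot t\<bar>)"
proof -
  have dG: "((\<lambda>x. G x * exp (c * cot x)) has_real_derivative
      (G' x - c * G x / (sin x)\<^sup>2) * exp (c * cot x)) (at x)" if "0 < x" "x < pi" for x c
  proof -
    have "sin x \<noteq> 0" using that sin_gt_zero[of x] by simp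
    then show ?thesis
      by (auto intro!: derivative_eq_intros der[OF that] DERIV_cot simp: field_simps)
  qed
  have bd: "- (k * G x / (sin x)\<^sup>2) \<le> G' x" "G' x \<le> k * G x / (sin x)\<^sup>2" if "0 < x" "x < pi" for x
    using bnd[OF that] by linarith+
  show ?thesis
  proof (cases "s \<le> t")
    case True
    have "G t * exp (k * cot t) \<le> G s * exp (k * cot s)"
    proof (rule DERIV_nonpos_imp_nonincreasing[OF True])
      fix x assume x: "s \<le> x" "x \<le> t"
      then have x': "0 < x" "x < pi" using st by auto
      have "(G' x - k * G x / (sin x)\<^sup>2) * exp (k * cot x) \<le> 0"
        using bd(2)[OF x'] by (intro mult_nonpos_nonneg) auto
      then show "\<exists>y. ((\<lambda>x. G x * exp (k * cot x)) has_real_derivative y) (at x) \<and> y \<le> 0"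
        using dG[OF x', of k] by blast
    qed
    then have le: "G t \<le> G s * exp (k * (cot s - cot t))" by (simp add: right_diff_distrib exp_diff field_simps)
    have "k * (cot s - cot t) \<le> k * \<bar>cot s - cot t\<bar>" using k by (intro mult_left_mono) auto
    then show ?thesis using le Gs by (meson exp_le_cancel_iff mult_left_mono order_trans)
  next
    case False
    then have ts: "t \<le> s" by simp
    have "G t * exp (- k * cot t) \<le> G s * exp (- k * cot s)"
    proof (rule DERIV_nonneg_imp_nondecreasing[OF ts])
      fix x assume x: "t \<le> x" "x \<le> s"
      then have x': "0 < x" "x < pi" using st by auto
      have "(G' x - - k * G x / (sin x)\<^sup>2) * exp (- k * cot x) \<ge> 0"
        using bd(1)[OF x'] by (intro mult_nonneg_nonneg) auto
      then show "\<exists>y. ((\<lambda>x. G x * exp (- k * cot x)) has_real_derivative y) (at x) \<and> 0 \<le> y"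
        using dG[OF x', of "- k"] by blast
    qed
    then have le: "G t \<le> G s * exp (k * (cot t - cot s))"
      by (simp add: right_diff_distrib exp_diff exp_minus field_simps)
    have "k * (cot t - cot s) \<le> k * \<bar>cot s - cot t\<bar>" using k by (intro mult_left_mono) auto
    then show ?thesis using le Gs by (meson exp_le_cancel_iff mult_left_mono order_trans)
  qed
qed

text \<open>Jordan's inequality, from the concavity of the sine.\<close>

lemma two_x_le_pi_sin:
  fixes x :: real
  assumes "0 \<le> x" "x \<le> pi / 2"
  shows "2 * x \<le> pi * sin x"
proof -
  have cv: "convex_on {0..pi/2} (\<lambda>x. - sin x)"
    by (rule convex_on_realI[where f' = "\<lambda>x. - cos x"])
      (auto intro!: derivative_eq_intros cos_monotone_0_pi_le)
  have "- sin ((1 - 2 * x / pi) *\<^sub>R 0 + (2 * x / pi) *\<^sub>R (pi/2)) \<le> (1 - 2 * x / pi) * - sin 0 + 2 * x / pi * - sin (pi/2)"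
    using assms by (intro convex_onD[OF cv]) (auto simp: field_simps)
  then show ?thesis using pi_gt_zero by (simp add: field_simps)
qed

text \<open>With \<open>u = (sin t) powr lam * p (cos t)\<close> the equation becomes \<open>u'' = - (nu\<^sup>2 + lam (1 - lam) / (sin t)\<^sup>2) u\<close>. The perturbation of
  the oscillator is integrable at scale \<open>1 / nu\<close> from the endpoints, so the energy \<open>G\<close> stays within a
  constant factor there, and the \<open>L\<^sub>2\<close> normalization fixes its size.\<close>

locale gegen_ode =
  fixes lam n :: real and p :: "real poly"
  assumes lam: "lam > 0" and n1: "n \<ge> 1"
    and ode: "\<And>x. (1 - x\<^sup>2) * poly (pderiv (pderiv p)) x - (2 * lam + 1) * x * poly (pderiv p) x
                = - (n * (n + 2 * lam)) * poly p x"
begin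

definition "nu = n + lam"
definition "mu = \<bar>lam * (1 - lam)\<bar>"
definition "y t = poly p (cos t)" for t
definition "z t = - sin t * poly (pderiv p) (cos t)" for t
definition "u t = sin t powr lam * y t" for t
definition "v t = sin t powr lam * z t + lam * sin t powr (lam - 1) * cos t * y t" for t
definition "G t = (v t)\<^sup>2 + nu\<^sup>2 * (u t)\<^sup>2" for t

lemma nu1: "nu > 1" using lam n1 by (simp add: nu_def)
lemma mu0: "mu \<ge> 0" by (simp add: mu_def)
lemma eigenvalue: "n * (n + 2 * lam) = nu\<^sup>2 - lam\<^sup>2" by (simp add: nu_def power2_eq_square algebra_simps)

lemma dy: "(y has_real_derivative z t) (at t)"
  unfolding y_def z_def using DERIV_chain2[OF poly_DERIV DERIV_cos, of p t] by (simp add: mult.commute)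

lemma dz: "(z has_real_derivative 2 * lam * cos t * poly (pderiv p) (cos t) - (nu\<^sup>2 - lam\<^sup>2) * y t) (at t)"
proof -
  have "(z has_real_derivative - cos t * poly (pderiv p) (cos t) + poly (pderiv (pderiv p)) (cos t) * - sin t * - sin t) (at t)"
    unfolding z_def
    by (rule DERIV_mult[OF DERIV_minus[OF DERIV_sin] DERIV_chain2[OF poly_DERIV DERIV_cos]])
  moreover have "(sin t)\<^sup>2 = 1 - (cos t)\<^sup>2" by (simp add: sin_squared_eq)
  then have "poly (pderiv (pderiv p)) (cos t) * - sin t * - sin t = (1 - (cos t)\<^sup>2) * poly (pderiv (pderiv p)) (cos t)"
    by (simp add: power2_eq_square)
  ultimately show ?thesis
    using ode[of "cos t"] unfolding eigenvalue y_def[symmetric]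
    by (auto elim!: DERIV_cong simp: algebra_simps)
qed

lemma dpow:
  assumes "0 < t" "t < pi"
  shows "((\<lambda>t. sin t powr e) has_real_derivative e * sin t powr (e - 1) * cos t) (at t)"
  using DERIV_fun_powr[OF DERIV_sin sin_gt_zero[OF assms], of e] by simp

lemma du:
  assumes "0 < t" "t < pi"
  shows "(u has_real_derivative v t) (at t)"
  unfolding u_def v_def by (rule DERIV_cong[OF DERIV_mult[OF dpow[OF assms] dy]]) (simp add: algebra_simps)

lemma dv:
  assumes "0 < t" "t < pi"
  shows "(v has_real_derivative - u t * (nu\<^sup>2 + lam * (1 - lam) / (sin t)\<^sup>2)) (at t)"
proof -
  define S where "S = sin t"
  define w where "w = S powr (lam - 2)"
  define q where "q = poly (pderiv p) (cos t)"
  have S: "S > 0" using sin_gt_zero[OF assms] by (simp add: S_def)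
  have pw: "S powr lam = w * S\<^sup>2" "S powr (lam - 1) = w * S" "S powr (lam - 1 - 1) = w"
    using S powr_add[of S "lam - 2" 2] powr_add[of S "lam - 2" 1] by (auto simp: w_def)
  have cc: "(cos t)\<^sup>2 = 1 - S\<^sup>2" by (simp add: S_def cos_squared_eq)
  let ?D = "(lam * S powr (lam - 1) * cos t * z t + (2 * lam * cos t * q - (nu\<^sup>2 - lam\<^sup>2) * y t) * S powr lam)
      + ((lam * ((lam - 1) * S powr (lam - 1 - 1) * cos t) * cos t + - S * (lam * S powr (lam - 1))) * y t
         + z t * (lam * S powr (lam - 1) * cos t))"
  have "(v has_real_derivative ?D) (at t)"
    unfolding v_def S_def q_def
    by (rule DERIV_add[OF DERIV_mult[OF dpow[OF assms] dz]
          DERIV_mult[OF DERIV_mult[OF DERIV_cmult[OF dpow[OF assms]] DERIV_cos] dy]])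
  moreover have "?D = - u t * (nu\<^sup>2 + lam * (1 - lam) / (sin t)\<^sup>2)"
  proof -
    have z: "z t = - S * q" by (simp add: z_def S_def q_def)
    have ut: "u t = w * S\<^sup>2 * y t" using pw(1) by (simp add: u_def S_def)
    have "- u t * (nu\<^sup>2 + lam * (1 - lam) / (sin t)\<^sup>2) = - w * y t * (nu\<^sup>2 * S\<^sup>2 + lam * (1 - lam))"
      unfolding ut S_def[symmetric] using S by (simp add: field_simps)
    moreover have "?D
      = - (nu\<^sup>2 - lam\<^sup>2) * y t * w * S\<^sup>2 + lam * (lam - 1) * w * (cos t)\<^sup>2 * y t - lam * w * S\<^sup>2 * y t"
      unfolding pw z by (simp add: power2_eq_square algebra_simps)
    ultimately show ?thesis unfolding cc by (simp add: power2_eq_square algebra_simps)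
  qed
  ultimately show ?thesis by (rule DERIV_cong)
qed

lemma uv_le_G: "2 * nu * \<bar>u t * v t\<bar> \<le> G t"
proof -
  have "0 \<le> (\<bar>v t\<bar> - nu * \<bar>u t\<bar>)\<^sup>2" by simp
  then show ?thesis by (simp add: G_def power2_diff power_mult_distrib abs_mult algebra_simps)
qed

lemma G_nonneg: "G t \<ge> 0" by (simp add: G_def)

text \<open>The oscillator terms cancel in G', so only the perturbation lam (1 - lam) / sin^2
  remains; 2 |u v| \<le> G / nu gains the factor 1 / nu.\<close>

lemma G_compare:
  assumes "0 < s" "s < pi" "0 < t" "t < pi"
  shows "G t \<le> G s * exp (mu / nu * \<bar>cot s - cot t\<bar>)"
proof (rule gronwall_cot[where G' = "\<lambda>t. - 2 * (u t * v t) * (lam * (1 - lam)) / (sin t)\<^sup>2", OF _ _ _ G_nonneg assms])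
  fix t assume t: "0 < t" "t < pi"
  have S: "sin t > 0" by (rule sin_gt_zero[OF t])
  show "(G has_real_derivative - 2 * (u t * v t) * (lam * (1 - lam)) / (sin t)\<^sup>2) (at t)"
    unfolding G_def
    by (rule DERIV_cong[OF DERIV_add[OF DERIV_power[OF dv[OF t]] DERIV_cmult[OF DERIV_power[OF du[OF t]]]]])
      (use S in \<open>simp add: field_simps\<close>)
  have "2 * \<bar>u t * v t\<bar> \<le> G t / nu" using uv_le_G[of t] nu1 by (simp add: field_simps)
  then have "2 * \<bar>u t * v t\<bar> * mu \<le> G t / nu * mu" using mu0 by (rule mult_right_mono)
  then have "2 * \<bar>u t * v t\<bar> * mu / (sin t)\<^sup>2 \<le> G t / nu * mu / (sin t)\<^sup>2" by (rule divide_right_mono) simp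
  then show "\<bar>- 2 * (u t * v t) * (lam * (1 - lam)) / (sin t)\<^sup>2\<bar> \<le> mu / nu * G t / (sin t)\<^sup>2"
    by (simp add: abs_mult mu_def mult_ac)
qed (use mu0 nu1 in simp)

text \<open>Equipartition: integrating (u v)' = v^2 + u u'' bounds the integral of v^2 by a multiple
  of nu^2 times that of u^2, up to boundary terms of order G / nu. As G is comparable to G (pi/2) on
  [pi/4, 3 pi/4], the normalization of u bounds G.\<close>

lemma G_mid_bound:
  assumes I: "integral {0..pi} (\<lambda>t. sin t powr (2 * lam) * (poly p (cos t))\<^sup>2) \<le> I"
    and big: "nu \<ge> 2 * exp (2 * mu)"
  shows "G (pi/2) \<le> exp mu * (2 + 2 * mu) * I * nu\<^sup>2"
proof -
  let ?a = "pi/4" and ?b = "3*pi/4"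
  have u2: "(u t)\<^sup>2 = sin t powr (2 * lam) * (poly p (cos t))\<^sup>2" if "t \<in> {?a..?b}" for t
  proof -
    have "0 < t" "t < pi" using that pi_gt_zero unfolding atLeastAtMost_iff by linarith+
    then have "sin t > 0" by (rule sin_gt_zero)
    then show ?thesis by (simp add: u_def y_def power_mult_distrib powr_power mult.commute)
  qed
  have c: "continuous_on {0..pi} (\<lambda>t. sin t powr (2 * lam) * (poly p (cos t))\<^sup>2)"
    using continuous_on_gint[OF lam, of "\<lambda>x. (poly p x)\<^sup>2"] by (simp add: continuous_on_power)
  have ab: "?a \<le> ?b" "{?a..?b} \<subseteq> {0..pi}" using pi_gt_zero by auto
  have int_u: "(\<lambda>t. (u t)\<^sup>2) integrable_on {?a..?b}"
    using integrable_continuous_real[OF continuous_on_subset[OF c ab(2)]]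
    by (rule integrable_eq) (use u2 in auto)
  have "integral {?a..?b} (\<lambda>t. (u t)\<^sup>2) = integral {?a..?b} (\<lambda>t. sin t powr (2 * lam) * (poly p (cos t))\<^sup>2)"
    by (rule integral_cong[OF u2])
  also have "\<dots> \<le> integral {0..pi} (\<lambda>t. sin t powr (2 * lam) * (poly p (cos t))\<^sup>2)"
    by (rule integral_subset_le[OF ab(2)])
      (use integrable_continuous_real[OF c] integrable_continuous_real[OF continuous_on_subset[OF c ab(2)]] in auto)
  finally have uI: "integral {?a..?b} (\<lambda>t. (u t)\<^sup>2) \<le> I" using I by simp
  have cot1: "\<bar>cot t\<bar> \<le> 1" "(sin t)\<^sup>2 \<ge> 1/2" "sin t > 0" if "t \<in> {?a..?b}" for t
  proof -
    have t: "0 < t" "t < pi" using that pi_gt_zero unfolding atLeastAtMost_iff by linarith+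
    show S: "sin t > 0" by (rule sin_gt_zero[OF t])
    have "cos (2 * t) \<le> 0"
    proof -
      have "cos (2 * t) = - cos (2 * t - pi)" by (simp add: cos_diff)
      moreover have "cos (2 * t - pi) \<ge> 0" using that by (intro cos_ge_zero) auto
      ultimately show ?thesis by simp
    qed
    then show s2: "(sin t)\<^sup>2 \<ge> 1/2" by (simp add: cos_double_sin)
    then have "(cos t)\<^sup>2 \<le> (sin t)\<^sup>2" by (simp add: cos_squared_eq)
    then have "\<bar>cos t\<bar> \<le> \<bar>sin t\<bar>" by (simp only: abs_le_square_iff)
    then show "\<bar>cot t\<bar> \<le> 1" using S by (simp add: cot_def abs_divide)
  qed
  have ratio: "mu / nu \<le> mu" using nu1 mu0 mult_left_mono[of 1 nu mu] by (simp add: field_simps)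
  have ex: "exp (mu / nu * \<bar>cot t\<bar>) \<le> exp mu" if "t \<in> {?a..?b}" for t
    using mult_mono[OF ratio cot1(1)[OF that]] mu0 nu1 by simp
  have G1: "G t \<le> G (pi/2) * exp mu" "G (pi/2) * exp (- mu) \<le> G t" if "t \<in> {?a..?b}" for t
  proof -
    have t: "0 < t" "t < pi" "0 < pi/2" "pi/2 < pi" using that pi_gt_zero unfolding atLeastAtMost_iff by linarith+
    have c0: "cot (pi/2) = (0::real)" by (simp add: cot_def)
    have "G t \<le> G (pi/2) * exp (mu / nu * \<bar>cot t\<bar>)"
      using G_compare[OF t(3,4,1,2)] unfolding c0 by simp
    also have "\<dots> \<le> G (pi/2) * exp mu" using ex[OF that] G_nonneg by (intro mult_left_mono)
    finally show "G t \<le> G (pi/2) * exp mu" .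
    have "G (pi/2) \<le> G t * exp (mu / nu * \<bar>cot t\<bar>)"
      using G_compare[OF t(1,2,3,4)] unfolding c0 by simp
    also have "\<dots> \<le> G t * exp mu" using ex[OF that] G_nonneg by (intro mult_left_mono)
    finally show "G (pi/2) * exp (- mu) \<le> G t" by (simp add: exp_minus field_simps)
  qed
  define W' where "W' t = v t * v t - u t * (u t * (nu\<^sup>2 + lam * (1 - lam) / (sin t)\<^sup>2))" for t
  have intW: "(W' has_integral (u ?b * v ?b - u ?a * v ?a)) {?a..?b}"
  proof (rule fundamental_theorem_of_calculus[OF ab(1)])
    fix t assume "t \<in> {?a..?b}"
    then have t: "0 < t" "t < pi" using pi_gt_zero unfolding atLeastAtMost_iff by linarith+
    have "((\<lambda>t. u t * v t) has_real_derivative W' t) (at t)"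
      by (rule DERIV_cong[OF DERIV_mult[OF du[OF t] dv[OF t]]]) (simp add: W'_def mult_ac)
    then show "((\<lambda>t. u t * v t) has_vector_derivative W' t) (at t within {?a..?b})"
      by (simp add: has_real_derivative_iff_has_vector_derivative has_vector_derivative_at_within)
  qed
  have intF: "((\<lambda>t. G (pi/2) * exp (- mu) - (2 + 2 * mu) * nu\<^sup>2 * (u t)\<^sup>2) has_integral
      G (pi/2) * exp (- mu) * (?b - ?a) - (2 + 2 * mu) * nu\<^sup>2 * integral {?a..?b} (\<lambda>t. (u t)\<^sup>2)) {?a..?b}"
    using has_integral_const_real[of "G (pi/2) * exp (- mu)" ?a ?b] ab(1)
    by (intro has_integral_diff has_integral_mult_right integrable_integral int_u) (simp add: mult.commute)
  have leW: "G (pi/2) * exp (- mu) - (2 + 2 * mu) * nu\<^sup>2 * (u t)\<^sup>2 \<le> W' t" if t: "t \<in> {?a..?b}" for t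
  proof -
    have "lam * (1 - lam) / (sin t)\<^sup>2 \<le> mu / (1/2)"
      using cot1[OF t] mu0 by (intro frac_le) (auto simp: mu_def)
    also have "\<dots> \<le> 2 * mu * nu\<^sup>2" using mu0 nu1 one_le_power[of nu 2] mult_left_mono[of 1 "nu\<^sup>2" "2 * mu"] by (simp add: less_imp_le)
    finally have "nu\<^sup>2 + lam * (1 - lam) / (sin t)\<^sup>2 \<le> (1 + 2 * mu) * nu\<^sup>2" by (simp add: algebra_simps)
    then have "(u t)\<^sup>2 * (nu\<^sup>2 + lam * (1 - lam) / (sin t)\<^sup>2) \<le> (u t)\<^sup>2 * ((1 + 2 * mu) * nu\<^sup>2)"
      by (intro mult_left_mono) auto
    moreover have "W' t = G t - nu\<^sup>2 * (u t)\<^sup>2 - (u t)\<^sup>2 * (nu\<^sup>2 + lam * (1 - lam) / (sin t)\<^sup>2)"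
      by (simp add: W'_def G_def power2_eq_square)
    ultimately show ?thesis using G1(2)[OF t] by (simp add: algebra_simps)
  qed
  have "G (pi/2) * exp (- mu) * (?b - ?a) - (2 + 2 * mu) * nu\<^sup>2 * integral {?a..?b} (\<lambda>t. (u t)\<^sup>2)
      \<le> u ?b * v ?b - u ?a * v ?a"
    by (rule has_integral_le[OF intF intW leW])
  moreover have "\<bar>u t * v t\<bar> \<le> G (pi/2) * exp (- mu) / 4" if t: "t \<in> {?a..?b}" for t
  proof -
    have "2 * nu * \<bar>u t * v t\<bar> \<le> G (pi/2) * exp mu" using uv_le_G[of t] G1(1)[OF t] by simp
    moreover have "4 * exp (2 * mu) * \<bar>u t * v t\<bar> \<le> 2 * nu * \<bar>u t * v t\<bar>"
      using big by (intro mult_right_mono) auto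
    ultimately have "4 * exp (2 * mu) * \<bar>u t * v t\<bar> \<le> G (pi/2) * exp mu" by simp
    moreover have "exp (2 * mu) = exp mu * exp mu" by (simp add: mult_exp_exp)
    ultimately have "exp mu * (4 * exp mu * \<bar>u t * v t\<bar>) \<le> exp mu * G (pi/2)" by (simp add: mult_ac)
    then have "4 * exp mu * \<bar>u t * v t\<bar> \<le> G (pi/2)" by (simp only: mult_le_cancel_left_pos exp_gt_zero)
    then show ?thesis by (simp add: exp_minus field_simps)
  qed
  then have "\<bar>u ?b * v ?b\<bar> \<le> G (pi/2) * exp (- mu) / 4" "\<bar>u ?a * v ?a\<bar> \<le> G (pi/2) * exp (- mu) / 4"
    using ab(1) by auto
  moreover have "(2 + 2 * mu) * nu\<^sup>2 * integral {?a..?b} (\<lambda>t. (u t)\<^sup>2) \<le> (2 + 2 * mu) * nu\<^sup>2 * I"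
    using mu0 uI by (intro mult_left_mono) auto
  \<comment> \<open>The interval has length pi/2 \<ge> 3/2; the two boundary terms take a quarter
    each, and one full copy of \<open>G (pi/2) * exp (- mu)\<close> is left.\<close>
  moreover have "G (pi/2) * exp (- mu) * (?b - ?a) \<ge> G (pi/2) * exp (- mu) * (3/2)"
    using pi_gt3 G_nonneg by (intro mult_left_mono) auto
  ultimately have "G (pi/2) * exp (- mu) \<le> (2 + 2 * mu) * nu\<^sup>2 * I" by linarith
  then show ?thesis by (simp add: exp_minus field_simps)
qed

text \<open>From sin t \<ge> 1 / (4 nu) follows |cot t| \<le> 4 nu, so G exceeds its value at pi/2
  at most by the factor exp (4 mu).\<close>

lemma interior_bound:
  assumes I: "integral {0..pi} (\<lambda>t. sin t powr (2 * lam) * (poly p (cos t))\<^sup>2) \<le> I"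
    and big: "nu \<ge> 2 * exp (2 * mu)" and t: "0 < t" "t < pi" "sin t \<ge> 1 / (4 * nu)"
  shows "(sin t powr lam * poly p (cos t))\<^sup>2 \<le> exp (5 * mu) * (2 + 2 * mu) * I"
proof -
  have S: "sin t > 0" by (rule sin_gt_zero[OF t(1,2)])
  have "\<bar>cot t\<bar> \<le> 1 / sin t" using S by (simp add: cot_def abs_divide divide_right_mono)
  also have "\<dots> \<le> 4 * nu" using t(3) S nu1 by (simp add: field_simps)
  finally have "mu / nu * \<bar>cot t\<bar> \<le> mu / nu * (4 * nu)" using mu0 nu1 by (intro mult_left_mono) auto
  then have ex: "mu / nu * \<bar>cot t\<bar> \<le> 4 * mu" using nu1 by simp
  have "nu\<^sup>2 * (u t)\<^sup>2 \<le> G t" by (simp add: G_def)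
  also have "G t \<le> G (pi/2) * exp (mu / nu * \<bar>cot t\<bar>)"
    using G_compare[of "pi/2" t] t by (simp add: cot_def)
  also have "\<dots> \<le> G (pi/2) * exp (4 * mu)" using ex G_nonneg by (intro mult_left_mono) auto
  also have "\<dots> \<le> exp mu * (2 + 2 * mu) * I * nu\<^sup>2 * exp (4 * mu)"
    using G_mid_bound[OF I big] by (intro mult_right_mono) auto
  also have "\<dots> = nu\<^sup>2 * ((exp mu * exp (4 * mu)) * (2 + 2 * mu) * I)" by (simp only: mult_ac)
  also have "exp mu * exp (4 * mu) = exp (5 * mu)" by (simp add: mult_exp_exp)
  finally have "(u t)\<^sup>2 \<le> exp (5 * mu) * (2 + 2 * mu) * I"
    using nu1 by (simp add: mult_le_cancel_left_pos)
  then show ?thesis by (simp add: u_def y_def)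
qed

text \<open>Closer to the endpoint the energy G is no longer comparable, but z^2 + e y^2 decreases
  on [0, pi/2]. Hence |y| is largest at 0, with value A, and |y'| \<le> nu A. At t1 \<le> 1 / (2 nu)
  the value is still at least A / 2, and there the hypothesis on K applies.\<close>

lemma near_bound:
  assumes K: "\<And>t. 0 < t \<Longrightarrow> t < pi \<Longrightarrow> sin t \<ge> 1 / (4 * nu) \<Longrightarrow> \<bar>sin t powr lam * poly p (cos t)\<bar> \<le> K"
    and t: "0 \<le> t" "t \<le> pi/2"
  shows "\<bar>poly p (cos t)\<bar> \<le> 2 * K * (4 * nu) powr lam" and "\<bar>sin t powr lam * poly p (cos t)\<bar> \<le> 2 * K"
proof -
  define e where "e = nu\<^sup>2 - lam\<^sup>2"
  have e: "e > 0" "e \<le> nu\<^sup>2"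
  proof -
    have "n * (n + 2 * lam) > 0" using lam n1 by simp
    then show "e > 0" unfolding e_def eigenvalue .
  qed (simp add: e_def)
  have En: "(z s)\<^sup>2 + e * (y s)\<^sup>2 \<le> (z 0)\<^sup>2 + e * (y 0)\<^sup>2" if s: "0 \<le> s" "s \<le> pi/2" for s
  proof (rule DERIV_nonpos_imp_nonincreasing[OF s(1)])
    fix x assume x: "0 \<le> x" "x \<le> s"
    have "((\<lambda>s. (z s)\<^sup>2 + e * (y s)\<^sup>2) has_real_derivative - 4 * lam * sin x * cos x * (poly (pderiv p) (cos x))\<^sup>2) (at x)"
      by (rule DERIV_cong[OF DERIV_add[OF DERIV_power[OF dz] DERIV_cmult[OF DERIV_power[OF dy]]]])
        (simp add: z_def e_def power2_eq_square algebra_simps)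
    moreover have "sin x \<ge> 0" "cos x \<ge> 0" using x s by (auto intro!: sin_ge_zero cos_ge_zero)
    then have "- 4 * lam * sin x * cos x * (poly (pderiv p) (cos x))\<^sup>2 \<le> 0" using lam by simp
    ultimately show "\<exists>y'. ((\<lambda>s. (z s)\<^sup>2 + e * (y s)\<^sup>2) has_real_derivative y') (at x) \<and> y' \<le> 0" by blast
  qed
  define A where "A = \<bar>y 0\<bar>"
  have z0: "(z 0)\<^sup>2 = 0" by (simp add: z_def)
  have yA: "\<bar>y s\<bar> \<le> A" and zA: "\<bar>z s\<bar> \<le> nu * A" if s: "0 \<le> s" "s \<le> pi/2" for s
  proof -
    have "e * (y s)\<^sup>2 \<le> e * (y 0)\<^sup>2" using En[OF s] z0 zero_le_power2[of "z s"] by linarith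
    then have "(y s)\<^sup>2 \<le> (y 0)\<^sup>2" using e(1) by (simp add: mult_le_cancel_left_pos)
    then show "\<bar>y s\<bar> \<le> A" unfolding A_def by (simp add: abs_le_square_iff)
    have "(z s)\<^sup>2 \<le> e * (y 0)\<^sup>2" 
      using En[OF s] mult_nonneg_nonneg[OF less_imp_le[OF e(1)] zero_le_power2[of "y s"]] z0 by linarith
    also have "\<dots> \<le> nu\<^sup>2 * (y 0)\<^sup>2" using e(2) by (intro mult_right_mono) auto
    also have "\<dots> = (nu * A)\<^sup>2" by (simp add: A_def power_mult_distrib)
    finally have "\<bar>z s\<bar> \<le> \<bar>nu * A\<bar>" by (simp only: abs_le_square_iff)
    then show "\<bar>z s\<bar> \<le> nu * A" using nu1 by (simp add: A_def abs_mult)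
  qed
  define t1 where "t1 = arcsin (1 / (4 * nu))"
  have d: "0 < 1 / (4 * nu)" "1 / (4 * nu) < 1" using nu1 by (auto simp: field_simps)
  have t1: "sin t1 = 1 / (4 * nu)" "0 < t1" "t1 < pi/2"
  proof -
    show "sin t1 = 1 / (4 * nu)" unfolding t1_def using d by (intro sin_arcsin) linarith+
    have "arcsin 0 < t1" unfolding t1_def using d by (intro arcsin_less_arcsin) linarith+
    then show "0 < t1" by simp
    show "t1 < pi/2" unfolding t1_def using d arcsin_lt_bounded[of "1 / (4 * nu)"] by linarith
  qed
  have "2 * t1 \<le> pi * (1 / (4 * nu))" using two_x_le_pi_sin[of t1] t1 by simp
  also have "\<dots> \<le> 4 * (1 / (4 * nu))" using pi_less_4 d by (intro mult_right_mono) auto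
  finally have t1n: "t1 * nu \<le> 1/2" using nu1 by (simp add: field_simps)
  obtain s where s: "0 < s" "s < t1" "y t1 - y 0 = (t1 - 0) * z s"
    using MVT2[OF t1(2), of y z] dy by blast
  have "\<bar>y t1 - y 0\<bar> \<le> t1 * (nu * A)"
    unfolding s(3) abs_mult using zA[of s] s t1 by (intro mult_mono) auto
  also have "\<dots> \<le> 1/2 * A" using mult_right_mono[OF t1n, of A] by (simp add: mult.assoc A_def)
  finally have "A / 2 \<le> \<bar>y t1\<bar>" unfolding A_def by linarith
  moreover have "\<bar>y t1\<bar> \<le> K * (4 * nu) powr lam"
  proof -
    have "\<bar>sin t1 powr lam * y t1\<bar> \<le> K" unfolding y_def using t1 pi_gt_zero by (intro K) auto
    then have "\<bar>y t1\<bar> * (1 / (4 * nu)) powr lam \<le> K" unfolding t1(1) by (simp add: abs_mult mult.commute)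
    then show ?thesis using nu1 by (simp add: powr_divide field_simps)
  qed
  ultimately have A: "A \<le> 2 * K * (4 * nu) powr lam" by simp
  then show first: "\<bar>poly p (cos t)\<bar> \<le> 2 * K * (4 * nu) powr lam" using yA[OF t] by (simp add: y_def)
  have K0: "K \<ge> 0" using K[of "pi/2"] d pi_gt_zero abs_ge_zero[of "sin (pi/2) powr lam * poly p (cos (pi/2))"] by simp
  show "\<bar>sin t powr lam * poly p (cos t)\<bar> \<le> 2 * K"
  proof (cases "sin t \<ge> 1 / (4 * nu)")
    case True
    have "t \<noteq> 0" using True d by auto
    then have "0 < t" "t < pi" using t pi_gt_zero by linarith+
    from K[OF this True] show ?thesis using K0 by linarith
  next
    case False
    have S: "sin t \<ge> 0" using t by (intro sin_ge_zero) auto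
    have "\<bar>sin t powr lam * poly p (cos t)\<bar> \<le> (1 / (4 * nu)) powr lam * (2 * K * (4 * nu) powr lam)"
      unfolding abs_mult using False first lam S by (intro mult_mono) (auto intro!: powr_mono2)
    also have "\<dots> = 2 * K" using nu1 by (simp add: powr_divide)
    finally show ?thesis .
  qed
qed

end

text \<open>Serves the half [pi/2, pi]: p (-x) solves the same equation, so the bounds at the
  endpoint 1 transfer to -1.\<close>

lemma gegen_ode_reflect:
  assumes "gegen_ode lam n p"
  shows "gegen_ode lam n (pcompose p [:0, -1:])"
proof -
  interpret gegen_ode lam n p by fact
  have "pderiv [:0, -1::real:] = [:-1:]" by (simp add: pderiv_pCons)
  then have d: "pderiv (pcompose q [:0, -1:]) = - pcompose (pderiv q) [:0, -1:]" for q :: "real poly"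
    by (simp add: pderiv_pcompose)
  show ?thesis
  proof
    fix x :: real
    show "(1 - x\<^sup>2) * poly (pderiv (pderiv (pcompose p [:0, -1:]))) x
        - (2 * lam + 1) * x * poly (pderiv (pcompose p [:0, -1:])) x
        = - (n * (n + 2 * lam)) * poly (pcompose p [:0, -1:]) x"
      using ode[of "- x"] by (simp add: d pderiv_minus poly_pcompose)
  qed (use lam n1 in auto)
qed

section \<open>Uniform bounds for the orthonormal polynomials\<close>

lemma gegen_poly_bounds_eventually:
  assumes \<alpha>: "\<alpha> > -1/2"
  defines "lam \<equiv> \<alpha> + 1/2"
  shows "\<exists>n0 K. \<forall>n t. n \<ge> n0 \<longrightarrow>
    \<bar>poly (gegen_poly \<alpha> n) (cos t)\<bar> \<le> K * (1 + real n) powr lam \<and>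
    \<bar>sin t\<bar> powr lam * \<bar>poly (gegen_poly \<alpha> n) (cos t)\<bar> \<le> K"
proof -
  have lam: "lam > 0" using \<alpha> by (simp add: lam_def)
  define m where "m = \<bar>lam * (1 - lam)\<bar>"
  define I where "I = gint lam (\<lambda>_. 1)"
  define K where "K = sqrt (exp (5 * m) * (2 + 2 * m) * I)"
  \<comment> \<open>From this degree on nu \<ge> 2 exp (2 m), as the energy estimate at pi/2
    demands.\<close>
  define n0 where "n0 = Suc (nat \<lceil>2 * exp (2 * m)\<rceil>)"
  define K' where "K' = max (2 * K) (2 * K * (4 * (1 + lam)) powr lam)"
  have I0: "I > 0" unfolding I_def by (rule gint_1_pos[OF lam])
  have K0: "K \<ge> 0" unfolding K_def m_def using I0 by simp
  have "\<bar>poly (gegen_poly \<alpha> n) (cos t)\<bar> \<le> K' * (1 + real n) powr lam \<and>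
    \<bar>sin t\<bar> powr lam * \<bar>poly (gegen_poly \<alpha> n) (cos t)\<bar> \<le> K'" if n: "n \<ge> n0" for n t
  proof -
    define p where "p = gegen_poly \<alpha> n"
    have deg: "degree p = n" unfolding p_def by (rule gegen_poly_orthonormal(1)[OF \<alpha>])
    have op: "gegen_op lam p = smult (- (real n * (real n + 2 * lam))) p"
      using orth_lower_imp_gegen_op[OF lam, of p] gegen_poly_orthonormal(4)[OF \<alpha>, of n] deg
      by (simp add: p_def lam_def)
    have ode_p: "gegen_ode lam (real n) p"
    proof
      show "real n \<ge> 1" using n by (simp add: n0_def)
      fix x show "(1 - x\<^sup>2) * poly (pderiv (pderiv p)) x - (2 * lam + 1) * x * poly (pderiv p) x
          = - (real n * (real n + 2 * lam)) * poly p x"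
        unfolding poly_gegen_op[symmetric] op by simp
    qed (rule lam)
    interpret gegen_ode lam "real n" p by (rule ode_p)
    interpret R: gegen_ode lam "real n" "pcompose p [:0, -1:]" by (rule gegen_ode_reflect[OF ode_p])
    have mum: "mu = m" by (simp add: mu_def m_def)
    have big: "nu \<ge> 2 * exp (2 * mu)"
    proof -
      have "2 * exp (2 * m) \<le> real n0" unfolding n0_def by linarith
      then show ?thesis using n lam by (simp add: nu_def mum)
    qed
    have "gmean lam (\<lambda>x. poly p x * poly p x) = 1"
      using gegen_poly_orthonormal(3)[OF \<alpha>, of n n] by (simp add: p_def lam_def)
    then have I: "integral {0..pi} (\<lambda>t. sin t powr (2 * lam) * (poly p (cos t))\<^sup>2) \<le> I"
      using I0 by (simp add: gmean_def gint_def I_def power2_eq_square)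
    have int: "\<bar>sin t powr lam * poly p (cos t)\<bar> \<le> K" if "0 < t" "t < pi" "sin t \<ge> 1 / (4 * nu)" for t
      using interior_bound[OF I big that] unfolding K_def mum
      by (metis real_sqrt_abs real_sqrt_le_iff)
    have intR: "\<bar>sin t powr lam * poly (pcompose p [:0, -1:]) (cos t)\<bar> \<le> K"
      if "0 < t" "t < pi" "sin t \<ge> 1 / (4 * nu)" for t
      using int[of "pi - t"] that by (simp add: poly_pcompose)
    define s where "s = arccos (cos t)"
    have s: "0 \<le> s" "s \<le> pi" "cos s = cos t" "sin s = \<bar>sin t\<bar>"
    proof -
      show "0 \<le> s" "s \<le> pi" "cos s = cos t" unfolding s_def by (auto intro: arccos_lbound arccos_ubound)
      have "sin s = sqrt (1 - (cos t)\<^sup>2)" unfolding s_def by (rule sin_arccos) auto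
      then show "sin s = \<bar>sin t\<bar>" by (simp add: sin_squared_eq[symmetric])
    qed
    have bd: "\<bar>poly p (cos s)\<bar> \<le> 2 * K * (4 * nu) powr lam \<and> \<bar>sin s powr lam * poly p (cos s)\<bar> \<le> 2 * K"
    proof (cases "s \<le> pi/2")
      case True
      then show ?thesis using near_bound[of K s, OF int] s(1) by blast
    next
      case False
      then have "0 \<le> pi - s" "pi - s \<le> pi/2" using s(2) by auto
      then show ?thesis using R.near_bound[of K "pi - s", OF intR] by (simp add: poly_pcompose)
    qed
    have "(4 * nu) powr lam \<le> (4 * (1 + lam) * (1 + real n)) powr lam"
      using lam nu1 by (intro powr_mono2) (auto simp: nu_def algebra_simps)
    also have "\<dots> = (4 * (1 + lam)) powr lam * (1 + real n) powr lam"
      using lam by (simp add: powr_mult)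
    finally have "2 * K * (4 * nu) powr lam \<le> 2 * K * ((4 * (1 + lam)) powr lam * (1 + real n) powr lam)"
      using K0 by (intro mult_left_mono) auto
    also have "\<dots> \<le> K' * (1 + real n) powr lam"
      unfolding mult.assoc[symmetric] by (intro mult_right_mono) (auto simp: K'_def)
    finally show ?thesis using bd s unfolding p_def[symmetric] by (auto simp: K'_def abs_mult)
  qed
  then show ?thesis by blast
qed

text \<open>The finitely many degrees below the threshold are bounded on [-1, 1] by continuity and
  go into the constant.\<close>

lemma gegen_poly_bounds:
  assumes \<alpha>: "\<alpha> > -1/2"
  defines "lam \<equiv> \<alpha> + 1/2"
  shows "\<exists>C>0. \<forall>n t. \<bar>poly (gegen_poly \<alpha> n) (cos t)\<bar> \<le> C * (1 + real n) powr lam \<and>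
    \<bar>sin t\<bar> powr lam * \<bar>poly (gegen_poly \<alpha> n) (cos t)\<bar> \<le> C"
proof -
  have lam: "lam > 0" using \<alpha> by (simp add: lam_def)
  obtain n0 K where K: "\<And>n t. n \<ge> n0 \<Longrightarrow>
    \<bar>poly (gegen_poly \<alpha> n) (cos t)\<bar> \<le> K * (1 + real n) powr lam \<and>
    \<bar>sin t\<bar> powr lam * \<bar>poly (gegen_poly \<alpha> n) (cos t)\<bar> \<le> K"
    using gegen_poly_bounds_eventually[OF \<alpha>] unfolding lam_def by blast
  have "\<exists>b. \<forall>x\<in>{-1..1}. \<bar>poly (gegen_poly \<alpha> n) x\<bar> \<le> b" for n
    using continuous_on_interval_bounded[of "poly (gegen_poly \<alpha> n)"] by auto
  then obtain b where b: "\<And>n x. x \<in> {-1..1} \<Longrightarrow> \<bar>poly (gegen_poly \<alpha> n) x\<bar> \<le> b n" by metis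
  have b0: "b n \<ge> 0" for n using b[of 0 n] by simp
  define C where "C = 1 + \<bar>K\<bar> + (\<Sum>n<n0. b n)"
  have C: "C > 0" "K \<le> C" unfolding C_def using sum_nonneg[of "{..<n0}" b] b0 by auto
  have "\<bar>poly (gegen_poly \<alpha> n) (cos t)\<bar> \<le> C * (1 + real n) powr lam \<and>
    \<bar>sin t\<bar> powr lam * \<bar>poly (gegen_poly \<alpha> n) (cos t)\<bar> \<le> C" for n t
  proof (cases "n \<ge> n0")
    case True
    have "K * (1 + real n) powr lam \<le> C * (1 + real n) powr lam" using C by (intro mult_right_mono) auto
    then show ?thesis using K[OF True, of t] C by linarith
  next
    case False
    then have "b n \<le> (\<Sum>n<n0. b n)" using b0 by (intro member_le_sum) auto
    then have le: "\<bar>poly (gegen_poly \<alpha> n) (cos t)\<bar> \<le> C" using b[of "cos t" n] unfolding C_def by simp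
    moreover have "C * 1 \<le> C * (1 + real n) powr lam" using C lam by (intro mult_left_mono ge_one_powr_ge_zero) auto
    moreover have "\<bar>sin t\<bar> powr lam \<le> 1" using lam powr_mono2[of lam "\<bar>sin t\<bar>" 1] by simp
    then have "\<bar>sin t\<bar> powr lam * \<bar>poly (gegen_poly \<alpha> n) (cos t)\<bar> \<le> 1 * C" using le by (intro mult_mono) auto
    ultimately show ?thesis by simp
  qed
  then show ?thesis using C(1) by blast
qed

section \<open>Sparsification of a block\<close>

text \<open>Any positive exponent below 1 for y \<ge> 1 and any exponent above 1 for y < 1 would do:
  both make the sum of the values at m / (i + 1) over all i of order m.\<close>

definition decay_profile :: "real \<Rightarrow> real" where
  "decay_profile y = (if y \<ge> 1 then sqrt y else y\<^sup>2)"

lemma sum_inverse_sqrt_le: "(\<Sum>i<n. 1 / sqrt (real i + 1)) \<le> 2 * sqrt (real n)"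
proof (induction n)
  case (Suc n)
  define a where "a = sqrt (real n)"
  define b where "b = sqrt (real n + 1)"
  have ab: "0 \<le> a" "0 < b" "a \<le> b" "b\<^sup>2 = a\<^sup>2 + 1" by (auto simp: a_def b_def)
  have "1 = (b - a) * (b + a)" using ab(4) by (simp add: power2_eq_square algebra_simps)
  also have "\<dots> \<le> (b - a) * (2 * b)" using ab by (intro mult_left_mono) auto
  finally have "1 / b \<le> 2 * b - 2 * a" using ab by (simp add: field_simps)
  then show ?case using Suc by (simp add: a_def b_def add.commute)
qed simp

lemma sum_inverse_square_le:
  assumes "m \<ge> 1" "m \<le> n"
  shows "(\<Sum>i\<in>{m..<n}. 1 / (real i + 1)\<^sup>2) \<le> 1 / real m - 1 / real n"
  using assms(2)
proof (induction n rule: dec_induct)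
  case (step n)
  have n: "real n > 0" using step assms by simp
  have "1 / (real n + 1)\<^sup>2 \<le> 1 / (real n * (real n + 1))"
    using n by (intro divide_left_mono) (auto simp: power2_eq_square)
  also have "\<dots> = 1 / real n - 1 / (real n + 1)" using n by (simp add: field_simps)
  finally have *: "1 / (real n + 1)\<^sup>2 \<le> 1 / real n - 1 / (real n + 1)" .
  have "(\<Sum>i\<in>{m..<Suc n}. 1 / (real i + 1)\<^sup>2) = (\<Sum>i\<in>{m..<n}. 1 / (real i + 1)\<^sup>2) + 1 / (real n + 1)\<^sup>2"
    using step by (simp add: atLeastLessThanSuc)
  also have "\<dots> \<le> 1 / real m - 1 / (real n + 1)" using * step by linarith
  finally show ?case by (simp add: add.commute)
qed simp

lemma sum_decay_profile_le:
  fixes m n :: nat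
  assumes "m \<ge> 1"
  shows "(\<Sum>i<n. decay_profile (real m / (real i + 1))) \<le> 3 * real m"
proof -
  have small: "(\<Sum>i<k. decay_profile (real m / (real i + 1))) \<le> 2 * real m" if "k \<le> m" for k
  proof -
    have "(\<Sum>i<k. decay_profile (real m / (real i + 1))) = (\<Sum>i<k. sqrt (real m) * (1 / sqrt (real i + 1)))"
      using that by (intro sum.cong) (auto simp: decay_profile_def real_sqrt_divide)
    also have "\<dots> \<le> sqrt (real m) * (2 * sqrt (real k))"
      unfolding sum_distrib_left[symmetric] by (intro mult_left_mono sum_inverse_sqrt_le) auto
    also have "\<dots> \<le> sqrt (real m) * (2 * sqrt (real m))" using that by (intro mult_left_mono) auto
    also have "\<dots> = 2 * real m" by (simp add: mult.left_commute[of _ 2])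
    finally show ?thesis .
  qed
  show ?thesis
  proof (cases "n \<le> m")
    case True
    then show ?thesis using small[OF True] by simp
  next
    case False
    have "(\<Sum>i<n. decay_profile (real m / (real i + 1)))
        = (\<Sum>i<m. decay_profile (real m / (real i + 1))) + (\<Sum>i\<in>{m..<n}. decay_profile (real m / (real i + 1)))"
      using False by (simp add: lessThan_atLeast0 sum.atLeastLessThan_concat)
    also have "(\<Sum>i\<in>{m..<n}. decay_profile (real m / (real i + 1))) = (\<Sum>i\<in>{m..<n}. (real m)\<^sup>2 * (1 / (real i + 1)\<^sup>2))"
      by (intro sum.cong) (auto simp: decay_profile_def power_divide)
    also have "\<dots> \<le> (real m)\<^sup>2 * (1 / real m - 1 / real n)"
      unfolding sum_distrib_left[symmetric] using assms False by (intro mult_left_mono sum_inverse_square_le) auto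
    also have "\<dots> \<le> (real m)\<^sup>2 * (1 / real m)" by (intro mult_left_mono) auto
    also have "\<dots> = real m" by (simp add: power2_eq_square)
    finally show ?thesis using small[of m] by simp
  qed
qed

text \<open>Here y is the number of coefficients over the position of the grid point, up to a
  factor, and c (1/y)^lam the ratio of tolerance to fluctuation. The two cost estimates fit the two
  branches of the profile through q with lam q \<le> 1/2 and k with lam k \<ge> 2, which exists as
  lam > 0.\<close>

lemma round_cost_decay:
  fixes lam e :: real
  assumes lam: "lam > 0" and e: "e > 0"
  shows "\<exists>c>0. \<forall>y>0. round_cost (c * (1 / y) powr lam) \<le> e * decay_profile y"
proof -
  define q where "q = min 1 (1 / (2 * lam))"
  define k where "k = Suc (nat \<lceil>2 / lam\<rceil>)"
  have q: "0 < q" "q \<le> 1" "lam * q \<le> 1/2" using lam by (auto simp: q_def min_def field_simps)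
  have k: "k \<ge> 1" "lam * real k \<ge> 2"
  proof -
    have "2 / lam \<le> real k" unfolding k_def by linarith
    then show "lam * real k \<ge> 2" using lam by (simp add: field_simps)
  qed (simp add: k_def)
  \<comment> \<open>The entries of the maximum are the values that \<open>c1\<close> and
    \<open>c2\<close> demand, solved for c.\<close>
  define c where "c = max (8 * (3 / (q * e)) powr (1 / q)) (4 * max 1 (6 * fact k / e))"
  have c0: "c > 0" by (simp add: c_def less_max_iff_disj)
  have c1: "3 / q * (8 / c) powr q \<le> e"
  proof -
    have "8 / c \<le> 8 / (8 * (3 / (q * e)) powr (1 / q))"
      using q e by (intro divide_left_mono) (auto simp: c_def)
    also have "\<dots> = (q * e / 3) powr (1 / q)" using q e by (simp add: powr_divide)
    finally have "(8 / c) powr q \<le> ((q * e / 3) powr (1 / q)) powr q" using c0 q by (intro powr_mono2) auto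
    also have "\<dots> = q * e / 3" using q e by (simp add: powr_powr)
    finally show ?thesis using q by (simp add: field_simps)
  qed
  have c2: "6 * fact k * (4 / c) ^ k \<le> e"
  proof -
    define g where "g = max 1 (6 * fact k / e)"
    have g: "g \<ge> 1" "6 * fact k / e \<le> g" by (auto simp: g_def)
    have "4 / c \<le> 4 / (4 * g)" using g by (intro divide_left_mono) (auto simp: c_def g_def)
    then have "(4 / c) ^ k \<le> (1 / g) ^ k" using c0 by (intro power_mono) auto
    also have "\<dots> \<le> (1 / g) ^ 1" using g k by (intro power_decreasing) auto
    also have "(1 / g) ^ 1 \<le> 1 / (6 * fact k / e)"
      unfolding power_one_right using g e by (intro divide_left_mono) auto
    finally show ?thesis using e by (simp add: field_simps)
  qed
  have "round_cost (c * (1 / y) powr lam) \<le> e * decay_profile y" if y: "y > 0" for y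
  proof (cases "y \<ge> 1")
    case True
    have "round_cost (c * (1 / y) powr lam) \<le> 3 / q * (8 / (c * (1 / y) powr lam)) powr q"
      using c0 y q by (intro round_cost_le_powr) auto
    also have "8 / (c * (1 / y) powr lam) = (8 / c) * y powr lam" using y by (simp add: powr_divide)
    also have "((8 / c) * y powr lam) powr q = (8 / c) powr q * y powr (lam * q)"
      by (subst powr_mult) (use c0 in \<open>auto simp: powr_powr\<close>)
    also have "3 / q * ((8 / c) powr q * y powr (lam * q)) \<le> e * y powr (1/2)"
      unfolding mult.assoc[symmetric] using c1 True q e by (intro mult_mono powr_mono) auto
    finally show ?thesis using True by (simp add: decay_profile_def powr_half_sqrt)
  next
    case False
    have "round_cost (c * (1 / y) powr lam) \<le> 6 * fact k * (4 / (c * (1 / y) powr lam)) ^ k"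
      using c0 y k by (intro round_cost_le_power) auto
    also have "4 / (c * (1 / y) powr lam) = (4 / c) * y powr lam" using y by (simp add: powr_divide)
    also have "((4 / c) * y powr lam) ^ k = (4 / c) ^ k * y powr (lam * real k)"
      by (subst power_mult_distrib) (use y in \<open>simp add: powr_power mult.commute\<close>)
    also have "6 * fact k * ((4 / c) ^ k * y powr (lam * real k)) \<le> e * y powr 2"
      unfolding mult.assoc[symmetric] using c2 False k e y by (intro mult_mono powr_mono') auto
    finally show ?thesis using False y by (simp add: decay_profile_def)
  qed
  then show ?thesis using c0 by blast
qed

section \<open>Rounding the coefficients of one block\<close>

abbreviation support_in :: "nat set \<Rightarrow> (nat \<Rightarrow> real) \<Rightarrow> nat set" where
  "support_in S b \<equiv> {k\<in>S. b k \<noteq> 0}"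

text \<open>What the sparsification retains of the orthonormal polynomials: their degrees and the
  two pointwise bounds.\<close>

locale peaked_polys =
  fixes L :: "nat \<Rightarrow> real poly" and lam C :: real
  assumes lam: "lam > 0" and C: "C > 0" and degL: "degree (L k) \<le> k"
    and sup_bound: "\<bar>poly (L k) (cos t)\<bar> \<le> C * (1 + real k) powr lam"
    and weighted_bound: "\<bar>sin t\<bar> powr lam * \<bar>poly (L k) (cos t)\<bar> \<le> C"
begin

abbreviation gap :: "nat set \<Rightarrow> (nat \<Rightarrow> real) \<Rightarrow> (nat \<Rightarrow> real) \<Rightarrow> real \<Rightarrow> real" where
  "gap S a b x \<equiv> \<bar>\<Sum>k\<in>S. (a k - b k) * poly (L k) x\<bar>"

abbreviation sparse_approx :: "nat set \<Rightarrow> (nat \<Rightarrow> real) \<Rightarrow> real \<Rightarrow> real \<Rightarrow> bool" where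
  "sparse_approx S a m e \<equiv> \<exists>b. real (card (support_in S b)) \<le> m \<and> (\<forall>x\<in>{-1..1}. gap S a b x \<le> e)"

text \<open>Origin of 31/32: at least half of the coefficients are small enough to be coloured, more
  than an eighth of these gets a colour, and the larger colour class is deleted.\<close>

abbreviation rounded :: "real \<Rightarrow> nat \<Rightarrow> real \<Rightarrow> nat set \<Rightarrow> (nat \<Rightarrow> real) \<Rightarrow> bool" where
  "rounded K N A S a \<equiv> \<exists>b. 32 * card (support_in S b) \<le> 31 * card S \<and>
     (\<Sum>k\<in>S. \<bar>b k\<bar>) \<le> A * (1 + K / sqrt (card S)) \<and>
     (\<forall>x\<in>{-1..1}. gap S a b x \<le> A * K / sqrt (card S) * (real N / real (card S)) powr lam)"

abbreviation rounding_step :: "real \<Rightarrow> bool" where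
  "rounding_step K \<equiv> \<forall>N A S a. N \<ge> 1 \<longrightarrow> A > 0 \<longrightarrow> S \<subseteq> {..<2 * N} \<longrightarrow> card S \<ge> 16 \<longrightarrow>
     (\<Sum>k\<in>S. \<bar>a k\<bar>) \<le> A \<longrightarrow> rounded K N A S a"

text \<open>Quadrant i and position j stand for the point 2 pi (2 N i + j) / (8 N). Degree at most 2
  N would need 6 N points; with 8 N every multiple of pi/2 is a grid point.\<close>

definition grid_pt :: "nat \<Rightarrow> nat \<times> nat \<Rightarrow> real" where
  "grid_pt N ij = pi * real (fst ij) / 2 + pi * real (snd ij) / (4 * real N)"

text \<open>Grid points are counted from the nearest zero of the sine.\<close>
definition grid_ix :: "nat \<Rightarrow> nat \<times> nat \<Rightarrow> nat" where
  "grid_ix N ij = (if even (fst ij) then snd ij else 2 * N - snd ij)"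

lemma sin_grid_pt:
  assumes "N \<ge> 1" "j < 2 * N"
  shows "\<bar>sin (grid_pt N (i, j))\<bar> \<ge> real (grid_ix N (i, j)) / (2 * real N)"
proof -
  define w where "w = pi * real j / (4 * real N)"
  have w: "0 \<le> w" "w \<le> pi / 2" using assms by (auto simp: w_def field_simps)
  have sw: "sin w \<ge> real j / (2 * real N)"
    using two_x_le_pi_sin[OF w] assms by (simp add: w_def field_simps)
  have cw: "cos w \<ge> real (2 * N - j) / (2 * real N)"
  proof -
    have "2 * (pi / 2 - w) \<le> pi * sin (pi / 2 - w)" using w by (intro two_x_le_pi_sin) auto
    then have "2 * (pi / 2 - w) \<le> pi * cos w" by (simp add: sin_diff)
    moreover have "2 * (pi / 2 - w) = pi * (real (2 * N - j) / (2 * real N))"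
      using assms by (simp add: w_def of_nat_diff field_simps)
    ultimately show ?thesis by (metis mult_le_cancel_left_pos pi_gt_zero)
  qed
  show ?thesis
  proof (cases "even i")
    case True
    then obtain h where h: "i = 2 * h" by blast
    then have "grid_pt N (i, j) = w + real h * pi" by (simp add: grid_pt_def w_def)
    then have "\<bar>sin (grid_pt N (i, j))\<bar> = \<bar>sin w\<bar>" by (simp add: sin_add abs_mult power_abs)
    then show ?thesis using sw True by (simp add: grid_ix_def)
  next
    case False
    then obtain h where h: "i = 2 * h + 1" using oddE by blast
    then have "grid_pt N (i, j) = (w + pi / 2) + real h * pi" by (simp add: grid_pt_def w_def field_simps)
    then have "\<bar>sin (grid_pt N (i, j))\<bar> = \<bar>sin (w + pi/2)\<bar>" by (simp add: sin_add abs_mult power_abs)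
    also have "sin (w + pi/2) = cos w" by (simp add: sin_add)
    finally show ?thesis using cw False by (simp add: grid_ix_def)
  qed
qed

text \<open>One formula for both pointwise bounds: at index 0 the uniform one, since 1 + k \<le> 2
  N, and at index m \<ge> 1 the weighted one, since m + 1 \<le> 2 m.\<close>

lemma grid_bound:
  assumes "N \<ge> 1" "j < 2 * N" "k < 2 * N"
  shows "\<bar>poly (L k) (cos (grid_pt N (i, j)))\<bar> \<le> C * (4 * real N / (real (grid_ix N (i, j)) + 1)) powr lam"
proof (cases "grid_ix N (i, j) = 0")
  case True
  have "C * (1 + real k) powr lam \<le> C * (4 * real N / (real (grid_ix N (i, j)) + 1)) powr lam"
    using assms C lam True by (intro mult_left_mono powr_mono2) auto
  then show ?thesis using sup_bound[of k "grid_pt N (i, j)"] by linarith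
next
  case False
  define m where "m = real (grid_ix N (i, j))"
  have m: "m \<ge> 1" using False by (simp add: m_def)
  have N: "real N > 0" using assms by simp
  have "(m / (2 * real N)) powr lam * \<bar>poly (L k) (cos (grid_pt N (i, j)))\<bar>
      \<le> \<bar>sin (grid_pt N (i, j))\<bar> powr lam * \<bar>poly (L k) (cos (grid_pt N (i, j)))\<bar>"
    using sin_grid_pt[OF assms(1,2), of i] lam m N by (intro mult_right_mono powr_mono2) (auto simp: m_def)
  also have "\<dots> \<le> C" by (rule weighted_bound)
  finally have "\<bar>poly (L k) (cos (grid_pt N (i, j)))\<bar> \<le> C * (2 * real N / m) powr lam"
    using m N by (simp add: powr_divide field_simps)
  also have "\<dots> \<le> C * (4 * real N / (m + 1)) powr lam"
    using m N lam C by (intro mult_left_mono powr_mono2) (auto simp: field_simps)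
  finally show ?thesis by (simp add: m_def)
qed

lemma sum_grid_profile:
  assumes "m \<ge> 1"
  shows "(\<Sum>ij\<in>{..<4} \<times> {..<2 * N}. decay_profile (real m / (real (grid_ix N ij) + 1))) \<le> 12 * real m"
proof -
  have nn: "decay_profile y \<ge> 0" for y by (auto simp: decay_profile_def)
  have "(\<Sum>j<2 * N. decay_profile (real m / (real (grid_ix N (i, j)) + 1))) \<le> 3 * real m" for i
  proof (cases "even i")
    case True
    then show ?thesis using sum_decay_profile_le[OF assms, of "2 * N"] by (simp add: grid_ix_def)
  next
    case False
    have "(\<Sum>j<2 * N. decay_profile (real m / (real (grid_ix N (i, j)) + 1)))
        = (\<Sum>j\<in>{1..2 * N}. decay_profile (real m / (real j + 1)))"
      using False by (intro sum.reindex_bij_witness[of _ "\<lambda>j. 2 * N - j" "\<lambda>j. 2 * N - j"]) (auto simp: grid_ix_def)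
    also have "\<dots> \<le> (\<Sum>j<2 * N + 1. decay_profile (real m / (real j + 1)))"
      using nn by (intro sum_mono2) auto
    also have "\<dots> \<le> 3 * real m" by (rule sum_decay_profile_le[OF assms])
    finally show ?thesis .
  qed
  then have "(\<Sum>i<4::nat. \<Sum>j<2 * N. decay_profile (real m / (real (grid_ix N (i, j)) + 1))) \<le> (\<Sum>i<4::nat. 3 * real m)"
    by (intro sum_mono) auto
  then show ?thesis by (simp add: sum.cartesian_product)
qed

text \<open>Partial colouring of the rows \<open>a k * poly (L k) x\<close> for x on the grid.
  Coefficients of one colour are deleted and those of the other doubled; the additional row |a k|
  keeps this from increasing the l_1 norm by more than the stated amount.\<close>

lemma sparsify_step: "\<exists>K>0. rounding_step K"
proof -
  \<comment> \<open>With 1/2000 the rows cost at most (1 + 12 * 4 s) / 2000 \<le> s/32 \<le> card B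
    / 16 altogether.\<close>
  obtain c where c: "c > 0" "\<And>y. y > 0 \<Longrightarrow> round_cost (c * (1 / y) powr lam) \<le> 1/2000 * decay_profile y"
    using round_cost_decay[OF lam, of "1/2000"] by auto
  \<comment> \<open>K has to cover 2 c for the l_1 row and 3 * 2 c C for the uniform error, where 3
    is the price for passing from the grid to [-1, 1].\<close>
  define K where "K = 6 * c * (C + 1)"
  have K: "K > 0" "2 * c \<le> K" "3 * (2 * c * C) \<le> K" using c C by (auto simp: K_def)
  show ?thesis
  proof (intro exI[of _ K] conjI allI impI K(1))
    fix N :: nat and A :: real and S :: "nat set" and a :: "nat \<Rightarrow> real"
    assume N: "N \<ge> 1" and A: "A > 0" and S: "S \<subseteq> {..<2 * N}" and S16: "card S \<ge> 16"
      and aA: "(\<Sum>k\<in>S. \<bar>a k\<bar>) \<le> A"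
    define s where "s = card S"
    have finS: "finite S" using S finite_subset by blast
    have s: "real s > 0" "s \<ge> 1" using S16 by (auto simp: s_def)
    \<comment> \<open>At most half of the coefficients exceed 2 A / s; those are left
      unchanged.\<close>
    define B where "B = {k\<in>S. \<bar>a k\<bar> \<le> 2 * A / s}"
    have finB: "finite B" and BS: "B \<subseteq> S" using finS by (auto simp: B_def)
    have cardB: "2 * card B \<ge> s"
    proof -
      have "real (card (S - B)) * (2 * A / s) \<le> (\<Sum>k\<in>S - B. \<bar>a k\<bar>)"
        by (rule sum_bounded_below) (auto simp: B_def)
      also have "\<dots> \<le> (\<Sum>k\<in>S. \<bar>a k\<bar>)" using finS by (intro sum_mono2) auto
      also note aA
      finally have "2 * real (card (S - B)) \<le> real s" using A s by (simp add: field_simps)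
      moreover have "card (S - B) = s - card B" "card B \<le> s"
        using finS BS finB by (auto simp: s_def card_Diff_subset card_mono)
      ultimately show ?thesis by linarith
    qed
    \<comment> \<open>Bounds the l_2 norm of at most s coefficients of size at most 2 A / s.\<close>
    define W where "W = 2 * A / sqrt s"
    have W: "W > 0" using A s by (simp add: W_def)
    define R where "R = insert None (Some ` ({..<4::nat} \<times> {..<2 * N}))"
    define v where "v i k = (case i of None \<Rightarrow> \<bar>a k\<bar> | Some ij \<Rightarrow> a k * poly (L k) (cos (grid_pt N ij)))" for i k
    define V where "V i = (case i of None \<Rightarrow> W | Some ij \<Rightarrow> W * C * (4 * real N / (real (grid_ix N ij) + 1)) powr lam)" for i
    \<comment> \<open>The same tolerance at all grid points, namely c times what the formula for
      \<open>V\<close> gives at index 4 s - 1.\<close>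
    define b where "b i = (case i of None \<Rightarrow> c * W | Some ij \<Rightarrow> c * (W * C) * (real N / s) powr lam)" for i :: "(nat \<times> nat) option"
    have V: "V i > 0" if "i \<in> R" for i
      using W C N by (auto simp: V_def split: option.split)
    have b: "b i > 0" if "i \<in> R" for i
      using W C N c(1) s by (auto simp: b_def split: option.split)
    have sq: "(\<Sum>k\<in>B. (f k)\<^sup>2) \<le> (W * M)\<^sup>2" if f: "\<And>k. k \<in> B \<Longrightarrow> \<bar>f k\<bar> \<le> 2 * A / s * M" for f M
    proof -
      have "(\<Sum>k\<in>B. (f k)\<^sup>2) \<le> (\<Sum>k\<in>B. (2 * A / s * M)\<^sup>2)"
        using f by (intro sum_mono) (metis abs_ge_zero power2_abs power_mono)
      also have "\<dots> \<le> real s * (2 * A / s * M)\<^sup>2"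
        using card_mono[OF finS BS] by (simp add: s_def mult_right_mono)
      also have "\<dots> = (W * M)\<^sup>2" using s by (simp add: W_def power2_eq_square field_simps)
      finally show ?thesis .
    qed
    have vV: "(\<Sum>k\<in>B. (v i k)\<^sup>2) \<le> (V i)\<^sup>2" if i: "i \<in> R" for i
    proof (cases i)
      case None
      then show ?thesis using sq[of "v None" 1] by (simp add: v_def V_def B_def)
    next
      case (Some ij)
      obtain i' j where ij: "ij = (i', j)" "j < 2 * N" using i Some by (auto simp: R_def)
      define M where "M = C * (4 * real N / (real (grid_ix N ij) + 1)) powr lam"
      have "\<bar>v i k\<bar> \<le> 2 * A / s * M" if k: "k \<in> B" for k
      proof -
        have "\<bar>poly (L k) (cos (grid_pt N ij))\<bar> \<le> M"
          unfolding M_def ij(1) using N ij(2) k BS S by (intro grid_bound) auto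
        then show ?thesis
          unfolding v_def Some option.case abs_mult using k A s by (intro mult_mono) (auto simp: B_def)
      qed
      then have "(\<Sum>k\<in>B. (v i k)\<^sup>2) \<le> (W * M)\<^sup>2" by (rule sq)
      then show ?thesis by (simp add: V_def Some M_def mult.assoc)
    qed
    have cost: "(\<Sum>i\<in>R. round_cost (b i / V i)) \<le> card B / 16"
    proof -
      have fin: "finite ({..<4::nat} \<times> {..<2 * N})" by simp
      have "(\<Sum>i\<in>R. round_cost (b i / V i)) = round_cost (b None / V None)
          + (\<Sum>ij\<in>{..<4::nat} \<times> {..<2 * N}. round_cost (b (Some ij) / V (Some ij)))"
        unfolding R_def using fin by (subst sum.insert) (auto simp: sum.reindex)
      also have "round_cost (b None / V None) \<le> 1/2000"
        using c(2)[of 1] W by (simp add: b_def V_def decay_profile_def)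
      also have "(\<Sum>ij\<in>{..<4::nat} \<times> {..<2 * N}. round_cost (b (Some ij) / V (Some ij)))
          \<le> (\<Sum>ij\<in>{..<4::nat} \<times> {..<2 * N}. 1/2000 * decay_profile (real (4 * s) / (real (grid_ix N ij) + 1)))"
      proof (rule sum_mono)
        fix ij :: "nat \<times> nat"
        define g where "g = real (grid_ix N ij) + 1"
        have g: "g > 0" by (simp add: g_def)
        have "(real N / s) powr lam / (4 * real N / g) powr lam = (1 / (real (4 * s) / g)) powr lam"
          using g s N by (simp add: powr_divide powr_mult)
        moreover have "b (Some ij) / V (Some ij) = c * ((real N / s) powr lam / (4 * real N / g) powr lam)"
          using W C by (simp add: b_def V_def g_def[symmetric])
        ultimately have "b (Some ij) / V (Some ij) = c * (1 / (real (4 * s) / g)) powr lam"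
          by (simp only:)
        then show "round_cost (b (Some ij) / V (Some ij)) \<le> 1/2000 * decay_profile (real (4 * s) / (real (grid_ix N ij) + 1))"
          unfolding g_def[symmetric] using c(2)[of "real (4 * s) / g"] g s by simp
      qed
      also have "\<dots> \<le> 1/2000 * (12 * real (4 * s))"
        unfolding sum_distrib_left[symmetric] using s by (intro mult_left_mono sum_grid_profile) auto
      finally show ?thesis using cardB s by simp
    qed
    have "\<exists>T1 T2. T1 \<subseteq> B \<and> T2 \<subseteq> B \<and> T1 \<inter> T2 = {} \<and> card B < 8 * (card T1 + card T2) \<and>
           (\<forall>i\<in>R. \<bar>(\<Sum>k\<in>T1. v i k) - (\<Sum>k\<in>T2. v i k)\<bar> \<le> b i)"
      using cardB S16 by (intro partial_colouring[OF finB _ _ V vV b cost]) (auto simp: R_def s_def)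
    then obtain T1 T2 where T: "T1 \<subseteq> B" "T2 \<subseteq> B" "T1 \<inter> T2 = {}" "card B < 8 * (card T1 + card T2)"
      "\<And>i. i \<in> R \<Longrightarrow> \<bar>(\<Sum>k\<in>T1. v i k) - (\<Sum>k\<in>T2. v i k)\<bar> \<le> b i"
      by blast
    obtain P Q where PQ: "P \<subseteq> B" "Q \<subseteq> B" "P \<inter> Q = {}" "card B < 16 * card P"
      "\<And>i. i \<in> R \<Longrightarrow> \<bar>(\<Sum>k\<in>P. v i k) - (\<Sum>k\<in>Q. v i k)\<bar> \<le> b i"
    proof (cases "card T2 \<le> card T1")
      case True
      then show ?thesis using that[of T1 T2] T by auto
    next
      case False
      have "\<bar>(\<Sum>k\<in>T2. v i k) - (\<Sum>k\<in>T1. v i k)\<bar> \<le> b i" if "i \<in> R" for i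
        using T(5)[OF that] by (simp add: abs_minus_commute)
      then show ?thesis using that[of T2 T1] T False by auto
    qed
    have PS: "P \<subseteq> S" "Q \<subseteq> S" using PQ BS by auto
    \<comment> \<open>Thus a - a' is a on P, -a on Q and 0 elsewhere, so each sum against it is a
      signed sum controlled by the colouring.\<close>
    define a' where "a' k = (if k \<in> P then 0 else if k \<in> Q then 2 * a k else a k)" for k
    have split: "(\<Sum>k\<in>S. (f k::real)) = (\<Sum>k\<in>P. f k) + (\<Sum>k\<in>Q. f k) + (\<Sum>k\<in>S - P - Q. f k)" for f
    proof -
      have "(\<Sum>k\<in>S. f k) = (\<Sum>k\<in>S - P. f k) + (\<Sum>k\<in>P. f k)" by (rule sum.subset_diff[OF PS(1) finS])
      also have "(\<Sum>k\<in>S - P. f k) = (\<Sum>k\<in>S - P - Q. f k) + (\<Sum>k\<in>Q. f k)"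
        using PS PQ(3) finS by (intro sum.subset_diff) auto
      finally show ?thesis by simp
    qed
    have diff: "(\<Sum>k\<in>S. (a k - a' k) * f k) = (\<Sum>k\<in>P. a k * f k) - (\<Sum>k\<in>Q. a k * f k)" for f
    proof -
      have "(\<Sum>k\<in>P. (a k - a' k) * f k) = (\<Sum>k\<in>P. a k * f k)" by (intro sum.cong) (auto simp: a'_def)
      moreover have "(\<Sum>k\<in>Q. (a k - a' k) * f k) = (\<Sum>k\<in>Q. - (a k * f k))"
        using PQ(3) by (intro sum.cong) (auto simp: a'_def)
      moreover have "(\<Sum>k\<in>S - P - Q. (a k - a' k) * f k) = 0" by (intro sum.neutral) (auto simp: a'_def)
      ultimately show ?thesis unfolding split by (simp add: sum_negf)
    qed
    have "32 * card (support_in S a') \<le> 31 * card S"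
    proof -
      have "card (support_in S a') \<le> card (S - P)" using finS by (intro card_mono) (auto simp: a'_def)
      also have "\<dots> = card S - card P" using PS finS by (meson card_Diff_subset finite_subset)
      finally show ?thesis using PQ(4) cardB by (simp add: s_def)
    qed
    moreover have "(\<Sum>k\<in>S. \<bar>a' k\<bar>) \<le> A * (1 + K / sqrt (card S))"
    proof -
      have "(\<Sum>k\<in>P. \<bar>a' k\<bar>) = (\<Sum>k\<in>P. 0)" by (intro sum.cong) (auto simp: a'_def)
      moreover have "(\<Sum>k\<in>Q. \<bar>a' k\<bar>) = (\<Sum>k\<in>Q. 2 * \<bar>a k\<bar>)"
        using PQ(3) by (intro sum.cong) (auto simp: a'_def abs_mult)
      moreover have "(\<Sum>k\<in>S - P - Q. \<bar>a' k\<bar>) = (\<Sum>k\<in>S - P - Q. \<bar>a k\<bar>)" by (intro sum.cong) (auto simp: a'_def)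
      ultimately have "(\<Sum>k\<in>S. \<bar>a' k\<bar>) = (\<Sum>k\<in>S. \<bar>a k\<bar>) - ((\<Sum>k\<in>P. \<bar>a k\<bar>) - (\<Sum>k\<in>Q. \<bar>a k\<bar>))"
        unfolding split by (simp add: sum_distrib_left[symmetric])
      also have "\<dots> \<le> A + c * W"
        using PQ(5)[of None] aA by (simp add: R_def v_def b_def)
      also have "c * W = A * (2 * c / sqrt s)" by (simp add: W_def)
      also have "\<dots> \<le> A * (K / sqrt s)" using A K by (intro mult_left_mono divide_right_mono) auto
      finally show ?thesis by (simp add: s_def distrib_left)
    qed
    moreover have "gap S a a' x
        \<le> A * K / sqrt (card S) * (real N / real (card S)) powr lam" if x: "x \<in> {-1..1}" for x
    proof -
      define p where "p = (\<Sum>k\<in>S. smult (a k - a' k) (L k))"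
      have pp: "poly p y = (\<Sum>k\<in>S. (a k - a' k) * poly (L k) y)" for y by (simp add: p_def poly_sum)
      have "degree p \<le> 2 * N"
        unfolding p_def using S degL order_trans[OF degree_smult_le degL]
        by (intro degree_sum_le finS) (meson in_mono lessThan_iff less_imp_le order_trans)
      moreover have "\<bar>poly p (cos (2 * pi * real i / real (8 * N)))\<bar> \<le> c * (W * C) * (real N / s) powr lam"
        if i: "i < 8 * N" for i
      proof -
        define ij where "ij = (i div (2 * N), i mod (2 * N))"
        have ij: "ij \<in> {..<4::nat} \<times> {..<2 * N}"
          using i N by (auto simp: ij_def less_mult_imp_div_less)
        have "real i = real (2 * N) * real (i div (2 * N)) + real (i mod (2 * N))"
          unfolding of_nat_mult[symmetric] of_nat_add[symmetric] by simp
        then have "2 * pi * real i / real (8 * N) = grid_pt N ij"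
          using N by (simp add: grid_pt_def ij_def field_simps)
        then show ?thesis
          using PQ(5)[of "Some ij"] ij unfolding pp diff by (auto simp: R_def v_def b_def)
      qed
      ultimately have "\<bar>poly p x\<bar> \<le> 3 * (c * (W * C) * (real N / s) powr lam)"
        using N x by (intro poly_bound_from_grid[of p "2 * N" "8 * N"]) auto
      also have "\<dots> = A * (3 * (2 * c * C)) / sqrt s * (real N / s) powr lam" by (simp add: W_def)
      also have "\<dots> \<le> A * K / sqrt s * (real N / s) powr lam"
        using A K(3) by (intro mult_right_mono divide_right_mono mult_left_mono) auto
      finally show ?thesis unfolding pp s_def .
    qed
    ultimately show "rounded K N A S a" by blast
  qed
qed

text \<open>The factor \<open>exp (q / sqrt (card S))\<close> absorbs the growth of the \<open>l\<^sub>1\<close> norm in all later steps, and the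
  difference of powers in the error telescopes.\<close>

lemma sparsify_iterate:
  fixes K x \<beta> q D :: real
  assumes K: "K > 0" and step: "rounding_step K"
  defines "\<beta> \<equiv> lam + 1/2" and "q \<equiv> K / (sqrt (32/31) - 1)" and "D \<equiv> 1 / ((32/31) powr \<beta> - 1)"
  assumes N: "N \<ge> 1" and A: "A > 0" and x: "x \<ge> 16"
  assumes "S \<subseteq> {..<2 * N}" and "x < card S" and "(\<Sum>k\<in>S. \<bar>a k :: real\<bar>) \<le> A * exp (q / sqrt (card S))"
  shows "sparse_approx S a x
    (A * (K * exp q) * real N powr lam * (D * (x powr - \<beta> - card S powr - \<beta>) + x powr - \<beta>))"
  using assms(9-11)
proof (induction "card S" arbitrary: S a rule: less_induct)
  case less
  define s where "s = real (card S)"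
  have finS: "finite S" using less.prems(1) finite_subset by blast
  have \<beta>: "\<beta> > 0" using lam by (simp add: \<beta>_def)
  have rho: "sqrt (32/31) > (1::real)" "(32/31) powr \<beta> > (1::real)" using \<beta> by (auto intro: gr_one_powr)
  \<comment> \<open>The second equation determines q: one step turns the exponent into (q + K) /
    sqrt s, which is at most q / sqrt s1 because s1 \<le> s / (32/31).\<close>
  have q: "q > 0" "q * sqrt (32/31) = q + K" using K rho by (auto simp: q_def field_simps)
  have D: "D > 0" using rho by (simp add: D_def)
  have s: "s > x" "s \<ge> 16" "s > 0" using less.prems(2) x by (auto simp: s_def)
  have s16: "card S \<ge> 16" using s by (simp add: s_def)
  define A0 where "A0 = A * exp (q / sqrt s)"
  have A0: "A0 > 0" using A by (simp add: A0_def)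
  obtain a1 where a1: "32 * card (support_in S a1) \<le> 31 * card S"
    "(\<Sum>k\<in>S. \<bar>a1 k\<bar>) \<le> A0 * (1 + K / sqrt s)"
    "\<And>\<xi>. \<xi> \<in> {-1..1} \<Longrightarrow> gap S a a1 \<xi> \<le> A0 * K / sqrt s * (real N / s) powr lam"
    using step[rule_format, OF N A0 less.prems(1) s16, of a] less.prems(3) unfolding A0_def s_def by blast
  define M where "M = A * (K * exp q) * real N powr lam"
  have M: "M \<ge> 0" using A K by (simp add: M_def)
  have err1: "gap S a a1 \<xi> \<le> M * s powr - \<beta>" if "\<xi> \<in> {-1..1}" for \<xi>
  proof -
    have "q / sqrt s \<le> q / 1" using q s by (intro divide_left_mono) auto
    then have "A0 \<le> A * exp q" using A by (simp add: A0_def)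
    then have "A0 * K / sqrt s * (real N / s) powr lam \<le> A * exp q * K / sqrt s * (real N / s) powr lam"
      using K s by (intro mult_right_mono divide_right_mono) auto
    also have "\<dots> = M * s powr - \<beta>"
    proof -
      have "s powr - \<beta> = 1 / (s powr lam * sqrt s)"
        unfolding \<beta>_def powr_minus_divide using s by (simp add: powr_add powr_half_sqrt)
      then show ?thesis using s N by (simp add: M_def powr_divide field_simps)
    qed
    finally show ?thesis using a1(3)[OF that] by linarith
  qed
  have mono: "s powr - \<beta> \<le> x powr - \<beta>" using s x \<beta> by (intro powr_mono2') auto
  define S1 where "S1 = support_in S a1"
  define s1 where "s1 = real (card S1)"
  have s1: "s1 \<le> s / (32/31)" using a1(1) by (simp add: s1_def s_def S1_def)
  show ?case
  proof (cases "s1 \<le> x")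
    case True
    \<comment> \<open>The last rounding still starts from more than x coefficients, so the extra
      summand x powr - \<beta> covers its error.\<close>
    have "M * s powr - \<beta> \<le> M * (D * (x powr - \<beta> - s powr - \<beta>) + x powr - \<beta>)"
      using mono M D by (intro mult_left_mono) (auto intro: add_increasing)
    then show ?thesis
      using True err1 unfolding s1_def S1_def M_def[symmetric] s_def[symmetric] by (intro exI[of _ a1]) fastforce
  next
    case False
    then have s1x: "s1 > x" by simp
    have s1pos: "s1 > 0" using s1x x by simp
    have "card S1 < card S" using a1(1) s16 by (simp add: S1_def)
    moreover have "S1 \<subseteq> {..<2 * N}" using less.prems(1) by (auto simp: S1_def)
    moreover have "(\<Sum>k\<in>S1. \<bar>a1 k\<bar>) \<le> A * exp (q / sqrt s1)"
    proof -
      have "(\<Sum>k\<in>S1. \<bar>a1 k\<bar>) \<le> (\<Sum>k\<in>S. \<bar>a1 k\<bar>)" using finS by (intro sum_mono2) (auto simp: S1_def)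
      also have "\<dots> \<le> A0 * (1 + K / sqrt s)" by (rule a1(2))
      also have "\<dots> \<le> A0 * exp (K / sqrt s)" using A0 by (intro mult_left_mono exp_ge_add_one_self) auto
      also have "\<dots> = A * exp ((q + K) / sqrt s)" by (simp add: A0_def mult_exp_exp add_divide_distrib)
      also have "\<dots> \<le> A * exp (q / sqrt s1)"
      proof -
        have "sqrt s1 \<le> sqrt s / sqrt (32/31)" using real_sqrt_le_mono[OF s1] by (simp only: real_sqrt_divide)
        then have "sqrt (32/31) * sqrt s1 \<le> sqrt s" using rho by (simp add: field_simps)
        then have "q * (sqrt (32/31) * sqrt s1) \<le> q * sqrt s" using q by (intro mult_left_mono) auto
        then have "(q + K) * sqrt s1 \<le> q * sqrt s" by (simp add: q(2)[symmetric] mult.assoc)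
        then have "(q + K) / sqrt s \<le> q / sqrt s1" using s s1pos by (simp add: field_simps)
        then show ?thesis using A by simp
      qed
      finally show ?thesis .
    qed
    ultimately obtain a2 where a2: "real (card (support_in S1 a2)) \<le> x"
      "\<And>\<xi>. \<xi> \<in> {-1..1} \<Longrightarrow> gap S1 a1 a2 \<xi>
        \<le> M * (D * (x powr - \<beta> - s1 powr - \<beta>) + x powr - \<beta>)"
      using less.hyps[of S1 a1] s1x unfolding s1_def M_def by blast
    define a' where "a' k = (if k \<in> S1 then a2 k else 0)" for k
    have "support_in S a' = support_in S1 a2" by (auto simp: a'_def S1_def)
    then have "real (card (support_in S a')) \<le> x" using a2(1) by simp
    moreover have "gap S a a' \<xi>
        \<le> M * (D * (x powr - \<beta> - s powr - \<beta>) + x powr - \<beta>)" if \<xi>: "\<xi> \<in> {-1..1}" for \<xi>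
    proof -
      have "(\<Sum>k\<in>S. (a k - a' k) * poly (L k) \<xi>)
          = (\<Sum>k\<in>S. (a k - a1 k) * poly (L k) \<xi>) + (\<Sum>k\<in>S. (a1 k - a' k) * poly (L k) \<xi>)"
        by (simp add: sum.distrib[symmetric] algebra_simps)
      moreover have "(\<Sum>k\<in>S. (a1 k - a' k) * poly (L k) \<xi>) = (\<Sum>k\<in>S1. (a1 k - a2 k) * poly (L k) \<xi>)"
        using finS by (intro sum.mono_neutral_cong_right) (auto simp: a'_def S1_def)
      ultimately have "gap S a a' \<xi>
          \<le> M * s powr - \<beta> + M * (D * (x powr - \<beta> - s1 powr - \<beta>) + x powr - \<beta>)"
        using err1[OF \<xi>] a2(2)[OF \<xi>] by linarith
      also have "\<dots> = M * (s powr - \<beta> + D * (x powr - \<beta> - s1 powr - \<beta>) + x powr - \<beta>)"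
        by (simp add: algebra_simps)
      also have "\<dots> \<le> M * (D * (x powr - \<beta> - s powr - \<beta>) + x powr - \<beta>)"
      proof (intro mult_left_mono M)
        have "s powr - \<beta> * r powr \<beta> = (s / r) powr - \<beta>" if "r > 0" for r
          using s that by (simp add: powr_divide powr_minus field_simps)
        then have "s powr - \<beta> * (32/31) powr \<beta> = (s / (32/31)) powr - \<beta>" by simp
        also have "\<dots> \<le> s1 powr - \<beta>" using s1 s1pos \<beta> by (intro powr_mono2') auto
        finally have "s powr - \<beta> * ((32/31) powr \<beta> - 1) \<le> s1 powr - \<beta> - s powr - \<beta>"
          by (simp add: algebra_simps)
        \<comment> \<open>D is made for the ratio s / s1 \<ge> 32/31: the error of this step is at
          most D times the increment of the telescoping difference.\<close>
        then have "s powr - \<beta> \<le> D * (s1 powr - \<beta> - s powr - \<beta>)"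
          using rho(2) by (simp add: D_def field_simps)
        then show "s powr - \<beta> + D * (x powr - \<beta> - s1 powr - \<beta>) + x powr - \<beta>
            \<le> D * (x powr - \<beta> - s powr - \<beta>) + x powr - \<beta>"
          by (simp add: algebra_simps)
      qed
      finally show ?thesis .
    qed
    ultimately show ?thesis unfolding M_def s_def by blast
  qed
qed

text \<open>If x \<ge> card S everything is kept. If x < 16, where the iteration does not apply,
  zero is the approximant: the trivial bound A C (2 N)^lam has the claimed order since 1 \<le>
  16^\<beta> x^(-\<beta>).\<close>

lemma sparsify:
  "\<exists>K>0. \<forall>N A S a x. N \<ge> 1 \<longrightarrow> A > 0 \<longrightarrow> S \<subseteq> {..<2 * N} \<longrightarrow> x > 0 \<longrightarrow> (\<Sum>k\<in>S. \<bar>a k :: real\<bar>) \<le> A \<longrightarrow>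
     sparse_approx S a x (K * A * real N powr lam * x powr - (lam + 1/2))"
proof -
  define \<beta> where "\<beta> = lam + 1/2"
  have \<beta>: "\<beta> > 0" using lam by (simp add: \<beta>_def)
  obtain K where K: "K > 0" and step: "rounding_step K"
    using sparsify_step by blast
  define q where "q = K / (sqrt (32/31) - 1)"
  define D where "D = 1 / ((32/31) powr \<beta> - 1)"
  have D: "D > 0" using gr_one_powr[of "32/31" \<beta>] \<beta> by (simp add: D_def)
  define K1 where "K1 = max (K * exp q * (D + 1)) (C * 2 powr lam * 16 powr \<beta>)"
  have K1: "K1 > 0" unfolding K1_def using K D by (simp add: less_max_iff_disj)
  show ?thesis
  proof (intro exI[of _ K1] conjI allI impI K1)
    fix N :: nat and A x :: real and S :: "nat set" and a :: "nat \<Rightarrow> real"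
    assume N: "N \<ge> 1" and A: "A > 0" and S: "S \<subseteq> {..<2 * N}" and x: "x > 0" and aA: "(\<Sum>k\<in>S. \<bar>a k\<bar>) \<le> A"
    consider "x \<ge> card S" | "x \<ge> 16" "x < card S" | "x < 16" by linarith
    then show "sparse_approx S a x (K1 * A * real N powr lam * x powr - (lam + 1/2))"
    proof cases
      case 1
      have "card (support_in S a) \<le> card S" using S finite_subset by (intro card_mono) auto
      then show ?thesis using 1 K1 A by (intro exI[of _ a]) auto
    next
      case 2
      have "q / sqrt (card S) \<ge> 0" unfolding q_def using K by simp
      then have "1 \<le> exp (q / sqrt (card S))" by (simp only: one_le_exp_iff)
      then have "A * 1 \<le> A * exp (q / sqrt (card S))" using A by (intro mult_left_mono) auto
      then have "(\<Sum>k\<in>S. \<bar>a k\<bar>) \<le> A * exp (q / sqrt (card S))" using aA by linarith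
      then obtain a' where a': "real (card (support_in S a')) \<le> x" "\<And>\<xi>. \<xi> \<in> {-1..1} \<Longrightarrow> gap S a a' \<xi>
        \<le> A * (K * exp q) * real N powr lam * (D * (x powr - \<beta> - card S powr - \<beta>) + x powr - \<beta>)"
        using sparsify_iterate[OF K step N A 2(1) S 2(2), of a] unfolding q_def D_def \<beta>_def by blast
      have "A * (K * exp q) * real N powr lam * (D * (x powr - \<beta> - card S powr - \<beta>) + x powr - \<beta>)
          \<le> K1 * A * real N powr lam * x powr - \<beta>"
      proof -
        have "D * (x powr - \<beta> - card S powr - \<beta>) + x powr - \<beta> \<le> D * x powr - \<beta> + x powr - \<beta>"
          using D by (intro add_right_mono mult_left_mono) auto
        also have "\<dots> = (D + 1) * x powr - \<beta>" by (simp add: algebra_simps)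
        finally have "A * (K * exp q) * real N powr lam * (D * (x powr - \<beta> - card S powr - \<beta>) + x powr - \<beta>)
            \<le> A * (K * exp q) * real N powr lam * ((D + 1) * x powr - \<beta>)"
          using A K by (intro mult_left_mono) auto
        also have "\<dots> = (K * exp q * (D + 1)) * A * real N powr lam * x powr - \<beta>" by (simp add: mult_ac)
        also have "\<dots> \<le> K1 * A * real N powr lam * x powr - \<beta>"
          using A by (intro mult_right_mono) (auto simp: K1_def)
        finally show ?thesis .
      qed
      then show ?thesis using a' unfolding \<beta>_def[symmetric] by (meson order_trans)
    next
      case 3
      have "\<bar>\<Sum>k\<in>S. a k * poly (L k) \<xi>\<bar> \<le> K1 * A * real N powr lam * x powr - \<beta>" if \<xi>: "\<xi> \<in> {-1..1}" for \<xi>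
      proof -
        have "\<bar>poly (L k) \<xi>\<bar> \<le> C * (2 * real N) powr lam" if "k \<in> S" for k
        proof -
          have "\<bar>poly (L k) (cos (arccos \<xi>))\<bar> \<le> C * (1 + real k) powr lam" by (rule sup_bound)
          also have "\<dots> \<le> C * (2 * real N) powr lam"
            using C lam that S by (intro mult_left_mono powr_mono2) auto
          finally show ?thesis using \<xi> by simp
        qed
        then have "\<bar>\<Sum>k\<in>S. a k * poly (L k) \<xi>\<bar> \<le> (\<Sum>k\<in>S. \<bar>a k\<bar> * (C * (2 * real N) powr lam))"
          by (intro sum_abs[THEN order_trans] sum_mono) (auto simp: abs_mult intro!: mult_left_mono)
        also have "\<dots> \<le> A * (C * (2 * real N) powr lam)"
          unfolding sum_distrib_right[symmetric] using aA C by (intro mult_right_mono) auto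
        also have "\<dots> = (C * 2 powr lam * 1) * A * real N powr lam" by (simp add: powr_mult)
        also have "\<dots> \<le> (C * 2 powr lam * (16 powr \<beta> * x powr - \<beta>)) * A * real N powr lam"
        proof -
          have "16 powr - \<beta> \<le> x powr - \<beta>" using 3 x \<beta> by (intro powr_mono2') auto
          then have "16 powr \<beta> * 16 powr - \<beta> \<le> 16 powr \<beta> * x powr - \<beta>" by (intro mult_left_mono) auto
          then have "1 \<le> 16 powr \<beta> * x powr - \<beta>" by (simp add: powr_minus)
          then show ?thesis using A C by (intro mult_right_mono mult_left_mono) auto
        qed
        also have "\<dots> = (C * 2 powr lam * 16 powr \<beta>) * A * real N powr lam * x powr - \<beta>" by (simp add: mult_ac)
        also have "\<dots> \<le> K1 * A * real N powr lam * x powr - \<beta>"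
          using A by (intro mult_right_mono) (auto simp: K1_def)
        finally show ?thesis .
      qed
      then show ?thesis using x unfolding \<beta>_def by (intro exI[of _ "\<lambda>_. 0"]) auto
    qed
  qed
qed

text \<open>At most x coefficients exceed the threshold h, and these are kept. The others have l_1
  norm at most \<open>B powr \<theta> * h powr (1 - \<theta>)\<close>, which is
  \<open>B * x powr (1 - 1/\<theta>)\<close>; the l_1 result spends the second half of the budget on
  them.\<close>

lemma sparsify_quasi:
  fixes \<theta> :: real
  assumes \<theta>: "0 < \<theta>" "\<theta> \<le> 1"
  shows "\<exists>K>0. \<forall>N B S a x. N \<ge> 1 \<longrightarrow> B > 0 \<longrightarrow> S \<subseteq> {..<2 * N} \<longrightarrow> x > 0 \<longrightarrow> (\<Sum>k\<in>S. \<bar>a k :: real\<bar> powr \<theta>) \<le> B powr \<theta> \<longrightarrow>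
     sparse_approx S a (2 * x) (K * B * real N powr lam * x powr - (lam + 1/\<theta> - 1/2))"
proof -
  obtain K where K: "K > 0" and sp: "\<And>N A S a x. N \<ge> 1 \<Longrightarrow> A > 0 \<Longrightarrow> S \<subseteq> {..<2 * N} \<Longrightarrow> x > 0 \<Longrightarrow> (\<Sum>k\<in>S. \<bar>a k :: real\<bar>) \<le> A \<Longrightarrow>
     sparse_approx S a x (K * A * real N powr lam * x powr - (lam + 1/2))"
    using sparsify by blast
  show ?thesis
  proof (intro exI[of _ K] conjI allI impI K)
    fix N :: nat and B x :: real and S :: "nat set" and a :: "nat \<Rightarrow> real"
    assume N: "N \<ge> 1" and B: "B > 0" and S: "S \<subseteq> {..<2 * N}" and x: "x > 0"
      and aB: "(\<Sum>k\<in>S. \<bar>a k\<bar> powr \<theta>) \<le> B powr \<theta>"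
    have finS: "finite S" using S finite_subset by blast
    define h where "h = B * x powr (- 1/\<theta>)"
    have h: "h > 0" using B x by (simp add: h_def)
    have hth: "h powr \<theta> = B powr \<theta> / x" using B x \<theta> by (simp add: h_def powr_divide powr_powr powr_minus_divide)
    define T where "T = {k\<in>S. \<bar>a k\<bar> > h}"
    have TS: "T \<subseteq> S" "finite T" using finS by (auto simp: T_def)
    have cardT: "real (card T) \<le> x"
    proof -
      have "real (card T) * h powr \<theta> \<le> (\<Sum>k\<in>T. \<bar>a k\<bar> powr \<theta>)"
        using h \<theta> by (intro sum_bounded_below powr_mono2) (auto simp: T_def)
      also have "\<dots> \<le> (\<Sum>k\<in>S. \<bar>a k\<bar> powr \<theta>)" using finS TS by (intro sum_mono2) auto
      finally have "real (card T) * (B powr \<theta> / x) \<le> B powr \<theta>" using aB hth by simp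
      then show ?thesis using B x by (simp add: field_simps)
    qed
    define A where "A = B * x powr (1 - 1/\<theta>)"
    have A: "A > 0" using B x by (simp add: A_def)
    have "(\<Sum>k\<in>S - T. \<bar>a k\<bar>) \<le> (\<Sum>k\<in>S - T. \<bar>a k\<bar> powr \<theta> * h powr (1 - \<theta>))"
    proof (rule sum_mono)
      fix k assume k: "k \<in> S - T"
      show "\<bar>a k\<bar> \<le> \<bar>a k\<bar> powr \<theta> * h powr (1 - \<theta>)"
      proof (cases "a k = 0")
        case False
        then have "\<bar>a k\<bar> = \<bar>a k\<bar> powr \<theta> * \<bar>a k\<bar> powr (1 - \<theta>)" by (simp add: powr_add[symmetric])
        also have "\<dots> \<le> \<bar>a k\<bar> powr \<theta> * h powr (1 - \<theta>)"
          using k \<theta> by (intro mult_left_mono powr_mono2) (auto simp: T_def)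
        finally show ?thesis .
      qed simp
    qed
    also have "\<dots> \<le> B powr \<theta> * h powr (1 - \<theta>)"
      unfolding sum_distrib_right[symmetric]
      using finS by (intro mult_right_mono order_trans[OF _ aB] sum_mono2) auto
    also have "\<dots> = A"
    proof -
      have "h powr (1 - \<theta>) = B powr (1 - \<theta>) * x powr (- 1/\<theta> * (1 - \<theta>))"
        unfolding h_def using B x by (simp add: powr_mult powr_powr)
      moreover have "- 1/\<theta> * (1 - \<theta>) = 1 - 1/\<theta>" using \<theta> by (simp add: field_simps)
      moreover have "B powr \<theta> * B powr (1 - \<theta>) = B" using B by (simp add: powr_add[symmetric])
      ultimately show ?thesis by (simp add: A_def mult.assoc[symmetric])
    qed
    finally have restA: "(\<Sum>k\<in>S - T. \<bar>a k\<bar>) \<le> A" .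
    obtain a1 where a1: "real (card (support_in (S - T) a1)) \<le> x" "\<And>\<xi>. \<xi> \<in> {-1..1} \<Longrightarrow>
        gap (S - T) a a1 \<xi> \<le> K * A * real N powr lam * x powr - (lam + 1/2)"
      using sp[OF N A _ x restA] S by blast
    define a' where "a' k = (if k \<in> T then a k else a1 k)" for k
    have "real (card (support_in S a')) \<le> 2 * x"
    proof -
      have "card (support_in S a') \<le> card (T \<union> (support_in (S - T) a1))"
        using finS TS by (intro card_mono) (auto simp: a'_def)
      also have "\<dots> \<le> card T + card (support_in (S - T) a1)" by (rule card_Un_le)
      finally show ?thesis using cardT a1(1) by linarith
    qed
    moreover have "gap S a a' \<xi>
        \<le> K * B * real N powr lam * x powr - (lam + 1/\<theta> - 1/2)" if \<xi>: "\<xi> \<in> {-1..1}" for \<xi>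
    proof -
      have "(\<Sum>k\<in>S. (a k - a' k) * poly (L k) \<xi>) = (\<Sum>k\<in>S - T. (a k - a1 k) * poly (L k) \<xi>)"
        using finS by (intro sum.mono_neutral_cong_right) (auto simp: a'_def)
      moreover have "K * A * real N powr lam * x powr - (lam + 1/2) = K * B * real N powr lam * x powr - (lam + 1/\<theta> - 1/2)"
      proof -
        have "x powr (1 - 1/\<theta>) * x powr - (lam + 1/2) = x powr - (lam + 1/\<theta> - 1/2)"
          unfolding powr_add[symmetric] by (simp add: algebra_simps)
        then show ?thesis by (simp add: A_def mult_ac)
      qed
      ultimately show ?thesis using a1(2)[OF \<xi>] by (simp only:)
    qed
    ultimately show "sparse_approx S a (2 * x) (K * B * real N powr lam * x powr - (lam + 1/\<theta> - 1/2))" by blast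
  qed
qed

end

section \<open>Approximation by few terms\<close>

lemma summable_from_powr:
  fixes f :: "nat \<Rightarrow> real"
  assumes \<theta>: "0 < \<theta>" "\<theta> \<le> 1" and f: "\<And>k. f k \<ge> 0"
    and sm: "summable (\<lambda>k. f k powr \<theta>)" and le: "(\<Sum>k. f k powr \<theta>) \<le> 1"
  shows "summable f"
proof (rule summable_comparison_test'[OF sm])
  fix k
  have "f k powr \<theta> \<le> (\<Sum>k. f k powr \<theta>)"
    using sum_le_suminf[OF sm, of "{k}"] by simp
  then have "f k powr \<theta> \<le> 1 powr \<theta>" using le by simp
  then have "f k \<le> 1" using \<theta> f by (meson not_le powr_less_mono2 zero_le_one)
  then show "norm (f k) \<le> f k powr \<theta>"
    using \<theta> f[of k] powr_mono'[of \<theta> 1 "f k"] by simp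
qed

definition coeff_ball :: "real \<Rightarrow> real \<Rightarrow> (nat \<Rightarrow> real) \<Rightarrow> bool" where
  "coeff_ball r \<theta> a \<longleftrightarrow> summable (\<lambda>k. ((1 + real k) powr r * \<bar>a k\<bar>) powr \<theta>) \<and>
     (\<Sum>k. ((1 + real k) powr r * \<bar>a k\<bar>) powr \<theta>) \<le> 1"

lemma coeff_ball_summable:
  assumes "0 < \<theta>" "\<theta> \<le> 1" "coeff_ball r \<theta> a"
  shows "summable (\<lambda>k. (1 + real k) powr r * \<bar>a k\<bar>)"
  by (rule summable_from_powr[OF assms(1,2)]) (use assms(3) in \<open>auto simp: coeff_ball_def\<close>)

text \<open>Blocks of 1 + k rather than k, so that degree 0 lies in block 0 and 1 + k is comparable
  to 2 ^ j throughout.\<close>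

definition dyadic :: "nat \<Rightarrow> nat set" where
  "dyadic j = {2 ^ j - 1..<2 ^ Suc j - 1}"

lemma dyadic_iff: "k \<in> dyadic j \<longleftrightarrow> 2 ^ j \<le> k + 1 \<and> k + 1 < 2 ^ Suc j"
  by (auto simp: dyadic_def)

lemma dyadic_index_unique: "k \<in> dyadic j \<Longrightarrow> (LEAST i. k + 1 < 2 ^ Suc i) = j"
proof (rule Least_equality)
  fix i assume k: "k \<in> dyadic j" and "k + 1 < 2 ^ Suc i"
  then have "(2::nat) ^ j < 2 ^ Suc i" by (simp only: dyadic_iff) linarith
  then show "j \<le> i" by (simp add: power_strict_increasing_iff del: power_Suc)
qed (simp add: dyadic_iff)

lemma sum_dyadic_split:
  fixes f :: "nat \<Rightarrow> real"
  shows "(\<Sum>k<2 ^ (j0 + m) - 1. f k) = (\<Sum>k<2 ^ j0 - 1. f k) + (\<Sum>i<m. \<Sum>k\<in>dyadic (j0 + i). f k)"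
proof (induction m)
  case (Suc m)
  have "(2::nat) ^ (j0 + m) - 1 \<le> 2 ^ Suc (j0 + m) - 1" by (intro diff_le_mono power_increasing) auto
  then have "(\<Sum>k<2 ^ (j0 + Suc m) - 1. f k)
      = (\<Sum>k<2 ^ (j0 + m) - 1. f k) + (\<Sum>k\<in>dyadic (j0 + m). f k)"
    by (simp add: lessThan_atLeast0 dyadic_def sum.atLeastLessThan_concat)
  then show ?case using Suc by simp
qed simp

lemma sum_powr_geometric_le:
  fixes d :: real
  assumes "d > 0"
  shows "(\<Sum>i<m. 2 powr (- d * real i)) \<le> 1 / (1 - 2 powr - d)"
proof -
  define q where "q = (2::real) powr - d"
  have q: "0 < q" "q < 1" using assms by (auto simp: q_def powr_minus inverse_less_1_iff gr_one_powr)
  have "(\<Sum>i<m. 2 powr (- d * real i)) = (\<Sum>i<m. q ^ i)"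
    by (intro sum.cong refl) (simp add: q_def powr_realpow[symmetric] powr_powr)
  also have "\<dots> \<le> (\<Sum>i. q ^ i)" using q by (intro sum_le_suminf summable_geometric) auto
  also have "\<dots> = 1 / (1 - q)" using q by (intro suminf_geometric) auto
  finally show ?thesis by (simp add: q_def)
qed

context peaked_polys
begin

lemma abs_poly_le:
  assumes "\<xi> \<in> {-1..1}"
  shows "\<bar>poly (L k) \<xi>\<bar> \<le> C * (1 + real k) powr lam"
  using sup_bound[of k "arccos \<xi>"] assms by simp

lemma abs_term_le:
  assumes "\<xi> \<in> {-1..1}" "r > lam"
  shows "\<bar>a k * poly (L k) \<xi>\<bar> \<le> C * ((1 + real k) powr r * \<bar>a k\<bar>)"
proof -
  have "\<bar>a k * poly (L k) \<xi>\<bar> \<le> \<bar>a k\<bar> * (C * (1 + real k) powr lam)"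
    unfolding abs_mult using abs_poly_le[OF assms(1)] by (intro mult_left_mono) auto
  also have "\<dots> \<le> \<bar>a k\<bar> * (C * (1 + real k) powr r)"
    using assms C by (intro mult_left_mono powr_mono) auto
  finally show ?thesis by (simp add: mult_ac)
qed

text \<open>Degrees up to about y are kept, and the i-th block above them gets the budget y
  2^(-\<kappa> i), up to a factor 2. With a constant budget its error would decay like 2^(-(r - lam)
  i); \<kappa> is chosen so that shrinking the budgets spends half of this exponent. Then both the
  budgets and the errors are geometric series.\<close>

lemma nterm_upper:
  fixes \<theta> r :: real
  assumes \<theta>: "0 < \<theta>" "\<theta> \<le> 1" and r: "r > lam"
  shows "\<exists>K>0. \<exists>Q>0. \<forall>a y. y > 0 \<longrightarrow> coeff_ball r \<theta> a \<longrightarrow>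
     (\<exists>J c. finite J \<and> real (card J) \<le> Q * y \<and> (\<forall>\<xi>\<in>{-1..1}.
        \<bar>(\<Sum>k. a k * poly (L k) \<xi>) - (\<Sum>k\<in>J. c k * poly (L k) \<xi>)\<bar> \<le> K * y powr - (r + 1/\<theta> - 1/2)))"
proof -
  define \<rho> where "\<rho> = lam + 1/\<theta> - 1/2"
  have "1/\<theta> \<ge> 1" using \<theta> by (simp add: field_simps)
  then have \<rho>: "\<rho> > 0" using lam by (simp add: \<rho>_def)
  define \<kappa> where "\<kappa> = (r - lam) / (2 * \<rho>)"
  define \<delta> where "\<delta> = (r - lam) / 2"
  have \<kappa>: "\<kappa> > 0" "\<kappa> * \<rho> = \<delta>" and \<delta>: "\<delta> > 0" using r \<rho> by (auto simp: \<kappa>_def \<delta>_def)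
  obtain K where K: "K > 0" and sq: "\<And>N B S a x. N \<ge> 1 \<Longrightarrow> B > 0 \<Longrightarrow> S \<subseteq> {..<2 * N} \<Longrightarrow> x > 0 \<Longrightarrow>
     (\<Sum>k\<in>S. \<bar>a k :: real\<bar> powr \<theta>) \<le> B powr \<theta> \<Longrightarrow>
     sparse_approx S a (2 * x) (K * B * real N powr lam * x powr - \<rho>)"
    using sparsify_quasi[OF \<theta>] unfolding \<rho>_def by blast
  define K' where "K' = K * 2 powr (r - lam) * (1 / (1 - 2 powr - \<delta>))"
  define Q where "Q = 1 + 2 * (1 / (1 - 2 powr - \<kappa>))"
  have geo: "1 / (1 - 2 powr - d) > 0" if "d > 0" for d :: real
  proof -
    have "2 powr - d < (1::real)" using that by (simp add: powr_minus inverse_less_1_iff gr_one_powr)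
    then show ?thesis by simp
  qed
  have K': "K' > 0" unfolding K'_def using K geo[OF \<delta>] by (intro mult_pos_pos) auto
  have Q: "Q > 0" unfolding Q_def using geo[OF \<kappa>(1)] by linarith
  show ?thesis
  proof (rule exI[of _ K'], rule conjI, rule K', rule exI[of _ Q], rule conjI, rule Q, intro allI impI)
    fix a :: "nat \<Rightarrow> real" and y :: real
    assume y: "y > 0" and ball: "coeff_ball r \<theta> a"
    then have sm: "summable (\<lambda>k. ((1 + real k) powr r * \<bar>a k\<bar>) powr \<theta>)"
      and le1: "(\<Sum>k. ((1 + real k) powr r * \<bar>a k\<bar>) powr \<theta>) \<le> 1"
      by (auto simp: coeff_ball_def)
    have ex: "\<exists>j. y < 2 ^ Suc j"
    proof -
      obtain n where "y < 2 ^ n" using real_arch_pow[of 2 y] by auto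
      then have "y < 2 ^ Suc n" by (rule order_less_le_trans) simp
      then show ?thesis ..
    qed
    \<comment> \<open>So 2 ^ j0 - 1 \<le> y < 2 ^ (j0 + 1). For y < 2 this means j0 = 0, and no
      degree is kept exactly.\<close>
    define j0 where "j0 = (LEAST j. y < 2 ^ Suc j)"
    have j0: "y < 2 ^ Suc j0" unfolding j0_def using ex by (rule LeastI_ex)
    have low: "real (2 ^ j0 - 1) \<le> y"
    proof (cases j0)
      case (Suc j)
      then have "\<not> y < 2 ^ Suc j" using not_less_Least[of j "\<lambda>j. y < 2 ^ Suc j"] by (simp add: j0_def)
      then show ?thesis using Suc by (simp add: of_nat_diff)
    qed (use y in simp)
    define x where "x i = y * 2 powr (- \<kappa> * real i)" for i :: nat
    have x: "x i > 0" for i using y by (simp add: x_def)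
    define e where "e i = K * 2 powr (r - lam) * y powr - (r + 1/\<theta> - 1/2) * 2 powr (- \<delta> * real i)" for i :: nat
    have block: "sparse_approx (dyadic (j0 + i)) a (2 * x i) (e i)" for i
    proof -
      define j where "j = j0 + i"
      define B where "B = 2 powr (- r * real j)"
      have rpos: "r > 0" using r lam by simp
      have "(\<Sum>k\<in>dyadic j. \<bar>a k\<bar> powr \<theta>) \<le> B powr \<theta>"
      proof -
        have "(\<Sum>k\<in>dyadic j. \<bar>a k\<bar> powr \<theta>) \<le> (\<Sum>k\<in>dyadic j. B powr \<theta> * ((1 + real k) powr r * \<bar>a k\<bar>) powr \<theta>)"
        proof (rule sum_mono)
          fix k assume "k \<in> dyadic j"
          then have "2 ^ j \<le> k + 1" by (simp add: dyadic_iff)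
          then have "real (2 ^ j) \<le> real (k + 1)" by (simp only: of_nat_le_iff)
          then have "2 powr real j \<le> 1 + real k" by (simp add: powr_realpow)
          then have "(2 powr real j) powr r \<le> (1 + real k) powr r" using rpos by (intro powr_mono2) auto
          then have "B * (2 powr real j) powr r \<le> B * (1 + real k) powr r" by (intro mult_left_mono) (auto simp: B_def)
          moreover have "B * (2 powr real j) powr r = 1"
            by (simp add: B_def powr_powr powr_add[symmetric] mult.commute)
          ultimately have "1 * \<bar>a k\<bar> \<le> B * (1 + real k) powr r * \<bar>a k\<bar>" by (intro mult_right_mono) auto
          then have "\<bar>a k\<bar> powr \<theta> \<le> (B * ((1 + real k) powr r * \<bar>a k\<bar>)) powr \<theta>"
            using \<theta> by (intro powr_mono2) (auto simp: mult.assoc)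
          then show "\<bar>a k\<bar> powr \<theta> \<le> B powr \<theta> * ((1 + real k) powr r * \<bar>a k\<bar>) powr \<theta>"
            by (simp add: powr_mult B_def)
        qed
        also have "\<dots> \<le> B powr \<theta> * (\<Sum>k. ((1 + real k) powr r * \<bar>a k\<bar>) powr \<theta>)"
          unfolding sum_distrib_left[symmetric] using sm
          by (intro mult_left_mono sum_le_suminf) (auto simp: dyadic_def)
        also have "\<dots> \<le> B powr \<theta> * 1" using le1 by (intro mult_left_mono) auto
        finally show ?thesis by simp
      qed
      moreover have "dyadic j \<subseteq> {..<2 * 2 ^ j}" by (auto simp: dyadic_def)
      ultimately obtain a' where a': "real (card (support_in (dyadic j) a')) \<le> 2 * x i"
        "\<And>\<xi>. \<xi> \<in> {-1..1} \<Longrightarrow> gap (dyadic j) a a' \<xi> \<le> K * B * real (2 ^ j) powr lam * x i powr - \<rho>"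
        using sq[of "2 ^ j" B "dyadic j" "x i" a] x by (auto simp: B_def)
      have "K * B * real (2 ^ j) powr lam * x i powr - \<rho> \<le> e i"
      proof -
        have xpow: "x i powr - \<rho> = y powr - \<rho> * 2 powr (\<delta> * real i)"
        proof -
          have "(2 powr (- \<kappa> * real i)) powr - \<rho> = 2 powr ((\<kappa> * \<rho>) * real i)"
            by (simp add: powr_powr mult_ac)
          then show ?thesis using y by (simp add: x_def powr_mult \<kappa>(2))
        qed
        have "real (2 ^ j) powr lam = 2 powr (lam * real j)"
          by (simp add: powr_realpow[symmetric] powr_powr mult.commute)
        then have "B * real (2 ^ j) powr lam = 2 powr (- (r - lam) * real j)"
          by (simp add: B_def powr_add[symmetric] algebra_simps)
        also have "\<dots> = 2 powr (- (r - lam) * real i) * (2 ^ j0) powr - (r - lam)"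
          by (simp add: j_def powr_realpow[symmetric] powr_powr powr_add[symmetric] algebra_simps)
        also have "\<dots> \<le> 2 powr (- (r - lam) * real i) * (y / 2) powr - (r - lam)"
          using j0 y r by (intro mult_left_mono powr_mono2') auto
        also have "(y / 2) powr - (r - lam) = 2 powr (r - lam) * y powr - (r - lam)"
        proof -
          have "(y / 2) powr - d = 2 powr d * y powr - d" for d
            using y by (simp add: powr_divide powr_minus field_simps)
          then show ?thesis .
        qed
        finally have "B * real (2 ^ j) powr lam \<le> 2 powr (- (r - lam) * real i) * (2 powr (r - lam) * y powr - (r - lam))" .
        then have "K * (B * real (2 ^ j) powr lam) * x i powr - \<rho>
            \<le> K * (2 powr (- (r - lam) * real i) * (2 powr (r - lam) * y powr - (r - lam))) * x i powr - \<rho>"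
          using K by (intro mult_right_mono mult_left_mono) auto
        also have "\<dots> = K * 2 powr (r - lam) * (y powr - (r - lam) * y powr - \<rho>) * (2 powr (- (r - lam) * real i) * 2 powr (\<delta> * real i))"
          unfolding xpow by (simp only: mult_ac)
        also have "y powr - (r - lam) * y powr - \<rho> = y powr - (r + 1/\<theta> - 1/2)"
        proof -
          have "- (r - lam) + - \<rho> = - (r + 1/\<theta> - 1/2)" by (simp add: \<rho>_def)
          then show ?thesis unfolding powr_add[symmetric] by (simp only:)
        qed
        also have "2 powr (- (r - lam) * real i) * 2 powr (\<delta> * real i) = (2::real) powr (- \<delta> * real i)"
        proof -
          have "- (r - lam) * real i + \<delta> * real i = - \<delta> * real i" by (simp add: \<delta>_def field_simps)
          then show ?thesis unfolding powr_add[symmetric] by (simp only:)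
        qed
        finally show ?thesis by (simp add: e_def mult.assoc)
      qed
      then show ?thesis using a' unfolding j_def by (meson order_trans)
    qed
    have "\<forall>i. sparse_approx (dyadic (j0 + i)) a (2 * x i) (e i)" using block by blast
    then have "\<exists>a'. \<forall>i. (real (card (support_in (dyadic (j0 + i)) (a' i))) \<le> 2 * x i \<and>
        (\<forall>\<xi>\<in>{-1..1}. gap (dyadic (j0 + i)) a (a' i) \<xi> \<le> e i))"
      by (rule choice)
    then obtain a' where "\<forall>i. (real (card (support_in (dyadic (j0 + i)) (a' i))) \<le> 2 * x i \<and>
        (\<forall>\<xi>\<in>{-1..1}. gap (dyadic (j0 + i)) a (a' i) \<xi> \<le> e i))"
      by blast
    then have a': "\<And>i. real (card (support_in (dyadic (j0 + i)) (a' i))) \<le> 2 * x i"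
      "\<And>i \<xi>. \<xi> \<in> {-1..1} \<Longrightarrow> gap (dyadic (j0 + i)) a (a' i) \<xi> \<le> e i"
      by blast+
    define b where "b k = (if k < 2 ^ j0 - 1 then a k else a' ((LEAST i. k + 1 < 2 ^ Suc i) - j0) k)" for k :: nat
    have b_block: "b k = a' i k" if k: "k \<in> dyadic (j0 + i)" for i k
    proof -
      have "(2::nat) ^ j0 \<le> 2 ^ (j0 + i)" by (rule power_increasing) auto
      then have "\<not> k < 2 ^ j0 - 1" using k unfolding dyadic_iff by linarith
      then show ?thesis unfolding b_def dyadic_index_unique[OF k] by simp
    qed
    \<comment> \<open>A budget below one forces the zero approximant, so only finitely many blocks
      contribute indices to J.\<close>
    have "(\<lambda>i. 2 * x i) \<longlonglongrightarrow> 0"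
    proof -
      have "(\<lambda>i. 2 * y * (2 powr - \<kappa>) ^ i) \<longlonglongrightarrow> 2 * y * 0"
        using \<kappa>(1) by (intro tendsto_mult_left LIMSEQ_power_zero) (simp add: powr_minus inverse_less_1_iff gr_one_powr)
      then show ?thesis by (simp add: x_def powr_realpow[symmetric] powr_powr mult.assoc)
    qed
    then have "\<forall>\<^sub>F i in sequentially. 2 * x i < 1" by (rule order_tendstoD) simp
    then obtain i1 where i1: "\<And>i. i \<ge> i1 \<Longrightarrow> 2 * x i < 1" unfolding eventually_sequentially by blast
    have fin_dyadic: "finite (dyadic j)" for j by (simp add: dyadic_def)
    have zero: "a' i k = 0" if "i \<ge> i1" "k \<in> dyadic (j0 + i)" for i k
    proof -
      have "card (support_in (dyadic (j0 + i)) (a' i)) = 0" using a'(1)[of i] i1[OF that(1)] by linarith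
      then show ?thesis using that(2) fin_dyadic by (auto simp: card_eq_0_iff)
    qed
    define J where "J = {..<2 ^ j0 - 1} \<union> (\<Union>i<i1. (support_in (dyadic (j0 + i)) (a' i)))"
    have finJ: "finite J" using fin_dyadic by (auto simp: J_def)
    have cardJ: "real (card J) \<le> Q * y"
    proof -
      have "card J \<le> card {..<2 ^ j0 - 1 :: nat} + (\<Sum>i<i1. card (support_in (dyadic (j0 + i)) (a' i)))"
        unfolding J_def by (rule order_trans[OF card_Un_le add_left_mono[OF card_UN_le]]) simp
      then have "real (card J) \<le> real (2 ^ j0 - 1) + (\<Sum>i<i1. real (card (support_in (dyadic (j0 + i)) (a' i))))"
        unfolding of_nat_sum[symmetric] of_nat_add[symmetric] of_nat_le_iff by simp
      also have "\<dots> \<le> y + (\<Sum>i<i1. 2 * x i)" using low a'(1) by (intro add_mono sum_mono) auto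
      also have "(\<Sum>i<i1. 2 * x i) = 2 * y * (\<Sum>i<i1. 2 powr (- \<kappa> * real i))"
        by (simp add: x_def sum_distrib_left mult.assoc)
      also have "y + \<dots> \<le> y + 2 * y * (1 / (1 - 2 powr - \<kappa>))"
        using y \<kappa> by (intro add_left_mono mult_left_mono sum_powr_geometric_le) auto
      finally show ?thesis by (simp add: Q_def algebra_simps)
    qed
    have "\<bar>(\<Sum>k. a k * poly (L k) \<xi>) - (\<Sum>k\<in>J. b k * poly (L k) \<xi>)\<bar> \<le> K' * y powr - (r + 1/\<theta> - 1/2)"
      if \<xi>: "\<xi> \<in> {-1..1}" for \<xi>
    proof -
      have sa: "summable (\<lambda>k. a k * poly (L k) \<xi>)"
      proof (rule summable_comparison_test')
        show "summable (\<lambda>k. C * ((1 + real k) powr r * \<bar>a k\<bar>))"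
          by (rule summable_mult[OF coeff_ball_summable[OF \<theta> ball]])
        show "norm (a k * poly (L k) \<xi>) \<le> C * ((1 + real k) powr r * \<bar>a k\<bar>)" for k
          using abs_term_le[OF \<xi> r, of a k] by simp
      qed
      have part: "\<bar>(\<Sum>k<2 ^ (j0 + m) - 1. a k * poly (L k) \<xi>) - (\<Sum>k\<in>J. b k * poly (L k) \<xi>)\<bar>
          \<le> K' * y powr - (r + 1/\<theta> - 1/2)" if m: "m \<ge> i1" for m
      proof -
        have "(\<Sum>k<2 ^ (j0 + m) - 1. b k * poly (L k) \<xi>) = (\<Sum>k\<in>J. b k * poly (L k) \<xi>)"
        proof (rule sum.mono_neutral_right)
          have "k < 2 ^ (j0 + m) - 1" if kJ: "k \<in> J" for k
          proof -
            consider "k < 2 ^ j0 - 1" | i where "i < i1" "k \<in> dyadic (j0 + i)" using kJ unfolding J_def by blast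
            then show ?thesis
            proof cases
              case 1
              have "(2::nat) ^ j0 \<le> 2 ^ (j0 + m)" by (rule power_increasing) auto
              then show ?thesis using 1 by linarith
            next
              case 2
              have "(2::nat) ^ Suc (j0 + i) \<le> 2 ^ (j0 + m)" using 2 m by (intro power_increasing) auto
              then show ?thesis using 2(2) unfolding dyadic_iff by linarith
            qed
          qed
          then show "J \<subseteq> {..<2 ^ (j0 + m) - 1}" by auto
          show "\<forall>k\<in>{..<2 ^ (j0 + m) - 1} - J. b k * poly (L k) \<xi> = 0"
          proof
            fix k assume k: "k \<in> {..<2 ^ (j0 + m) - 1} - J"
            define j where "j = (LEAST i. k + 1 < 2 ^ Suc i)"
            have "k + 1 < 2 ^ Suc k" using less_exp[of "Suc k"] by simp
            then have j1: "k + 1 < 2 ^ Suc j" unfolding j_def by (rule LeastI)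
            have k0: "2 ^ j0 \<le> k + 1" using k by (auto simp: J_def not_less)
            have j2: "2 ^ j \<le> k + 1"
            proof (cases j)
              case (Suc i)
              then have "\<not> k + 1 < 2 ^ Suc i" using not_less_Least[of i "\<lambda>i. k + 1 < 2 ^ Suc i"] by (simp add: j_def)
              then show ?thesis using Suc by simp
            qed simp
            have "(2::nat) ^ j0 < 2 ^ Suc j" using k0 j1 by linarith
            then have "j0 \<le> j" by (simp add: power_strict_increasing_iff del: power_Suc)
            then obtain i where i: "j = j0 + i" using le_Suc_ex by blast
            have kd: "k \<in> dyadic (j0 + i)" using j1 j2 by (simp add: dyadic_iff i)
            have "a' i k = 0"
            proof (cases "i < i1")
              case True
              then show ?thesis using k kd by (auto simp: J_def)
            qed (use zero kd in auto)
            then show "b k * poly (L k) \<xi> = 0" using b_block[OF kd] by simp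
          qed
        qed simp
        moreover have "(\<Sum>k<2 ^ (j0 + m) - 1. a k * poly (L k) \<xi>) - (\<Sum>k<2 ^ (j0 + m) - 1. b k * poly (L k) \<xi>)
            = (\<Sum>i<m. \<Sum>k\<in>dyadic (j0 + i). (a k - a' i k) * poly (L k) \<xi>)"
        proof -
          have "(\<Sum>k<2 ^ (j0 + m) - 1. (a k - b k) * poly (L k) \<xi>)
              = (\<Sum>i<m. \<Sum>k\<in>dyadic (j0 + i). (a k - b k) * poly (L k) \<xi>)"
            unfolding sum_dyadic_split by (simp add: b_def)
          also have "\<dots> = (\<Sum>i<m. \<Sum>k\<in>dyadic (j0 + i). (a k - a' i k) * poly (L k) \<xi>)"
            by (intro sum.cong refl) (simp add: b_block)
          finally show ?thesis by (simp add: left_diff_distrib sum_subtractf)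
        qed
        ultimately have "\<bar>(\<Sum>k<2 ^ (j0 + m) - 1. a k * poly (L k) \<xi>) - (\<Sum>k\<in>J. b k * poly (L k) \<xi>)\<bar> \<le> (\<Sum>i<m. e i)"
          by (simp only:) (rule order_trans[OF sum_abs], rule sum_mono, rule a'(2)[OF \<xi>])
        also have "\<dots> = K * 2 powr (r - lam) * y powr - (r + 1/\<theta> - 1/2) * (\<Sum>i<m. 2 powr (- \<delta> * real i))"
          by (simp add: e_def sum_distrib_left)
        also have "\<dots> \<le> K * 2 powr (r - lam) * y powr - (r + 1/\<theta> - 1/2) * (1 / (1 - 2 powr - \<delta>))"
          using K \<delta> by (intro mult_left_mono sum_powr_geometric_le) auto
        also have "\<dots> = K' * y powr - (r + 1/\<theta> - 1/2)" by (simp add: K'_def)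
        finally show ?thesis .
      qed
      \<comment> \<open>The bound for partial sums over complete blocks is uniform in m and passes
        to the limit.\<close>
      have "(\<lambda>m. \<Sum>k<2 ^ (j0 + m) - 1. a k * poly (L k) \<xi>) \<longlonglongrightarrow> (\<Sum>k. a k * poly (L k) \<xi>)"
      proof (rule filterlim_compose[OF summable_LIMSEQ[OF sa]])
        show "filterlim (\<lambda>m. 2 ^ (j0 + m) - 1 :: nat) at_top sequentially"
        proof (rule filterlim_at_top_mono[OF filterlim_ident])
          show "\<forall>\<^sub>F m in sequentially. m \<le> 2 ^ (j0 + m) - 1"
          proof (rule always_eventually, rule allI)
            fix m :: nat
            have "m < 2 ^ m" by (rule less_exp)
            also have "(2::nat) ^ m \<le> 2 ^ (j0 + m)" by (rule power_increasing) auto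
            finally show "m \<le> 2 ^ (j0 + m) - 1" by simp
          qed
        qed
      qed
      then have "(\<lambda>m. \<bar>(\<Sum>k<2 ^ (j0 + m) - 1. a k * poly (L k) \<xi>) - (\<Sum>k\<in>J. b k * poly (L k) \<xi>)\<bar>)
          \<longlonglongrightarrow> \<bar>(\<Sum>k. a k * poly (L k) \<xi>) - (\<Sum>k\<in>J. b k * poly (L k) \<xi>)\<bar>"
        by (intro tendsto_rabs tendsto_diff tendsto_const)
      then show ?thesis by (rule LIMSEQ_le_const2) (use part in blast)
    qed
    then show "\<exists>J c. finite J \<and> real (card J) \<le> Q * y \<and> (\<forall>\<xi>\<in>{-1..1}.
        \<bar>(\<Sum>k. a k * poly (L k) \<xi>) - (\<Sum>k\<in>J. c k * poly (L k) \<xi>)\<bar> \<le> K' * y powr - (r + 1/\<theta> - 1/2))"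
      using finJ cardJ by blast
  qed
qed

end

section \<open>Expansions\<close>

text \<open>Coefficients pass to uniform limits because \<open>gmean\<close> is bounded by the
  uniform norm.\<close>

lemma uniform_limit_gmean_coeff:
  fixes a :: "nat \<Rightarrow> real" and P :: "nat \<Rightarrow> real poly"
  assumes lam: "lam > 0"
    and orth: "\<And>m n. gmean lam (\<lambda>x. poly (P m) x * poly (P n) x) = (if m = n then 1 else 0)"
    and ul: "uniform_limit {-1..1} (\<lambda>n x. \<Sum>k<n. a k * poly (P k) x) g sequentially"
  shows "continuous_on {-1..1} g" and "gmean lam (\<lambda>x. g x * poly (P m) x) = a m"
proof -
  show cg: "continuous_on {-1..1} g"
    using ul by (rule uniform_limit_theorem[rotated]) (auto intro!: always_eventually continuous_intros)
  obtain B where B: "B > 0" "\<And>x. x \<in> {-1..1} \<Longrightarrow> \<bar>poly (P m) x\<bar> \<le> B"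
    using continuous_on_interval_bounded[of "poly (P m)"] by auto
  have S: "gmean lam (\<lambda>x. (\<Sum>k<n. a k * poly (P k) x) * poly (P m) x) = a m" if "n > m" for n
  proof -
    have "(\<lambda>x. (\<Sum>k<n. a k * poly (P k) x) * poly (P m) x) = (\<lambda>x. \<Sum>k<n. a k * (poly (P k) x * poly (P m) x))"
      by (simp add: sum_distrib_right mult.assoc)
    then have "gmean lam (\<lambda>x. (\<Sum>k<n. a k * poly (P k) x) * poly (P m) x) = (\<Sum>k<n. a k * (if k = m then 1 else 0))"
      by (simp add: gmean_sum[OF lam] gmean_cmult[OF lam] orth continuous_on_mult)
    then show ?thesis using that by (simp add: if_distrib[of "\<lambda>x. _ * x"] cong: if_cong)
  qed
  have "\<bar>gmean lam (\<lambda>x. g x * poly (P m) x) - a m\<bar> \<le> e" if e: "e > 0" for e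
  proof -
    have "\<forall>\<^sub>F n in sequentially. \<forall>x\<in>{-1..1}. dist (\<Sum>k<n. a k * poly (P k) x) (g x) < e / B"
      using uniform_limitD[OF ul, of "e / B"] e B by simp
    then have "\<forall>\<^sub>F n in sequentially. (\<forall>x\<in>{-1..1}. dist (\<Sum>k<n. a k * poly (P k) x) (g x) < e / B) \<and> n > m"
      by (rule eventually_conj[OF _ eventually_gt_at_top[of m]])
    then have "\<exists>n. (\<forall>x\<in>{-1..1}. dist (\<Sum>k<n. a k * poly (P k) x) (g x) < e / B) \<and> n > m"
      by (rule eventually_happens'[OF sequentially_bot])
    then obtain n where n: "n > m" "\<And>x. x \<in> {-1..1} \<Longrightarrow> dist (\<Sum>k<n. a k * poly (P k) x) (g x) < e / B"
      by blast
    let ?S = "\<lambda>x. \<Sum>k<n. a k * poly (P k) x"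
    have cS: "continuous_on {-1..1} ?S" by (intro continuous_intros)
    have "gmean lam (\<lambda>x. g x * poly (P m) x) - a m = gmean lam (\<lambda>x. g x * poly (P m) x - ?S x * poly (P m) x)"
      unfolding S[OF n(1), symmetric]
      by (rule gmean_diff[OF lam, symmetric]) (intro continuous_on_mult cg cS continuous_on_poly_fun)+
    also have "\<bar>\<dots>\<bar> \<le> e"
    proof (rule gmean_abs_le[OF lam])
      show "continuous_on {-1..1} (\<lambda>x. g x * poly (P m) x - ?S x * poly (P m) x)"
        using cg cS by (intro continuous_on_diff continuous_on_mult) auto
      fix x :: real assume x: "x \<in> {-1..1}"
      have "\<bar>g x * poly (P m) x - ?S x * poly (P m) x\<bar> = \<bar>?S x - g x\<bar> * \<bar>poly (P m) x\<bar>"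
        by (simp add: left_diff_distrib[symmetric] abs_mult abs_minus_commute)
      also have "\<dots> \<le> e / B * B" using n(2)[OF x] B e x by (intro mult_mono) (auto simp: dist_real_def)
      finally show "\<bar>g x * poly (P m) x - ?S x * poly (P m) x\<bar> \<le> e" using B by simp
    qed
    finally show ?thesis .
  qed
  then have "\<bar>gmean lam (\<lambda>x. g x * poly (P m) x) - a m\<bar> \<le> 0 + e" if "e > 0" for e
    using that by simp
  then have "\<bar>gmean lam (\<lambda>x. g x * poly (P m) x) - a m\<bar> \<le> 0" by (rule field_le_epsilon)
  then show "gmean lam (\<lambda>x. g x * poly (P m) x) = a m" by simp
qed

text \<open>Completeness: the mean of d^2 equals that of d (d - q) for every polynomial q, and by
  Weierstrass d - q can be made uniformly small.\<close>

lemma gmean_orthogonal_imp_zero: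
  fixes P :: "nat \<Rightarrow> real poly"
  assumes lam: "lam > 0" and P: "\<And>k. degree (P k) = k \<and> P k \<noteq> 0"
    and d: "continuous_on {-1..1} d" and z: "\<And>k. gmean lam (\<lambda>x. d x * poly (P k) x) = 0"
    and x: "x \<in> {-1..1}"
  shows "d x = 0"
proof -
  have zq: "gmean lam (\<lambda>x. d x * poly q x) = 0" for q
  proof -
    obtain c where c: "q = (\<Sum>k<Suc (degree q). smult (c k) (P k))"
      using poly_span_degree_basis[of "Suc (degree q)" P q] P by auto
    have pq: "poly q x = (\<Sum>k<Suc (degree q). c k * poly (P k) x)" for x
      by (subst c) (simp only: poly_sum poly_smult)
    have "(\<lambda>x. d x * poly q x) = (\<lambda>x. \<Sum>k<Suc (degree q). c k * (d x * poly (P k) x))"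
      unfolding pq sum_distrib_left by (simp only: mult.left_commute)
    then show ?thesis
      using z d by (simp add: gmean_sum[OF lam] gmean_cmult[OF lam] continuous_on_mult del: sum.lessThan_Suc)
  qed
  obtain M where M: "M > 0" "\<And>x. x \<in> {-1..1} \<Longrightarrow> \<bar>d x\<bar> \<le> M"
    using continuous_on_interval_bounded[OF d] by blast
  have dd: "continuous_on {-1..1} (\<lambda>x. (d x)\<^sup>2)" using d by (rule continuous_on_power)
  have "gmean lam (\<lambda>x. (d x)\<^sup>2) \<le> 0 + e" if e: "e > 0" for e
  proof -
    obtain p where p: "real_polynomial_function p" "\<And>x. x \<in> {-1..1} \<Longrightarrow> \<bar>d x - p x\<bar> < e / M"
      by (rule Stone_Weierstrass_real_polynomial_function[OF compact_Icc d, of "e / M"]) (use e M(1) in auto)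
    obtain c n where c: "p = (\<lambda>x. \<Sum>i\<le>n. c i * x ^ i)" using p(1) real_polynomial_function_iff_sum by blast
    define q where "q = (\<Sum>i\<le>n. monom (c i) i)"
    have pq: "p = poly q" by (simp add: c q_def poly_sum poly_monom fun_eq_iff)
    have "(\<lambda>x. (d x)\<^sup>2) = (\<lambda>x. d x * (d x - poly q x) + d x * poly q x)"
      by (simp add: power2_eq_square algebra_simps)
    then have "gmean lam (\<lambda>x. (d x)\<^sup>2) = gmean lam (\<lambda>x. d x * (d x - poly q x))"
      using d zq by (simp add: gmean_add[OF lam] continuous_on_mult continuous_on_diff)
    also have "\<dots> \<le> \<bar>\<dots>\<bar>" by simp
    also have "\<dots> \<le> M * (e / M)"
    proof (rule gmean_abs_le[OF lam])
      show "continuous_on {-1..1} (\<lambda>x. d x * (d x - poly q x))"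
        using d by (intro continuous_on_mult continuous_on_diff) auto
      fix x :: real assume x: "x \<in> {-1..1}"
      show "\<bar>d x * (d x - poly q x)\<bar> \<le> M * (e / M)"
        unfolding abs_mult using M(1) M(2)[OF x] p(2)[OF x] e by (intro mult_mono) (auto simp: pq)
    qed
    finally show ?thesis using M(1) by simp
  qed
  then have "gmean lam (\<lambda>x. (d x)\<^sup>2) \<le> 0" by (rule field_le_epsilon)
  moreover have "gmean lam (\<lambda>x. (d x)\<^sup>2) \<ge> 0"
    using gmean_mono[OF lam, of "\<lambda>_. 0" "\<lambda>x. (d x)\<^sup>2"] gmean_const[OF lam, of 0] dd by simp
  ultimately show ?thesis using gmean_square_eq_0[OF lam d _ x] by simp
qed

lemma gmean_parseval:
  fixes e :: "nat \<Rightarrow> real" and P :: "nat \<Rightarrow> real poly"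
  assumes lam: "lam > 0" and U: "finite U"
    and orth: "\<And>m n. gmean lam (\<lambda>x. poly (P m) x * poly (P n) x) = (if m = n then 1 else 0)"
  shows "gmean lam (\<lambda>x. (\<Sum>k\<in>U. e k * poly (P k) x)\<^sup>2) = (\<Sum>k\<in>U. (e k)\<^sup>2)"
proof -
  have "(\<lambda>x. (\<Sum>k\<in>U. e k * poly (P k) x)\<^sup>2) = (\<lambda>x. \<Sum>k\<in>U. \<Sum>l\<in>U. (e k * e l) * (poly (P k) x * poly (P l) x))"
    by (simp add: power2_eq_square sum_product mult_ac)
  then have "gmean lam (\<lambda>x. (\<Sum>k\<in>U. e k * poly (P k) x)\<^sup>2)
      = (\<Sum>k\<in>U. gmean lam (\<lambda>x. \<Sum>l\<in>U. (e k * e l) * (poly (P k) x * poly (P l) x)))"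
    using U by (simp only:) (intro gmean_sum[OF lam] continuous_on_sum continuous_on_mult continuous_on_const, auto)
  also have "\<dots> = (\<Sum>k\<in>U. \<Sum>l\<in>U. (e k * e l) * (if k = l then 1 else 0))"
    using U by (intro sum.cong refl) (subst gmean_sum[OF lam], auto simp: gmean_cmult[OF lam] orth continuous_on_mult)
  also have "\<dots> = (\<Sum>k\<in>U. (e k)\<^sup>2)"
    using U by (intro sum.cong refl) (simp add: if_distrib[of "\<lambda>x. _ * x"] power2_eq_square cong: if_cong)
  finally show ?thesis .
qed

text \<open>The basis is real, so complex functions reduce to their real and imaginary
  parts.\<close>

lemma gegen_inner_gegenL:
  assumes \<alpha>: "\<alpha> > -1/2" and f: "continuous_on {-1..1} f"
  shows "gegen_inner \<alpha> f (gegenL \<alpha> n) =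
    Complex (gmean (\<alpha> + 1/2) (\<lambda>x. Re (f x) * poly (gegen_poly \<alpha> n) x))
            (gmean (\<alpha> + 1/2) (\<lambda>x. Im (f x) * poly (gegen_poly \<alpha> n) x))"
proof -
  let ?P = "poly (gegen_poly \<alpha> n)"
  have int: "((\<lambda>x. complex_of_real (gegen_weight \<alpha> x * (h x * ?P x))) has_integral
      complex_of_real (gmean (\<alpha> + 1/2) (\<lambda>x. h x * ?P x))) {-1..1}" if "continuous_on {-1..1} h" for h
  proof -
    have "((\<lambda>x. gegen_weight \<alpha> x * (h x * ?P x)) has_integral gmean (\<alpha> + 1/2) (\<lambda>x. h x * ?P x)) {-1..1}"
      using that by (intro integral_gegen_weight[OF \<alpha>] continuous_on_mult) auto
    from has_integral_linear[OF this bounded_linear_of_real[where ?'a = complex]]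
    show ?thesis by (simp only: o_def)
  qed
  note re = int[OF continuous_on_Re[OF f]]
  note im = has_integral_mult_right[OF int[OF continuous_on_Im[OF f]], of \<i>]
  have "(\<lambda>x. complex_of_real (gegen_weight \<alpha> x) * f x * cnj (gegenL \<alpha> n x)) =
      (\<lambda>x. complex_of_real (gegen_weight \<alpha> x * (Re (f x) * ?P x)) + \<i> * complex_of_real (gegen_weight \<alpha> x * (Im (f x) * ?P x)))"
    by (rule ext) (simp add: gegenL_def complex_eq_iff)
  then show ?thesis
    unfolding gegen_inner_def using integral_unique[OF has_integral_add[OF re im]] by (simp add: Complex_eq)
qed

lemma sup_dist_ge:
  assumes "continuous_on {-1..1} f" "continuous_on {-1..1} g" "x \<in> {-1..1}"
  shows "norm (f x - g x) \<le> sup_dist f g"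
proof -
  have "compact ((\<lambda>x. norm (f x - g x)) ` {-1..1})"
    using assms by (intro compact_continuous_image continuous_intros) auto
  then have "bdd_above ((\<lambda>x. norm (f x - g x)) ` {-1..1})" by (intro bounded_imp_bdd_above compact_imp_bounded)
  then show ?thesis unfolding sup_dist_def using assms(3) by (intro cSUP_upper)
qed

lemma sup_dist_le:
  assumes "\<And>x. x \<in> {-1..1} \<Longrightarrow> norm (f x - g x) \<le> B"
  shows "sup_dist f g \<le> B"
  unfolding sup_dist_def using assms by (intro cSUP_least) auto

lemma continuous_on_gegen_comb: "continuous_on A (\<lambda>x. \<Sum>j\<in>J. c j * gegenL \<alpha> j x)"
  unfolding gegenL_def by (intro continuous_intros)

section \<open>The class of functions\<close>

locale gegen_class =
  fixes \<theta> \<alpha> r :: real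
  assumes \<theta>: "0 < \<theta>" "\<theta> \<le> 1" and \<alpha>: "\<alpha> > -1/2" and r: "r > \<alpha> + 1/2"
begin

abbreviation "lam \<equiv> \<alpha> + 1/2"
abbreviation "P \<equiv> gegen_poly \<alpha>"

lemma lam: "lam > 0" using \<alpha> by simp
lemma r_pos: "r > 0" using r lam by linarith

lemma orth: "gmean lam (\<lambda>x. poly (P m) x * poly (P n) x) = (if m = n then 1 else 0)"
  by (rule gegen_poly_orthonormal(3)[OF \<alpha>])

definition coeff :: "(real \<Rightarrow> real) \<Rightarrow> nat \<Rightarrow> real" where
  "coeff h k = gmean lam (\<lambda>x. h x * poly (P k) x)"

abbreviation rate :: "nat \<Rightarrow> real" where "rate n \<equiv> real n powr - (r + 1/\<theta> - 1/2)"

lemma classA_components: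
  assumes f: "f \<in> classA r \<alpha> \<theta>" and h: "h = (\<lambda>x. Re (f x)) \<or> h = (\<lambda>x. Im (f x))"
  shows "continuous_on {-1..1} h" and "coeff_ball r \<theta> (coeff h)"
proof -
  let ?c = "\<lambda>k. norm ((1 + real k) powr r * gegen_inner \<alpha> f (gegenL \<alpha> k)) powr \<theta>"
  have cf: "continuous_on {-1..1} f" and sm: "summable ?c" and le: "suminf ?c \<le> 1"
    using f by (auto simp: classA_def)
  show "continuous_on {-1..1} h" using h cf by (auto intro: continuous_on_Re continuous_on_Im)
  let ?w = "\<lambda>k. ((1 + real k) powr r * \<bar>coeff h k\<bar>) powr \<theta>"
  have b: "?w k \<le> ?c k" for k
  proof (rule powr_mono2)
    have "\<bar>coeff h k\<bar> \<le> cmod (gegen_inner \<alpha> f (gegenL \<alpha> k))"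
      using h abs_Re_le_cmod[of "gegen_inner \<alpha> f (gegenL \<alpha> k)"] abs_Im_le_cmod[of "gegen_inner \<alpha> f (gegenL \<alpha> k)"]
      unfolding gegen_inner_gegenL[OF \<alpha> cf] coeff_def by auto
    then show "(1 + real k) powr r * \<bar>coeff h k\<bar> \<le> norm ((1 + real k) powr r * gegen_inner \<alpha> f (gegenL \<alpha> k))"
      unfolding norm_mult by (intro mult_mono) auto
  qed (use \<theta> in auto)
  have s: "summable ?w" by (rule summable_comparison_test'[OF sm]) (use b in simp)
  then show "coeff_ball r \<theta> (coeff h)" using suminf_le[OF b s sm] le by (simp add: coeff_ball_def)
qed

text \<open>Membership in the class gives continuity and small coefficients, not yet a
  representation. As r > lam, the series converges uniformly by the M-test, its sum has the same
  coefficients, and completeness identifies it with h.\<close>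

lemma gegen_expansion:
  assumes pk: "peaked_polys P lam C" and h: "continuous_on {-1..1} h"
    and ball: "coeff_ball r \<theta> (coeff h)"
    and x: "x \<in> {-1..1}"
  shows "h x = (\<Sum>k. coeff h k * poly (P k) x)"
proof -
  interpret peaked_polys P lam C by (rule pk)
  define g where "g x = (\<Sum>k. coeff h k * poly (P k) x)" for x
  note M = summable_mult[OF coeff_ball_summable[OF \<theta> ball], of C]
  have ul: "uniform_limit {-1..1} (\<lambda>n x. \<Sum>k<n. coeff h k * poly (P k) x) g sequentially"
    unfolding g_def by (rule Weierstrass_m_test[OF _ M]) (use abs_term_le[OF _ r, of _ "coeff h"] in auto)
  note g = uniform_limit_gmean_coeff[OF lam orth ul]
  have "h x - g x = 0"
  proof (rule gmean_orthogonal_imp_zero[OF lam, of P "\<lambda>x. h x - g x"])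
    show "degree (P k) = k \<and> P k \<noteq> 0" for k using gegen_poly_orthonormal(1,2)[OF \<alpha>] by simp
    show "continuous_on {-1..1} (\<lambda>x. h x - g x)" by (intro continuous_on_diff h g(1))
    show "gmean lam (\<lambda>x. (h x - g x) * poly (P k) x) = 0" for k
    proof -
      have "gmean lam (\<lambda>x. (h x - g x) * poly (P k) x) = gmean lam (\<lambda>x. h x * poly (P k) x) - gmean lam (\<lambda>x. g x * poly (P k) x)"
        unfolding left_diff_distrib
        by (rule gmean_diff[OF lam]) (intro continuous_on_mult h g(1) continuous_on_poly_fun)+
      then show ?thesis unfolding g(2) by (simp add: coeff_def)
    qed
  qed (rule x)
  then show ?thesis by (simp add: g_def)
qed

definition nterm_dists :: "nat \<Rightarrow> (real \<Rightarrow> complex) \<Rightarrow> real set" where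
  "nterm_dists n f = {sup_dist f (\<lambda>x. \<Sum>j\<in>J. c j * gegenL \<alpha> j x) | J c. finite J \<and> card J = n}"

lemma nterm_dists_nonneg:
  assumes "continuous_on {-1..1} f" "d \<in> nterm_dists n f"
  shows "d \<ge> 0"
proof -
  obtain J c where "d = sup_dist f (\<lambda>x. \<Sum>j\<in>J. c j * gegenL \<alpha> j x)" using assms(2) by (auto simp: nterm_dists_def)
  moreover have "norm (f 0 - (\<Sum>j\<in>J. c j * gegenL \<alpha> j 0)) \<le> sup_dist f (\<lambda>x. \<Sum>j\<in>J. c j * gegenL \<alpha> j x)"
    by (rule sup_dist_ge[OF assms(1) continuous_on_gegen_comb]) simp
  ultimately show ?thesis using norm_ge_zero order_trans by blast
qed

lemma nterm_dists_nonempty: "nterm_dists n f \<noteq> {}"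
proof -
  have "finite {..<n} \<and> card {..<n} = n" by simp
  then show ?thesis unfolding nterm_dists_def by blast
qed

lemma nterm_upper_bound:
  "\<exists>K>0. \<forall>n\<ge>1. \<forall>f\<in>classA r \<alpha> \<theta>. Inf (nterm_dists n f) \<le> K * rate n"
proof -
  obtain C where C: "C > 0" "\<And>n t. \<bar>poly (P n) (cos t)\<bar> \<le> C * (1 + real n) powr lam"
    "\<And>n t. \<bar>sin t\<bar> powr lam * \<bar>poly (P n) (cos t)\<bar> \<le> C"
    using gegen_poly_bounds[OF \<alpha>] by blast
  have pk: "peaked_polys P lam C"
    by unfold_locales (use C lam gegen_poly_orthonormal(1)[OF \<alpha>] in auto)
  interpret peaked_polys P lam C by (rule pk)
  obtain K Q where K: "K > 0" and Q: "Q > 0" and up: "\<And>a y. y > 0 \<Longrightarrow> coeff_ball r \<theta> a \<Longrightarrow>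
     (\<exists>J c. finite J \<and> real (card J) \<le> Q * y \<and> (\<forall>\<xi>\<in>{-1..1}.
        \<bar>(\<Sum>k. a k * poly (P k) \<xi>) - (\<Sum>k\<in>J. c k * poly (P k) \<xi>)\<bar> \<le> K * y powr - (r + 1/\<theta> - 1/2)))"
    using nterm_upper[OF \<theta> r] by blast
  define E where "E = r + 1/\<theta> - 1/2"
  have comp: "\<exists>J c. finite J \<and> real (card J) \<le> Q * y \<and> (\<forall>\<xi>\<in>{-1..1}. \<bar>h \<xi> - (\<Sum>k\<in>J. c k * poly (P k) \<xi>)\<bar> \<le> K * y powr - E)"
    if f: "f \<in> classA r \<alpha> \<theta>" and h: "h = (\<lambda>x. Re (f x)) \<or> h = (\<lambda>x. Im (f x))" and y: "y > 0" for f h y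
  proof -
    note hc = classA_components[OF f h]
    obtain J c where J: "finite J" "real (card J) \<le> Q * y" "\<And>\<xi>. \<xi> \<in> {-1..1} \<Longrightarrow>
        \<bar>(\<Sum>k. coeff h k * poly (P k) \<xi>) - (\<Sum>k\<in>J. c k * poly (P k) \<xi>)\<bar> \<le> K * y powr - E"
      using up[OF y hc(2)] unfolding E_def by blast
    have "\<bar>h \<xi> - (\<Sum>k\<in>J. c k * poly (P k) \<xi>)\<bar> \<le> K * y powr - E" if "\<xi> \<in> {-1..1}" for \<xi>
      unfolding gegen_expansion[OF pk hc that] by (rule J(3)[OF that])
    then show ?thesis using J(1,2) by blast
  qed
  define K' where "K' = 2 * K * (2 * Q) powr E"
  have K': "K' > 0" using K Q by (simp add: K'_def)
  have "Inf (nterm_dists n f) \<le> K' * real n powr - E" if n: "n \<ge> 1" and f: "f \<in> classA r \<alpha> \<theta>" for n f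
  proof -
    \<comment> \<open>Real and imaginary parts get half of the n indices each.\<close>
    define y where "y = real n / (2 * Q)"
    have y: "y > 0" using n Q by (simp add: y_def)
    obtain J1 c1 where 1: "finite J1" "real (card J1) \<le> Q * y"
      "\<And>\<xi>. \<xi> \<in> {-1..1} \<Longrightarrow> \<bar>Re (f \<xi>) - (\<Sum>k\<in>J1. c1 k * poly (P k) \<xi>)\<bar> \<le> K * y powr - E"
      using comp[OF f disjI1[OF refl] y] by blast
    obtain J2 c2 where 2: "finite J2" "real (card J2) \<le> Q * y"
      "\<And>\<xi>. \<xi> \<in> {-1..1} \<Longrightarrow> \<bar>Im (f \<xi>) - (\<Sum>k\<in>J2. c2 k * poly (P k) \<xi>)\<bar> \<le> K * y powr - E"
      using comp[OF f disjI2[OF refl] y] by blast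
    have "card (J1 \<union> J2) \<le> card J1 + card J2" by (rule card_Un_le)
    moreover have "Q * y + Q * y = real n" using Q by (simp add: y_def)
    ultimately have card_le: "card (J1 \<union> J2) \<le> n" using 1(2) 2(2) by linarith
    \<comment> \<open>Exactly n indices are demanded, so the set is padded with further ones whose
      coefficient is 0.\<close>
    have "infinite (- (J1 \<union> J2))" using 1(1) 2(1) by (simp add: Compl_eq_Diff_UNIV Diff_infinite_finite del: Compl_Un)
    then obtain T where T: "finite T" "card T = n - card (J1 \<union> J2)" "T \<subseteq> - (J1 \<union> J2)"
      using infinite_arbitrarily_large by blast
    define J where "J = (J1 \<union> J2) \<union> T"
    have "card J = card (J1 \<union> J2) + card T"
      unfolding J_def using T 1(1) 2(1) by (intro card_Un_disjoint) auto
    then have J: "finite J" "card J = n" using T(1,2) 1(1) 2(1) card_le by (auto simp: J_def)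
    define c where "c k = Complex (if k \<in> J1 then c1 k else 0) (if k \<in> J2 then c2 k else 0)" for k
    have "norm (f x - (\<Sum>j\<in>J. c j * gegenL \<alpha> j x)) \<le> K' * real n powr - E" if x: "x \<in> {-1..1}" for x
    proof -
      have "Re (\<Sum>j\<in>J. c j * gegenL \<alpha> j x) = (\<Sum>j\<in>J1. c1 j * poly (P j) x)"
        unfolding Re_sum using J(1) by (intro sum.mono_neutral_cong_right) (auto simp: J_def c_def gegenL_def)
      moreover have "Im (\<Sum>j\<in>J. c j * gegenL \<alpha> j x) = (\<Sum>j\<in>J2. c2 j * poly (P j) x)"
        unfolding Im_sum using J(1) by (intro sum.mono_neutral_cong_right) (auto simp: J_def c_def gegenL_def)
      ultimately have "norm (f x - (\<Sum>j\<in>J. c j * gegenL \<alpha> j x)) \<le> K * y powr - E + K * y powr - E"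
        using 1(3)[OF x] 2(3)[OF x] by (intro order_trans[OF cmod_le]) (simp add: add_mono)
      also have "y powr - E = real n powr - E * (2 * Q) powr E"
        using n Q by (simp add: y_def powr_divide powr_minus field_simps)
      finally show ?thesis by (simp add: K'_def mult_ac)
    qed
    then have "sup_dist f (\<lambda>x. \<Sum>j\<in>J. c j * gegenL \<alpha> j x) \<le> K' * real n powr - E" by (rule sup_dist_le)
    moreover have "sup_dist f (\<lambda>x. \<Sum>j\<in>J. c j * gegenL \<alpha> j x) \<in> nterm_dists n f"
      using J unfolding nterm_dists_def by blast
    moreover have "continuous_on {-1..1} f" using f by (simp add: classA_def)
    then have "bdd_below (nterm_dists n f)" using nterm_dists_nonneg by (intro bdd_belowI[of _ 0])
    ultimately show ?thesis by (meson cInf_lower order_trans)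
  qed
  then show ?thesis using K' unfolding E_def by blast
qed

lemma nterm_lower_bound:
  assumes n: "n \<ge> 1"
  shows "\<exists>f\<in>classA r \<alpha> \<theta>. Inf (nterm_dists n f) \<ge> 2 powr - (r + 1/\<theta>) * rate n"
proof -
  \<comment> \<open>Each of the 2 n terms may contribute 1 / (2 n) to the sum defining the class,
    and (1 + k) powr r \<le> (2 n) powr r for k < 2 n.\<close>
  define \<delta> where "\<delta> = (2 * real n) powr - (r + 1/\<theta>)"
  have \<delta>: "\<delta> > 0" using n by (simp add: \<delta>_def)
  define f where "f x = (\<Sum>k<2 * n. complex_of_real \<delta> * gegenL \<alpha> k x)" for x
  have cf: "continuous_on {-1..1} f" unfolding f_def by (rule continuous_on_gegen_comb)
  have ref: "Re (f x) = (\<Sum>k<2 * n. \<delta> * poly (P k) x)" and imf: "Im (f x) = 0" for x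
    by (simp_all add: f_def gegenL_def)
  have inner: "gegen_inner \<alpha> f (gegenL \<alpha> m) = (if m < 2 * n then complex_of_real \<delta> else 0)" for m
  proof -
    have "(\<lambda>x. Re (f x) * poly (P m) x) = (\<lambda>x. \<Sum>k<2 * n. \<delta> * (poly (P k) x * poly (P m) x))"
      by (simp add: ref sum_distrib_right mult.assoc)
    then have "gmean lam (\<lambda>x. Re (f x) * poly (P m) x) = (\<Sum>k<2 * n. \<delta> * (if k = m then 1 else 0))"
      by (simp add: gmean_sum[OF lam] gmean_cmult[OF lam] orth continuous_on_mult)
    also have "\<dots> = (if m < 2 * n then \<delta> else 0)" by (simp add: if_distrib[of "\<lambda>x. _ * x"] cong: if_cong)
    finally show ?thesis
      unfolding gegen_inner_gegenL[OF \<alpha> cf] by (simp add: imf gmean_const[OF lam] Complex_eq)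
  qed
  have term_eq: "norm ((1 + real m) powr r * gegen_inner \<alpha> f (gegenL \<alpha> m)) powr \<theta>
      = (if m < 2 * n then ((1 + real m) powr r * \<delta>) powr \<theta> else 0)" for m
    using \<delta> by (simp add: inner norm_mult)
  have "f \<in> classA r \<alpha> \<theta>"
  proof -
    have "(\<Sum>m<2 * n. ((1 + real m) powr r * \<delta>) powr \<theta>) \<le> (\<Sum>m<2 * n. 1 / (2 * real n))"
    proof (rule sum_mono)
      fix m assume "m \<in> {..<2 * n}"
      then have "(1 + real m) powr r * \<delta> \<le> (2 * real n) powr r * \<delta>"
        using \<delta> r_pos by (intro mult_right_mono powr_mono2) auto
      also have "\<dots> = (2 * real n) powr (r + - (r + 1/\<theta>))" unfolding \<delta>_def by (rule powr_add[symmetric])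
      also have "\<dots> = (2 * real n) powr (- 1/\<theta>)" by simp
      finally have "((1 + real m) powr r * \<delta>) powr \<theta> \<le> ((2 * real n) powr (- 1/\<theta>)) powr \<theta>"
        using \<delta> \<theta> by (intro powr_mono2) auto
      also have "\<dots> = 1 / (2 * real n)" using \<theta> n by (simp add: powr_powr powr_minus_divide powr_divide)
      finally show "((1 + real m) powr r * \<delta>) powr \<theta> \<le> 1 / (2 * real n)" .
    qed
    also have "\<dots> = 1" using n by simp
    finally have le: "(\<Sum>m<2 * n. ((1 + real m) powr r * \<delta>) powr \<theta>) \<le> 1" .
    have fin: "finite {..<2 * n}" by simp
    have "(\<lambda>m. norm ((1 + real m) powr r * gegen_inner \<alpha> f (gegenL \<alpha> m)) powr \<theta>) sums
        (\<Sum>m<2 * n. norm ((1 + real m) powr r * gegen_inner \<alpha> f (gegenL \<alpha> m)) powr \<theta>)"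
      by (rule sums_finite[OF fin]) (simp add: term_eq)
    moreover have "(\<Sum>m<2 * n. norm ((1 + real m) powr r * gegen_inner \<alpha> f (gegenL \<alpha> m)) powr \<theta>) \<le> 1"
      using le by (simp add: term_eq)
    ultimately show ?thesis unfolding classA_def using cf by (auto simp: sums_iff)
  qed
  moreover have "Inf (nterm_dists n f) \<ge> 2 powr - (r + 1/\<theta>) * rate n"
  proof (rule cInf_greatest[OF nterm_dists_nonempty])
    fix d assume "d \<in> nterm_dists n f"
    then obtain J c where J: "finite J" "card J = n" and d: "d = sup_dist f (\<lambda>x. \<Sum>j\<in>J. c j * gegenL \<alpha> j x)"
      by (auto simp: nterm_dists_def)
    define U where "U = {..<2 * n} \<union> J"
    \<comment> \<open>Since f is real, the real part of the difference is no farther from 0 and has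
      real coefficients, to which Parseval applies.\<close>
    define e where "e k = (if k < 2 * n then \<delta> else 0) - (if k \<in> J then Re (c k) else 0)" for k
    define w where "w x = (\<Sum>k\<in>U. e k * poly (P k) x)" for x
    have U: "finite U" using J by (simp add: U_def)
    have we: "w x = Re (f x - (\<Sum>j\<in>J. c j * gegenL \<alpha> j x))" for x
    proof -
      have "(\<Sum>k\<in>U. (if k < 2 * n then \<delta> else 0) * poly (P k) x) = (\<Sum>k<2 * n. \<delta> * poly (P k) x)"
        using U by (intro sum.mono_neutral_cong_right) (auto simp: U_def)
      moreover have "(\<Sum>k\<in>U. (if k \<in> J then Re (c k) else 0) * poly (P k) x) = (\<Sum>k\<in>J. Re (c k) * poly (P k) x)"
        using U by (intro sum.mono_neutral_cong_right) (auto simp: U_def)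
      moreover have "Re (\<Sum>j\<in>J. c j * gegenL \<alpha> j x) = (\<Sum>k\<in>J. Re (c k) * poly (P k) x)"
        by (simp add: gegenL_def)
      ultimately show ?thesis by (simp add: w_def e_def left_diff_distrib sum_subtractf ref)
    qed
    have wd: "\<bar>w x\<bar> \<le> d" if "x \<in> {-1..1}" for x
      unfolding we d using sup_dist_ge[OF cf continuous_on_gegen_comb that] abs_Re_le_cmod order_trans by blast
    have d0: "d \<ge> 0" using wd[of 0] by simp
    have cw: "continuous_on {-1..1} w" unfolding w_def by (intro continuous_intros)
    have "\<bar>gmean lam (\<lambda>x. (w x)\<^sup>2)\<bar> \<le> d\<^sup>2"
    proof (rule gmean_abs_le[OF lam])
      show "continuous_on {-1..1} (\<lambda>x. (w x)\<^sup>2)" by (intro continuous_on_power cw)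
      show "\<bar>(w x)\<^sup>2\<bar> \<le> d\<^sup>2" if "x \<in> {-1..1}" for x
        using wd[OF that] d0 by (simp add: abs_le_square_iff[symmetric])
    qed
    then have "(\<Sum>k\<in>U. (e k)\<^sup>2) \<le> d\<^sup>2"
      unfolding w_def gmean_parseval[OF lam U orth] by linarith
    moreover have "real n * \<delta>\<^sup>2 \<le> (\<Sum>k\<in>U. (e k)\<^sup>2)"
    proof -
      have "2 * n - card J \<le> card ({..<2 * n} - J)"
        using diff_card_le_card_Diff[OF J(1), of "{..<2 * n}"] by simp
      then have "n \<le> card ({..<2 * n} - J)" using J(2) by simp
      then have "real n * \<delta>\<^sup>2 \<le> real (card ({..<2 * n} - J)) * \<delta>\<^sup>2" by (intro mult_right_mono) auto
      also have "\<dots> = (\<Sum>k\<in>{..<2 * n} - J. (e k)\<^sup>2)" by (simp add: e_def)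
      also have "\<dots> \<le> (\<Sum>k\<in>U. (e k)\<^sup>2)" using U by (intro sum_mono2) (auto simp: U_def)
      finally show ?thesis .
    qed
    ultimately have "(sqrt (real n) * \<delta>)\<^sup>2 \<le> d\<^sup>2" by (simp add: power_mult_distrib)
    then have "sqrt (real n) * \<delta> \<le> d" using d0 by (rule power2_le_imp_le)
    moreover have "sqrt (real n) * \<delta> = 2 powr - (r + 1/\<theta>) * rate n"
    proof -
      have "sqrt (real n) * real n powr - (r + 1/\<theta>) = real n powr (1/2 + - (r + 1/\<theta>))"
        unfolding powr_add by (simp add: powr_half_sqrt)
      moreover have "1/2 + - (r + 1/\<theta>) = - (r + 1/\<theta> - 1/2)" by simp
      ultimately have s: "sqrt (real n) * real n powr - (r + 1/\<theta>) = rate n"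
        by (simp only:)
      have \<delta>_eq: "\<delta> = 2 powr - (r + 1/\<theta>) * real n powr - (r + 1/\<theta>)" unfolding \<delta>_def by (rule powr_mult)
      show ?thesis unfolding \<delta>_eq s[symmetric] by (rule mult.left_commute)
    qed
    ultimately show "2 powr - (r + 1/\<theta>) * rate n \<le> d" by simp
  qed
  ultimately show ?thesis by blast
qed

end

theorem theorem6p3:
  fixes \<theta> \<alpha> r :: real
  assumes "0 < \<theta>" and "\<theta> \<le> 1" and "\<alpha> > -1/2" and "r > \<alpha> + 1/2"
  shows "\<exists>c1 > 0. \<exists>C2 > 0. \<forall>n::nat. n \<ge> 1 \<longrightarrow>
           c1 * real n powr (-(r + 1/\<theta> - 1/2)) \<le> sigma_n n \<alpha> (classA r \<alpha> \<theta>) \<and>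
           sigma_n n \<alpha> (classA r \<alpha> \<theta>) \<le> C2 * real n powr (-(r + 1/\<theta> - 1/2))"
proof -
  interpret gegen_class \<theta> \<alpha> r by unfold_locales (use assms in auto)
  obtain K where K: "K > 0" "\<And>n f. n \<ge> 1 \<Longrightarrow> f \<in> classA r \<alpha> \<theta> \<Longrightarrow>
      Inf (nterm_dists n f) \<le> K * rate n"
    using nterm_upper_bound by blast
  have sig: "sigma_n n \<alpha> F = Sup ((\<lambda>f. Inf (nterm_dists n f)) ` F)" for n F
    by (simp add: sigma_n_def nterm_dists_def)
  have "2 powr - (r + 1/\<theta>) * rate n \<le> sigma_n n \<alpha> (classA r \<alpha> \<theta>) \<and>
     sigma_n n \<alpha> (classA r \<alpha> \<theta>) \<le> K * rate n" if n: "n \<ge> 1" for n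
  proof -
    obtain f where f: "f \<in> classA r \<alpha> \<theta>" "2 powr - (r + 1/\<theta>) * rate n \<le> Inf (nterm_dists n f)"
      using nterm_lower_bound[OF n] by blast
    \<comment> \<open>A real \<open>Sup\<close> is informative only for a nonempty set bounded
      above: the upper estimate gives the bound, and f from the lower estimate the
      nonemptiness.\<close>
    have "bdd_above ((\<lambda>f. Inf (nterm_dists n f)) ` classA r \<alpha> \<theta>)"
      using K(2)[OF n] by (intro bdd_aboveI2)
    then have "Inf (nterm_dists n f) \<le> sigma_n n \<alpha> (classA r \<alpha> \<theta>)"
      unfolding sig using f(1) by (intro cSUP_upper)
    moreover have "sigma_n n \<alpha> (classA r \<alpha> \<theta>) \<le> K * rate n"
      unfolding sig using f(1) K(2)[OF n] by (intro cSUP_least) auto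
    ultimately show ?thesis using f(2) by linarith
  qed
  moreover have "(2::real) powr - (r + 1/\<theta>) > 0" by simp
  ultimately show ?thesis using K(1) by blast
qed

end
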